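(* Let $S=(W,\mathcal W,m,\mathbb D,\Gamma)$ be an error structure admitting a D-gradient $D:\mathbb D\to L^2(m,H)$ with $H$ a separable Hilbert space, let $\nu$ be an $H$-valued white noise measure on $(W,\mathcal W)$ with associated positive measure $m$, and let $X\in\mathbb D^d$. Let $U$ be a map from $\mathbb R^d$ into $\mathbb R^p$ such that $U\in(\mathbb D_X)^p$, and let $V$ be a map from $\mathbb R^p$ into $\mathbb R^q$ such that $V\circ U\in(\mathbb D_X)^q$ and $V\in(\mathbb D_{U\circ X})^q$. Then $$(\nabla_X(V\circ U))^t=(\nabla_{U\circ X}V)^t\circ U\cdot(\nabla_XU)^t$$ (equality, row by row, in the space $L^2(\mathbb R^d,\underline{\underline{\Gamma}}_X[I]\cdot X_*m)$).
   Context: **Error structure.** $(W,\mathcal W,m,\mathbb D,\Gamma)$ is an error structure if $(W,\mathcal W,m)$ is a probability space and: (1) $\mathbb D$ is a dense vector subspace of $L^2(W,\mathcal W,m)$; (2) $\Gamma$ is a symmetric positive bilinear operator from $\mathbb D\times\mathbb D$ into $L^1(m)$ such that for $u\in\mathbb D^k$, $v\in\mathbb D^n$ and $F:\mathbb R^k\to\mathbb R$, $G:\mathbb R^n\to\mathbb R$ Lipschitz and $C^1$, one has $F(u)\in\mathbb D$, $G(v)\in\mathbb D$ and $\Gamma[F(u),G(v)]=\sum_{i,j}F_i'(u)G_j'(v)\Gamma[u_i,v_j]$ $m$-a.e.; (3) the form $\mathcal E[u,v]=\frac12\int\Gamma[u,v]\,dm$ is closed, i.e. $\mathbb D$ is complete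 for the norm $\|u\|_{\mathbb D}=(\|u\|_{L^2(m)}^2+\mathcal E[u,u])^{1/2}$. One writes $\Gamma[u]=\Gamma[u,u]$. **Image structure.** For $X\in\mathbb D^d$, $S_X=(\mathbb R^d,\mathcal B(\mathbb R^d),X_*m,\mathbb D_X,\Gamma_X)$, where $X_*m$ is the image measure of $m$ by $X$, $\mathbb D_X$ is the closure (in $L^2(X_*m)$-classes) of the space of $C^1$ Lipschitz functions $u:\mathbb R^d\to\mathbb R$ for the norm $\|u\|_{\mathbb D_X}=\|u\circ X\|_{\mathbb D}$, and $\Gamma_X[u](x)=\mathbb E[\Gamma[u\circ X]\mid X=x]$ (conditional expectation under $m$; $\Gamma_X[u,v]$ by polarization). $S_X$ is again an error structure (known), and $F\in\mathbb D_X$ implies $F\circ X\in\mathbb D$. The identity map $I=(I_1,\dots,I_d)$ of $\mathbb R^d$ belongs to $(\mathbb D_X)^d$. If $U\in(\mathbb D_X)^p$ then $U\circ X\in\mathbb D^p$, and $\mathbb D_{U\circ X}$ is the domain of the image structure $S_{U\circ X}$ on $\mathbb R^p$, defined in the same way with $U\circ X$ in place of $X$. **D-gradient.** A D-gradient for the error structure, with auxiliary separable Hilbert space $H$, is a linear map $D:\mathbb D\to L^2(m,H)$ with $\|D[U]\|_H^2=\Gamma[U]$ $m$-a.e. for all $U\in\mathbb D$. **Scalar white noise measures.** Let $\mu$ be a bounded positive measure on a measurable space $(E,\mathcal F)$. A (Gaussian) white noise measure on $(E,\mathcal F)$ defined on a probability space $(\Omega,\mathcal A,\mathbb P)$ with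 associated positive measure $\mu$ is a map $\lambda:\mathcal F\to L^2(\Omega,\mathcal A,\mathbb P)$ such that $\lambda(A)$ is a centered Gaussian variable with variance $\mu(A)$ for all $A\in\mathcal F$; $A\mapsto\lambda(A)$ is $\sigma$-additive in $L^2(\Omega,\mathcal A,\mathbb P)$; and $\lambda(A_1),\dots,\lambda(A_k)$ are independent whenever $A_1,\dots,A_k\in\mathcal F$ are pairwise disjoint. It extends uniquely to a linear isometry $f\mapsto\lambda(f)=\int f\,d\lambda$ from $L^2(E,\mathcal F,\mu)$ into $L^2(\Omega,\mathcal A,\mathbb P)$. Equalities between white noise measures mean equality in $L^2(\Omega,\mathcal A,\mathbb P)$ of the values on every measurable set. **$H$-valued white noise and measure-valued gradient.** An $H$-valued white noise measure $\nu$ on $(W,\mathcal W)$ with associated positive measure $m$ is the formal series $\nu=\sum_n\nu_n\chi_n$, where $(\chi_n)$ is a complete orthonormal system of $H$ and $(\nu_n)$ are independent scalar white noise measures on $(W,\mathcal W)$, defined on a common probability space $(\Omega,\mathcal A,\mathbb P)$, each with associated positive measure $m$. For $\psi\in L^2(m,H)$, $(\psi,\nu)$ is the scalar white noise measure on $(W,\mathcal W)$ defined by $(\psi,\nu)(A)=\sum_n\nu_n(1_A\langle\psi,\chi_n\rangle_H)$, $A\in\mathcal W$ (series converging in $L^2(\Omega,\mathcal A,\mathbb P)$); its associated positive measure is $\|\psi\|_H^2\cdot m$. For $Y\in\mathbb D$, the measure-valued gradient of $Y$ is $d_GY=(DY,\nu)$; for $Y\in\mathbb D^d$, $d_GY$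 is the column vector $(d_GY_1,\dots,d_GY_d)^t$, an $\mathbb R^d$-valued white noise measure. **Images.** For a white noise measure $\lambda$ on $(W,\mathcal W)$, $X_*\lambda$ is defined by $(X_*\lambda)(A)=\lambda(X^{-1}(A))$, $A\in\mathcal B(\mathbb R^d)$ (componentwise for vector-valued $\lambda$). For $F\in\mathbb D_X$, $d_GF=X_*(d_G(F\circ X))$; for $\Phi=(\Phi_1,\dots,\Phi_k)\in(\mathbb D_X)^k$, $d_G\Phi$ is the column vector $(d_G\Phi_i)$. In particular $d_GI=X_*d_GX$. **Weighted $L^2$ spaces and products.** $\underline{\underline{\Gamma}}_X[I]$ is the matrix $(\Gamma_X[I_i,I_j])_{ij}$. $L^2(\mathbb R^d,\underline{\underline{\Gamma}}_X[I]\cdot X_*m)$ is the space of $d$-tuples $v=(v_1,\dots,v_d)$ (column vectors) of measurable functions on $\mathbb R^d$ with $\|v\|^2=\int v^t\underline{\underline{\Gamma}}_X[I]v\,dX_*m<\infty$, where $v,v'$ are identified if $\|v-v'\|=0$. For bounded measurable $\varphi:\mathbb R^d\to\mathbb R^d$, $\varphi^t\,d_GI$ is the map $A\mapsto\sum_i\int1_A\varphi_i\,d(d_GI_i)$; since $\mathbb E_{\mathbb P}[(\varphi^t d_GI)(A)^2]=\int_A\varphi^t\underline{\underline{\Gamma}}_X[I]\varphi\,dX_*m$, this extends by continuity to $\varphi\in L^2(\mathbb R^d,\underline{\underline{\Gamma}}_X[I]\cdot X_*m)$. **The gradient $\nabla_X$.** For $F\in\mathbb D_X$, $\nabla_XF$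 is the element of $L^2(\mathbb R^d,\underline{\underline{\Gamma}}_X[I]\cdot X_*m)$ (it exists and is unique) such that $d_GF=(\nabla_XF)^t\,d_GI$. For $U=(U_1,\dots,U_p)\in(\mathbb D_X)^p$, $\nabla_XU$ is the $d\times p$ matrix whose columns are $\nabla_XU_1,\dots,\nabla_XU_p$. $\nabla_{U\circ X}V$ is the analogous $p\times q$ matrix of functions on $\mathbb R^p$ for the image structure $S_{U\circ X}$. *)

theory Defs
  imports "HOL-Probability.Probability"
begin

text \<open>
  Elements of $L^2$ spaces are represented by measurable functions; two representatives of the same
  class are related by equality almost everywhere.
\<close>

section \<open>$L^2$ spaces\<close>

definition L2 :: "'a measure \<Rightarrow> ('a \<Rightarrow> real) set" where
  "L2 M = {f \<in> borel_measurable M. integrable M (\<lambda>x. (f x)\<^sup>2)}"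

text \<open>
  The membership conditions are needed: the Bochner integral of a function that is not integrable
  is \<open>0\<close>.
\<close>

definition L2_tendsto :: "'a measure \<Rightarrow> (nat \<Rightarrow> 'a \<Rightarrow> real) \<Rightarrow> ('a \<Rightarrow> real) \<Rightarrow> bool" where
  "L2_tendsto M Z Y \<longleftrightarrow> (\<forall>k. Z k \<in> L2 M) \<and> Y \<in> L2 M \<and>
     (\<lambda>k. \<integral>x. (Z k x - Y x)\<^sup>2 \<partial>M) \<longlonglongrightarrow> 0"

definition L2_lim :: "'a measure \<Rightarrow> (nat \<Rightarrow> 'a \<Rightarrow> real) \<Rightarrow> 'a \<Rightarrow> real" where
  "L2_lim M Z = (SOME Y. L2_tendsto M Z Y)"


section \<open>Error structures\<close>

text \<open>
  \<open>C1_Lipschitz_nat k F F'\<close>: the function \<open>F\<close> on \<open>\<real>\<^sup>k\<close> is Lipschitz and of class \<open>C\<^sup>1\<close>, with partial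
  derivatives \<open>F' 0, \<dots>, F' (k - 1)\<close>. As \<open>k\<close> has to range over all natural numbers, a point of \<open>\<real>\<^sup>k\<close>
  is given by the first \<open>k\<close> entries of a function \<open>nat \<Rightarrow> real\<close>. The Lipschitz condition forces \<open>F\<close>,
  and hence each \<open>F' i\<close>, to depend on these entries only, so that continuity for the product
  topology on \<open>nat \<Rightarrow> real\<close> is continuity on \<open>\<real>\<^sup>k\<close>.
\<close>

definition C1_Lipschitz_nat ::
    "nat \<Rightarrow> ((nat \<Rightarrow> real) \<Rightarrow> real) \<Rightarrow> (nat \<Rightarrow> (nat \<Rightarrow> real) \<Rightarrow> real) \<Rightarrow> bool" where
  "C1_Lipschitz_nat k F F' \<longleftrightarrow>
     (\<exists>C. \<forall>x y. \<bar>F x - F y\<bar> \<le> C * L2_set (\<lambda>i. x i - y i) {..<k}) \<and>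
     (\<forall>i<k. continuous_on UNIV (F' i) \<and>
        (\<forall>x. ((\<lambda>t. F (x(i := t))) has_real_derivative F' i x) (at (x i))))"

definition D_norm :: "'w measure \<Rightarrow> (('w \<Rightarrow> real) \<Rightarrow> ('w \<Rightarrow> real) \<Rightarrow> 'w \<Rightarrow> real) \<Rightarrow> ('w \<Rightarrow> real) \<Rightarrow> real"
  where "D_norm M \<Gamma> u = sqrt ((\<integral>w. (u w)\<^sup>2 \<partial>M) + 1/2 * (\<integral>w. \<Gamma> u u w \<partial>M))"

locale error_structure = prob_space M
  for M :: "'w measure"
    and \<D> :: "('w \<Rightarrow> real) set"
    and \<Gamma> :: "('w \<Rightarrow> real) \<Rightarrow> ('w \<Rightarrow> real) \<Rightarrow> 'w \<Rightarrow> real" +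
  assumes domain_L2: "\<D> \<subseteq> L2 M"
    and domain_AE: "u \<in> \<D> \<Longrightarrow> u' \<in> borel_measurable M \<Longrightarrow> (AE w in M. u w = u' w) \<Longrightarrow> u' \<in> \<D>"
    and domain_zero: "(\<lambda>w. 0) \<in> \<D>"
    and domain_add: "u \<in> \<D> \<Longrightarrow> v \<in> \<D> \<Longrightarrow> (\<lambda>w. u w + v w) \<in> \<D>"
    and domain_scale: "u \<in> \<D> \<Longrightarrow> (\<lambda>w. c * u w) \<in> \<D>"
    and domain_dense: "f \<in> L2 M \<Longrightarrow> \<epsilon> > 0 \<Longrightarrow> \<exists>u\<in>\<D>. sqrt (\<integral>w. (f w - u w)\<^sup>2 \<partial>M) < \<epsilon>"
    and Gamma_integrable: "u \<in> \<D> \<Longrightarrow> v \<in> \<D> \<Longrightarrow> integrable M (\<Gamma> u v)"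
    and Gamma_AE: "u \<in> \<D> \<Longrightarrow> u' \<in> \<D> \<Longrightarrow> v \<in> \<D> \<Longrightarrow> (AE w in M. u w = u' w) \<Longrightarrow>
           AE w in M. \<Gamma> u v w = \<Gamma> u' v w"
    and Gamma_sym: "u \<in> \<D> \<Longrightarrow> v \<in> \<D> \<Longrightarrow> AE w in M. \<Gamma> u v w = \<Gamma> v u w"
    and Gamma_pos: "u \<in> \<D> \<Longrightarrow> AE w in M. 0 \<le> \<Gamma> u u w"
    and Gamma_add: "u \<in> \<D> \<Longrightarrow> u' \<in> \<D> \<Longrightarrow> v \<in> \<D> \<Longrightarrow>
           AE w in M. \<Gamma> (\<lambda>w. u w + u' w) v w = \<Gamma> u v w + \<Gamma> u' v w"
    and Gamma_scale: "u \<in> \<D> \<Longrightarrow> v \<in> \<D> \<Longrightarrow> AE w in M. \<Gamma> (\<lambda>w. c * u w) v w = c * \<Gamma> u v w"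
    and domain_C1: "C1_Lipschitz_nat k F F' \<Longrightarrow> (\<And>i. i < k \<Longrightarrow> us i \<in> \<D>) \<Longrightarrow>
           (\<lambda>w. F (\<lambda>i. us i w)) \<in> \<D>"
    and Gamma_C1: "C1_Lipschitz_nat k F F' \<Longrightarrow> (\<And>i. i < k \<Longrightarrow> us i \<in> \<D>) \<Longrightarrow>
           C1_Lipschitz_nat n G G' \<Longrightarrow> (\<And>j. j < n \<Longrightarrow> vs j \<in> \<D>) \<Longrightarrow>
           AE w in M. \<Gamma> (\<lambda>w. F (\<lambda>i. us i w)) (\<lambda>w. G (\<lambda>j. vs j w)) w =
             (\<Sum>i<k. \<Sum>j<n. F' i (\<lambda>i. us i w) * G' j (\<lambda>j. vs j w) * \<Gamma> (us i) (vs j) w)"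
    and closed_form: "(\<And>k. s k \<in> \<D>) \<Longrightarrow>
           (\<forall>\<epsilon>>0. \<exists>n0. \<forall>k\<ge>n0. \<forall>l\<ge>n0. D_norm M \<Gamma> (\<lambda>w. s k w - s l w) < \<epsilon>) \<Longrightarrow>
           \<exists>u\<in>\<D>. (\<lambda>k. D_norm M \<Gamma> (\<lambda>w. s k w - u w)) \<longlonglongrightarrow> 0"

text \<open>The separable Hilbert space \<open>H\<close> is the type \<open>'h\<close>.\<close>

definition D_gradient ::
    "'w measure \<Rightarrow> ('w \<Rightarrow> real) set \<Rightarrow> (('w \<Rightarrow> real) \<Rightarrow> ('w \<Rightarrow> real) \<Rightarrow> 'w \<Rightarrow> real) \<Rightarrow>
     (('w \<Rightarrow> real) \<Rightarrow> 'w \<Rightarrow> 'h::{real_inner, banach, second_countable_topology}) \<Rightarrow> bool" where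
  "D_gradient M \<D> \<Gamma> Dg \<longleftrightarrow>
     (\<forall>u\<in>\<D>. Dg u \<in> borel_measurable M \<and> integrable M (\<lambda>w. (norm (Dg u w))\<^sup>2)) \<and>
     (\<forall>u\<in>\<D>. \<forall>u'\<in>\<D>. (AE w in M. u w = u' w) \<longrightarrow> (AE w in M. Dg u w = Dg u' w)) \<and>
     (\<forall>u\<in>\<D>. \<forall>v\<in>\<D>. AE w in M. Dg (\<lambda>w. u w + v w) w = Dg u w + Dg v w) \<and>
     (\<forall>u\<in>\<D>. \<forall>c. AE w in M. Dg (\<lambda>w. c * u w) w = c *\<^sub>R Dg u w) \<and>
     (\<forall>u\<in>\<D>. AE w in M. (norm (Dg u w))\<^sup>2 = \<Gamma> u u w)"


section \<open>Image structures\<close>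

definition C1_Lipschitz :: "(real^'d \<Rightarrow> real) \<Rightarrow> bool" where
  "C1_Lipschitz u \<longleftrightarrow>
     (\<exists>C. C-lipschitz_on UNIV u) \<and>
     (\<exists>g. (\<forall>x. GDERIV u x :> g x) \<and> continuous_on UNIV g)"

text \<open>
  The closure is taken among the measurable functions \<open>F\<close> for which the norm of \<open>F \<circ> X\<close> makes sense,
  that is \<open>F \<circ> X \<in> \<D>\<close>. As \<open>\<D>\<close> is complete, this gives the same space as the completion realized
  inside $L^2(X_*m)$.
\<close>

definition image_domain ::
    "'w measure \<Rightarrow> ('w \<Rightarrow> real) set \<Rightarrow> (('w \<Rightarrow> real) \<Rightarrow> ('w \<Rightarrow> real) \<Rightarrow> 'w \<Rightarrow> real) \<Rightarrow>
     ('w \<Rightarrow> real^'d) \<Rightarrow> (real^'d \<Rightarrow> real) set" where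
  "image_domain M \<D> \<Gamma> X =
     {F \<in> borel_measurable borel. (\<lambda>w. F (X w)) \<in> \<D> \<and>
        (\<forall>\<epsilon>>0. \<exists>u. C1_Lipschitz u \<and> D_norm M \<Gamma> (\<lambda>w. u (X w) - F (X w)) < \<epsilon>)}"

definition cond_exp_at :: "'w measure \<Rightarrow> ('w \<Rightarrow> real^'d) \<Rightarrow> ('w \<Rightarrow> real) \<Rightarrow> real^'d \<Rightarrow> real" where
  "cond_exp_at M X f = (SOME g. g \<in> borel_measurable borel \<and>
     (AE w in M. g (X w) = real_cond_exp M (vimage_algebra (space M) X borel) f w))"

definition image_Gamma1 ::
    "'w measure \<Rightarrow> (('w \<Rightarrow> real) \<Rightarrow> ('w \<Rightarrow> real) \<Rightarrow> 'w \<Rightarrow> real) \<Rightarrow> ('w \<Rightarrow> real^'d) \<Rightarrow>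
     (real^'d \<Rightarrow> real) \<Rightarrow> real^'d \<Rightarrow> real" where
  "image_Gamma1 M \<Gamma> X u = cond_exp_at M X (\<Gamma> (\<lambda>w. u (X w)) (\<lambda>w. u (X w)))"

definition image_Gamma ::
    "'w measure \<Rightarrow> (('w \<Rightarrow> real) \<Rightarrow> ('w \<Rightarrow> real) \<Rightarrow> 'w \<Rightarrow> real) \<Rightarrow> ('w \<Rightarrow> real^'d) \<Rightarrow>
     (real^'d \<Rightarrow> real) \<Rightarrow> (real^'d \<Rightarrow> real) \<Rightarrow> real^'d \<Rightarrow> real" where
  "image_Gamma M \<Gamma> X u v x =
     (image_Gamma1 M \<Gamma> X (\<lambda>y. u y + v y) x - image_Gamma1 M \<Gamma> X (\<lambda>y. u y - v y) x) / 4"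

definition Gamma_matrix ::
    "'w measure \<Rightarrow> (('w \<Rightarrow> real) \<Rightarrow> ('w \<Rightarrow> real) \<Rightarrow> 'w \<Rightarrow> real) \<Rightarrow> ('w \<Rightarrow> real^'d) \<Rightarrow>
     real^'d \<Rightarrow> real^'d^'d" where
  "Gamma_matrix M \<Gamma> X x = (\<chi> i j. image_Gamma M \<Gamma> X (\<lambda>y. y $ i) (\<lambda>y. y $ j) x)"


section \<open>White noise measures\<close>

definition centered_gaussian :: "'o measure \<Rightarrow> ('o \<Rightarrow> real) \<Rightarrow> real \<Rightarrow> bool" where
  "centered_gaussian P Z v \<longleftrightarrow> Z \<in> borel_measurable P \<and>
     (if v = 0 then AE \<omega> in P. Z \<omega> = 0
      else distributed P lborel Z (normal_density 0 (sqrt v)))"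

definition white_noise :: "'o measure \<Rightarrow> 'e measure \<Rightarrow> ('e set \<Rightarrow> 'o \<Rightarrow> real) \<Rightarrow> bool" where
  "white_noise P \<mu> lam \<longleftrightarrow> prob_space P \<and> finite_measure \<mu> \<and>
     (\<forall>A\<in>sets \<mu>. lam A \<in> L2 P \<and> centered_gaussian P (lam A) (measure \<mu> A)) \<and>
     (\<forall>A. range A \<subseteq> sets \<mu> \<longrightarrow> disjoint_family A \<longrightarrow>
        L2_tendsto P (\<lambda>k \<omega>. \<Sum>i<k. lam (A i) \<omega>) (lam (\<Union>i. A i))) \<and>
     (\<forall>k::nat. \<forall>A. (\<forall>i<k. A i \<in> sets \<mu>) \<longrightarrow> disjoint_family_on A {..<k} \<longrightarrow>
        prob_space.indep_vars P (\<lambda>_. borel) (\<lambda>i. lam (A i)) {..<k})"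

text \<open>
  \<open>wn_extension P \<mu> lam J\<close>: \<open>J\<close> is a linear isometry from $L^2(\mu)$ into $L^2(P)$ extending \<open>lam\<close>.
\<close>

definition wn_extension ::
    "'o measure \<Rightarrow> 'e measure \<Rightarrow> ('e set \<Rightarrow> 'o \<Rightarrow> real) \<Rightarrow> (('e \<Rightarrow> real) \<Rightarrow> 'o \<Rightarrow> real) \<Rightarrow> bool" where
  "wn_extension P \<mu> lam J \<longleftrightarrow>
     (\<forall>f\<in>L2 \<mu>. J f \<in> L2 P \<and> (\<integral>\<omega>. (J f \<omega>)\<^sup>2 \<partial>P) = (\<integral>x. (f x)\<^sup>2 \<partial>\<mu>)) \<and>
     (\<forall>f\<in>L2 \<mu>. \<forall>g\<in>L2 \<mu>. AE \<omega> in P. J (\<lambda>x. f x + g x) \<omega> = J f \<omega> + J g \<omega>) \<and>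
     (\<forall>f\<in>L2 \<mu>. \<forall>c. AE \<omega> in P. J (\<lambda>x. c * f x) \<omega> = c * J f \<omega>) \<and>
     (\<forall>A\<in>sets \<mu>. AE \<omega> in P. J (indicator A) \<omega> = lam A \<omega>)"

definition wn_integral ::
    "'o measure \<Rightarrow> 'e measure \<Rightarrow> ('e set \<Rightarrow> 'o \<Rightarrow> real) \<Rightarrow> ('e \<Rightarrow> real) \<Rightarrow> 'o \<Rightarrow> real" where
  "wn_integral P \<mu> lam = (SOME J. wn_extension P \<mu> lam J)"

text \<open>
  The index set \<open>N\<close> of the complete orthonormal system is a subset of \<open>nat\<close>, so that
  finite-dimensional \<open>H\<close> are covered.
\<close>

definition complete_orthonormal :: "nat set \<Rightarrow> (nat \<Rightarrow> 'h::real_inner) \<Rightarrow> bool" where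
  "complete_orthonormal N e \<longleftrightarrow>
     (\<forall>i\<in>N. \<forall>j\<in>N. e i \<bullet> e j = (if i = j then 1 else 0)) \<and> closure (span (e ` N)) = UNIV"

text \<open>
  Independence of the white noise measures \<open>\<nu> n\<close> is independence of the whole families
  \<open>(\<nu> n A)\<close>, \<open>A \<in> sets M\<close>, seen as random elements of the product space.
\<close>

definition hilbert_white_noise ::
    "'o measure \<Rightarrow> 'w measure \<Rightarrow> nat set \<Rightarrow> (nat \<Rightarrow> 'h::real_inner) \<Rightarrow>
     (nat \<Rightarrow> 'w set \<Rightarrow> 'o \<Rightarrow> real) \<Rightarrow> bool" where
  "hilbert_white_noise P M N e \<nu> \<longleftrightarrow> prob_space P \<and> complete_orthonormal N e \<and>
     (\<forall>n\<in>N. white_noise P M (\<nu> n)) \<and>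
     prob_space.indep_vars P (\<lambda>_. Pi\<^sub>M (sets M) (\<lambda>_. borel)) (\<lambda>n \<omega>. \<lambda>A\<in>sets M. \<nu> n A \<omega>) N"

definition wn_inner ::
    "'o measure \<Rightarrow> 'w measure \<Rightarrow> nat set \<Rightarrow> (nat \<Rightarrow> 'h::real_inner) \<Rightarrow>
     (nat \<Rightarrow> 'w set \<Rightarrow> 'o \<Rightarrow> real) \<Rightarrow> ('w \<Rightarrow> 'h) \<Rightarrow> 'w set \<Rightarrow> 'o \<Rightarrow> real" where
  "wn_inner P M N e \<nu> \<psi> A =
     L2_lim P (\<lambda>k \<omega>. \<Sum>n\<in>N \<inter> {..<k}. wn_integral P M (\<nu> n) (\<lambda>w. indicator A w * (\<psi> w \<bullet> e n)) \<omega>)"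

text \<open>The measure-valued gradient $d_G$ on \<open>\<D>\<close>.\<close>

definition measure_gradient ::
    "'o measure \<Rightarrow> 'w measure \<Rightarrow> nat set \<Rightarrow> (nat \<Rightarrow> 'h::real_inner) \<Rightarrow>
     (nat \<Rightarrow> 'w set \<Rightarrow> 'o \<Rightarrow> real) \<Rightarrow> (('w \<Rightarrow> real) \<Rightarrow> 'w \<Rightarrow> 'h) \<Rightarrow>
     ('w \<Rightarrow> real) \<Rightarrow> 'w set \<Rightarrow> 'o \<Rightarrow> real" where
  "measure_gradient P M N e \<nu> Dg Y = wn_inner P M N e \<nu> (Dg Y)"

definition wn_image ::
    "'w measure \<Rightarrow> ('w \<Rightarrow> real^'d) \<Rightarrow> ('w set \<Rightarrow> 'o \<Rightarrow> real) \<Rightarrow> (real^'d) set \<Rightarrow> 'o \<Rightarrow> real" where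
  "wn_image M X lam A = lam (X -` A \<inter> space M)"

text \<open>
  The measure-valued gradient $d_G$ on the domain of the image structure by \<open>X\<close>. Here and below
  \<open>dG\<close> stands for the measure-valued gradient on \<open>\<D>\<close>.
\<close>

definition image_measure_gradient ::
    "'w measure \<Rightarrow> (('w \<Rightarrow> real) \<Rightarrow> 'w set \<Rightarrow> 'o \<Rightarrow> real) \<Rightarrow> ('w \<Rightarrow> real^'d) \<Rightarrow>
     (real^'d \<Rightarrow> real) \<Rightarrow> (real^'d) set \<Rightarrow> 'o \<Rightarrow> real" where
  "image_measure_gradient M dG X F = wn_image M X (dG (\<lambda>w. F (X w)))"


section \<open>The gradient of an image structure\<close>

definition Gamma_form ::
    "'w measure \<Rightarrow> (('w \<Rightarrow> real) \<Rightarrow> ('w \<Rightarrow> real) \<Rightarrow> 'w \<Rightarrow> real) \<Rightarrow> ('w \<Rightarrow> real^'d) \<Rightarrow>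
     (real^'d \<Rightarrow> real^'d) \<Rightarrow> real^'d \<Rightarrow> real" where
  "Gamma_form M \<Gamma> X v x = v x \<bullet> (Gamma_matrix M \<Gamma> X x *v v x)"

text \<open>The space $L^2(\mathbb{R}^d, \Gamma_X[I] \cdot X_*m)$ and equality in it.\<close>

definition L2_Gamma ::
    "'w measure \<Rightarrow> (('w \<Rightarrow> real) \<Rightarrow> ('w \<Rightarrow> real) \<Rightarrow> 'w \<Rightarrow> real) \<Rightarrow> ('w \<Rightarrow> real^'d) \<Rightarrow>
     (real^'d \<Rightarrow> real^'d) set" where
  "L2_Gamma M \<Gamma> X =
     {v \<in> borel_measurable borel. integrable (distr M borel X) (Gamma_form M \<Gamma> X v)}"

definition L2_Gamma_eq ::
    "'w measure \<Rightarrow> (('w \<Rightarrow> real) \<Rightarrow> ('w \<Rightarrow> real) \<Rightarrow> 'w \<Rightarrow> real) \<Rightarrow> ('w \<Rightarrow> real^'d) \<Rightarrow>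
     (real^'d \<Rightarrow> real^'d) \<Rightarrow> (real^'d \<Rightarrow> real^'d) \<Rightarrow> bool" where
  "L2_Gamma_eq M \<Gamma> X v v' \<longleftrightarrow> v \<in> L2_Gamma M \<Gamma> X \<and> v' \<in> L2_Gamma M \<Gamma> X \<and>
     (\<integral>x. Gamma_form M \<Gamma> X (\<lambda>x. v x - v' x) x \<partial>distr M borel X) = 0"

text \<open>
  The product $\varphi^t\, d_GI$ for bounded measurable \<open>\<phi>\<close>. The positive measure associated with
  the white noise measure $d_GI_i$ has density $\Gamma_X[I_i, I_i]$ with respect to $X_*m$.
\<close>

definition dGI_integral_bounded ::
    "'w measure \<Rightarrow> (('w \<Rightarrow> real) \<Rightarrow> ('w \<Rightarrow> real) \<Rightarrow> 'w \<Rightarrow> real) \<Rightarrow> 'o measure \<Rightarrow>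
     (('w \<Rightarrow> real) \<Rightarrow> 'w set \<Rightarrow> 'o \<Rightarrow> real) \<Rightarrow> ('w \<Rightarrow> real^'d) \<Rightarrow>
     (real^'d \<Rightarrow> real^'d) \<Rightarrow> (real^'d) set \<Rightarrow> 'o \<Rightarrow> real" where
  "dGI_integral_bounded M \<Gamma> P dG X \<phi> A \<omega> =
     (\<Sum>i\<in>UNIV. wn_integral P (density (distr M borel X) (\<lambda>x. ennreal (Gamma_matrix M \<Gamma> X x $ i $ i)))
        (image_measure_gradient M dG X (\<lambda>y. y $ i)) (\<lambda>x. indicator A x * \<phi> x $ i) \<omega>)"

text \<open>Its extension by continuity to \<open>L2_Gamma M \<Gamma> X\<close>.\<close>

definition dGI_integral ::
    "'w measure \<Rightarrow> (('w \<Rightarrow> real) \<Rightarrow> ('w \<Rightarrow> real) \<Rightarrow> 'w \<Rightarrow> real) \<Rightarrow> 'o measure \<Rightarrow>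
     (('w \<Rightarrow> real) \<Rightarrow> 'w set \<Rightarrow> 'o \<Rightarrow> real) \<Rightarrow> ('w \<Rightarrow> real^'d) \<Rightarrow>
     (real^'d \<Rightarrow> real^'d) \<Rightarrow> (real^'d) set \<Rightarrow> 'o \<Rightarrow> real" where
  "dGI_integral M \<Gamma> P dG X \<phi> A = (SOME Z. \<exists>\<psi>.
     (\<forall>k. \<psi> k \<in> borel_measurable borel \<and> bounded (range (\<psi> k))) \<and>
     (\<lambda>k. \<integral>x. Gamma_form M \<Gamma> X (\<lambda>x. \<psi> k x - \<phi> x) x \<partial>distr M borel X) \<longlonglongrightarrow> 0 \<and>
     L2_tendsto P (\<lambda>k. dGI_integral_bounded M \<Gamma> P dG X (\<psi> k) A) Z)"

text \<open>\<open>nabla\<close> is a representative of the class $\nabla_X F$.\<close>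

definition nabla ::
    "'w measure \<Rightarrow> (('w \<Rightarrow> real) \<Rightarrow> ('w \<Rightarrow> real) \<Rightarrow> 'w \<Rightarrow> real) \<Rightarrow> 'o measure \<Rightarrow>
     (('w \<Rightarrow> real) \<Rightarrow> 'w set \<Rightarrow> 'o \<Rightarrow> real) \<Rightarrow> ('w \<Rightarrow> real^'d) \<Rightarrow>
     (real^'d \<Rightarrow> real) \<Rightarrow> real^'d \<Rightarrow> real^'d" where
  "nabla M \<Gamma> P dG X F = (SOME \<phi>. \<phi> \<in> L2_Gamma M \<Gamma> X \<and>
     (\<forall>A\<in>sets borel. AE \<omega> in P.
        image_measure_gradient M dG X F A \<omega> = dGI_integral M \<Gamma> P dG X \<phi> A \<omega>))"

text \<open>The $d \times p$ matrix with columns $\nabla_X U_1, \dots, \nabla_X U_p$.\<close>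

definition nabla_matrix ::
    "'w measure \<Rightarrow> (('w \<Rightarrow> real) \<Rightarrow> ('w \<Rightarrow> real) \<Rightarrow> 'w \<Rightarrow> real) \<Rightarrow> 'o measure \<Rightarrow>
     (('w \<Rightarrow> real) \<Rightarrow> 'w set \<Rightarrow> 'o \<Rightarrow> real) \<Rightarrow> ('w \<Rightarrow> real^'d) \<Rightarrow>
     (real^'d \<Rightarrow> real^'p) \<Rightarrow> real^'d \<Rightarrow> real^'p^'d" where
  "nabla_matrix M \<Gamma> P dG X U x = (\<chi> i j. nabla M \<Gamma> P dG X (\<lambda>y. U y $ j) x $ i)"

end

theory Submission
  imports Defs
begin

text \<open>
  The defining equation $d_GF = (\nabla_X F)^t\, d_GI$ is an equation between noises, but it is
  equivalent to one between vector fields on the original space, namely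
  $$D(F \circ X) = \sum_i (\nabla_X F)_i(X)\, D X_i \quad m\mbox{-a.e.}$$
  (lemma \<open>gradient_eq_pullback_nabla\<close>). The chain rule is then substitution: with
  $g = \nabla_{U \circ X} V_r$ and $h_j = \nabla_X U_j$,
  $$D(V_r \circ U \circ X) = \sum_j g_j(U(X))\, D(U_j \circ X) = \sum_i \Big(\sum_j g_j(U(X))\, h_{ji}(X)\Big) D X_i,$$
  so that the field $\sum_j (g_j \circ U)\, h_j$ and $\nabla_X(V_r \circ U)$ give the same vector field
  (lemma \<open>nabla_chain_rule\<close>). The distance of two fields $\varphi, \psi$ for the matrix $\Gamma_X[I]$ is
  the distance in $L^2(m, H)$ of the vector fields $\sum_i \varphi_i(X)\, D X_i$ and
  $\sum_i \psi_i(X)\, D X_i$, because $\Gamma_X[I_i, I_j]$ is the conditional expectation of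
  $\langle D X_i, D X_j\rangle$ given $X$ (lemma \<open>Gamma_form_integral\<close>); so it is \<open>0\<close>.

  The equivalence rests on two facts. First, the noise of a vector field determines it, since
  $\psi \mapsto (\psi, \nu)(A)$ is an isometry from $L^2(m, H)$ restricted to $A$ into
  $L^2(P)$ (lemma \<open>wn_inner_covariance\<close>). This comes from the isometry of the integral against each
  component of the noise, from the orthogonality of independent components, and from Parseval's
  identity. In particular $\varphi^t\, d_GI$ is the image of the noise of
  $\sum_i \varphi_i(X)\, D X_i$ (lemma \<open>dGI_integral_eq\<close>).

  Second, $D(F \circ X)$ is of the form $\sum_i \varphi_i(X)\, D X_i$ at all (lemma
  \<open>image_domain_gradient\<close>). For smooth $F$ this is the functional calculus, with $\varphi$ the usual
  gradient. The general case needs the vector fields of this form to be closed in $L^2(m, H)$ (lemma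
  \<open>pullback_range_closed\<close>). The matrix $\Gamma_X[I]$ may be degenerate, so the coefficients of a
  convergent sequence of fields need not converge; only their images under the matrix do. A
  limiting field is obtained by solving a linear system at each point, by an iteration that
  keeps measurability.
\<close>

section \<open>Square integrable functions\<close>

text \<open>
  Gradients are \<open>H\<close>-valued and noises are real-valued; both are handled by one notion, which for
  real functions is membership in \<open>L2\<close>.
\<close>

definition square_integrable :: "'a measure \<Rightarrow> ('a \<Rightarrow> 'b::{real_inner, second_countable_topology}) \<Rightarrow> bool" where
  "square_integrable M f \<longleftrightarrow> f \<in> borel_measurable M \<and> integrable M (\<lambda>x. (norm (f x))\<^sup>2)"

lemma L2_iff_square_integrable: "f \<in> L2 M \<longleftrightarrow> square_integrable M f"
  by (simp add: L2_def square_integrable_def)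

lemma square_integrable_measurable [measurable_dest]:
  "square_integrable M f \<Longrightarrow> f \<in> borel_measurable M"
  by (simp add: square_integrable_def)

lemma square_integrable_integrable:
  "square_integrable M f \<Longrightarrow> integrable M (\<lambda>x. (norm (f x))\<^sup>2)"
  by (simp add: square_integrable_def)

lemma square_integrable_zero [simp]: "square_integrable M (\<lambda>x. 0)"
  by (simp add: square_integrable_def)

lemma square_integrable_bound:
  assumes "square_integrable M f" "g \<in> borel_measurable M"
    and "AE x in M. norm (g x) \<le> norm (f x)"
  shows "square_integrable M g"
  unfolding square_integrable_def
proof
  show "integrable M (\<lambda>x. (norm (g x))\<^sup>2)"
  proof (rule Bochner_Integration.integrable_bound[OF square_integrable_integrable[OF assms(1)]])
    show "(\<lambda>x. (norm (g x))\<^sup>2) \<in> borel_measurable M" using assms(2) by measurable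
    show "AE x in M. norm ((norm (g x))\<^sup>2) \<le> norm ((norm (f x))\<^sup>2)"
      using assms(3) by eventually_elim (auto intro: power_mono)
  qed
qed fact

lemma square_integrable_AE:
  assumes "square_integrable M f" "g \<in> borel_measurable M" and "AE x in M. f x = g x"
  shows "square_integrable M g"
  by (rule square_integrable_bound[OF assms(1,2)]) (use assms(3) in eventually_elim, simp)

lemma square_integrable_scaleR:
  "square_integrable M f \<Longrightarrow> square_integrable M (\<lambda>x. c *\<^sub>R f x)"
  by (auto simp: square_integrable_def power_mult_distrib)

lemma square_integrable_inner:
  assumes f: "square_integrable M f" and g: "square_integrable M g"
  shows "integrable M (\<lambda>x. f x \<bullet> g x)"
proof (rule Bochner_Integration.integrable_bound)
  show "integrable M (\<lambda>x. (norm (f x))\<^sup>2 + (norm (g x))\<^sup>2)"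
    using f g by (auto simp: square_integrable_def)
  show "(\<lambda>x. f x \<bullet> g x) \<in> borel_measurable M" using f g by measurable
  show "AE x in M. norm (f x \<bullet> g x) \<le> norm ((norm (f x))\<^sup>2 + (norm (g x))\<^sup>2)"
  proof (intro AE_I2)
    fix x
    have "\<bar>f x \<bullet> g x\<bar> \<le> norm (f x) * norm (g x)" by (rule Cauchy_Schwarz_ineq2)
    also have "\<dots> \<le> 2 * norm (f x) * norm (g x)" by simp
    also have "\<dots> \<le> (norm (f x))\<^sup>2 + (norm (g x))\<^sup>2" by (rule sum_squares_bound)
    finally show "norm (f x \<bullet> g x) \<le> norm ((norm (f x))\<^sup>2 + (norm (g x))\<^sup>2)" by simp
  qed
qed

lemma square_integrable_add:
  assumes f: "square_integrable M f" and g: "square_integrable M g"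
  shows "square_integrable M (\<lambda>x. f x + g x)"
proof -
  have "(norm (f x + g x))\<^sup>2 = (norm (f x))\<^sup>2 + (norm (g x))\<^sup>2 + 2 * (f x \<bullet> g x)" for x
    by (simp add: power2_norm_eq_inner inner_simps inner_commute)
  then show ?thesis
    using f g square_integrable_inner[OF f g] by (simp add: square_integrable_def borel_measurable_add)
qed

lemma square_integrable_diff:
  assumes f: "square_integrable M f" and g: "square_integrable M g"
  shows "square_integrable M (\<lambda>x. f x - g x)"
  using square_integrable_add[OF f square_integrable_scaleR[OF g, of "-1"]] by simp

lemma square_integrable_sum:
  fixes f :: "'i \<Rightarrow> 'a \<Rightarrow> 'b::{real_inner, second_countable_topology}"
  shows "(\<And>i. i \<in> I \<Longrightarrow> square_integrable M (f i)) \<Longrightarrow> square_integrable M (\<lambda>x. \<Sum>i\<in>I. f i x)"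
  by (induction I rule: infinite_finite_induct) (auto intro: square_integrable_add)

lemmas L2_mult = square_integrable_scaleR[where 'b=real, unfolded L2_iff_square_integrable[symmetric] real_scaleR_def]
lemmas L2_add = square_integrable_add[where 'b=real, folded L2_iff_square_integrable]
lemmas L2_diff = square_integrable_diff[where 'b=real, folded L2_iff_square_integrable]
lemmas L2_sum = square_integrable_sum[where 'b=real, folded L2_iff_square_integrable]

lemma L2_integrable_mult: "f \<in> L2 M \<Longrightarrow> g \<in> L2 M \<Longrightarrow> integrable M (\<lambda>x. f x * g x)"
  using square_integrable_inner[of M f g] by (simp add: L2_iff_square_integrable mult.commute)

lemma L2_measurable [measurable_dest]: "f \<in> L2 M \<Longrightarrow> f \<in> borel_measurable M"
  by (simp add: L2_def)

lemmas L2_AE = square_integrable_AE[where 'b=real, folded L2_iff_square_integrable]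

lemma L2_indicator: "finite_measure M \<Longrightarrow> A \<in> sets M \<Longrightarrow> (indicator A :: 'a \<Rightarrow> real) \<in> L2 M"
proof -
  assume M: "finite_measure M" and A: "A \<in> sets M"
  have "(\<lambda>x. (indicator A x :: real)\<^sup>2) = indicator A"
    by (auto simp: fun_eq_iff split: split_indicator)
  then show ?thesis
    using A finite_measure.emeasure_finite[OF M, of A] by (simp add: L2_def top.not_eq_extremum)
qed

lemma square_integrable_null_iff:
  assumes "square_integrable M f"
  shows "(\<integral>x. (norm (f x))\<^sup>2 \<partial>M) = 0 \<longleftrightarrow> (AE x in M. f x = 0)"
  using integral_nonneg_eq_0_iff_AE[OF square_integrable_integrable[OF assms]] by simp

lemma L2_null_iff: "f \<in> L2 M \<Longrightarrow> (\<integral>x. (f x)\<^sup>2 \<partial>M) = 0 \<longleftrightarrow> (AE x in M. f x = 0)"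
  using square_integrable_null_iff[of M f] by (simp add: L2_iff_square_integrable)

lemma square_integrable_norm_diff:
  assumes f: "square_integrable M f" and g: "square_integrable M g"
  shows "(\<integral>x. (norm (f x - g x))\<^sup>2 \<partial>M) =
    (\<integral>x. (norm (f x))\<^sup>2 \<partial>M) - 2 * (\<integral>x. f x \<bullet> g x \<partial>M) + (\<integral>x. (norm (g x))\<^sup>2 \<partial>M)"
proof -
  have "(norm (f x - g x))\<^sup>2 = (norm (f x))\<^sup>2 - 2 * (f x \<bullet> g x) + (norm (g x))\<^sup>2" for x
    by (simp add: power2_norm_eq_inner inner_simps inner_commute)
  then show ?thesis
    using f g square_integrable_inner[OF f g]
    by (simp add: square_integrable_def)
qed

lemma L2_diff_squared:
  "f \<in> L2 M \<Longrightarrow> g \<in> L2 M \<Longrightarrow> (\<integral>x. (f x - g x)\<^sup>2 \<partial>M) =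
    (\<integral>x. (f x)\<^sup>2 \<partial>M) - 2 * (\<integral>x. f x * g x \<partial>M) + (\<integral>x. (g x)\<^sup>2 \<partial>M)"
  using square_integrable_norm_diff[of M f g] by (simp add: L2_iff_square_integrable mult.commute)

text \<open>
  The Cauchy-Schwarz inequality of a positive semidefinite form, with \<open>a\<close>, \<open>b\<close>, \<open>c\<close> its values at
  two vectors; it serves for inner products in mean square and for forms given by matrices.
\<close>

lemma discriminant_le:
  fixes a b c :: real
  assumes nonneg: "\<And>t. 0 \<le> a + 2 * t * b + t\<^sup>2 * c" and "a \<ge> 0" "c \<ge> 0"
  shows "\<bar>b\<bar> \<le> sqrt a * sqrt c"
proof -
  have "b\<^sup>2 \<le> a * c"
  proof (cases "c = 0")
    case True
    have "b = 0"
    proof (rule ccontr)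
      assume "b \<noteq> 0"
      then show False using nonneg[of "- (a + 1) / (2 * b)"] True by (simp add: field_simps)
    qed
    then show ?thesis using True by simp
  next
    case False
    then have "c > 0" using \<open>c \<ge> 0\<close> by simp
    then show ?thesis using nonneg[of "- b / c"] by (simp add: power2_eq_square field_simps)
  qed
  then have "sqrt (b\<^sup>2) \<le> sqrt (a * c)" by (rule real_sqrt_le_mono)
  then show ?thesis by (simp add: real_sqrt_mult)
qed

lemma square_integrable_Cauchy_Schwarz:
  assumes f: "square_integrable M f" and g: "square_integrable M g"
  shows "\<bar>\<integral>x. f x \<bullet> g x \<partial>M\<bar> \<le>
    sqrt (\<integral>x. (norm (f x))\<^sup>2 \<partial>M) * sqrt (\<integral>x. (norm (g x))\<^sup>2 \<partial>M)"
proof (rule discriminant_le)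
  fix t :: real
  have "0 \<le> (\<integral>x. (norm (f x - (- t) *\<^sub>R g x))\<^sup>2 \<partial>M)" by simp
  then show "0 \<le> (\<integral>x. (norm (f x))\<^sup>2 \<partial>M) + 2 * t * (\<integral>x. f x \<bullet> g x \<partial>M) + t\<^sup>2 * (\<integral>x. (norm (g x))\<^sup>2 \<partial>M)"
    by (subst (asm) square_integrable_norm_diff[OF f square_integrable_scaleR[OF g]])
       (simp add: power_mult_distrib)
qed simp_all

lemma square_integrable_norm_sum_le:
  assumes f: "square_integrable M f" and g: "square_integrable M g"
  shows "(\<integral>x. (norm (f x + g x))\<^sup>2 \<partial>M) \<le>
    2 * (\<integral>x. (norm (f x))\<^sup>2 \<partial>M) + 2 * (\<integral>x. (norm (g x))\<^sup>2 \<partial>M)"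
proof -
  have "(\<integral>x. (norm (f x + g x))\<^sup>2 \<partial>M) \<le> (\<integral>x. 2 * (norm (f x))\<^sup>2 + 2 * (norm (g x))\<^sup>2 \<partial>M)"
  proof (rule integral_mono)
    fix x
    have "(norm (f x + g x))\<^sup>2 \<le> (norm (f x) + norm (g x))\<^sup>2"
      by (intro power_mono norm_triangle_ineq) auto
    also have "\<dots> \<le> 2 * (norm (f x))\<^sup>2 + 2 * (norm (g x))\<^sup>2"
      using sum_squares_bound[of "norm (f x)" "norm (g x)"] by (simp add: power2_sum)
    finally show "(norm (f x + g x))\<^sup>2 \<le> 2 * (norm (f x))\<^sup>2 + 2 * (norm (g x))\<^sup>2" .
  qed (use f g square_integrable_add[OF f g] in \<open>auto simp: square_integrable_def\<close>)
  then show ?thesis using f g by (simp add: square_integrable_def)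
qed

lemma L2_sum_squared_le:
  "f \<in> L2 M \<Longrightarrow> g \<in> L2 M \<Longrightarrow>
    (\<integral>x. (f x + g x)\<^sup>2 \<partial>M) \<le> 2 * (\<integral>x. (f x)\<^sup>2 \<partial>M) + 2 * (\<integral>x. (g x)\<^sup>2 \<partial>M)"
  using square_integrable_norm_sum_le[of M f g] by (simp add: L2_iff_square_integrable)

lemma square_integrable_tendsto_inner:
  assumes f: "\<And>k. square_integrable M (F k)" "square_integrable M f"
      "(\<lambda>k. \<integral>x. (norm (F k x - f x))\<^sup>2 \<partial>M) \<longlonglongrightarrow> 0"
    and g: "\<And>k. square_integrable M (G k)" "square_integrable M g"
      "(\<lambda>k. \<integral>x. (norm (G k x - g x))\<^sup>2 \<partial>M) \<longlonglongrightarrow> 0"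
  shows "(\<lambda>k. \<integral>x. F k x \<bullet> G k x \<partial>M) \<longlonglongrightarrow> (\<integral>x. f x \<bullet> g x \<partial>M)"
proof -
  let ?n = "\<lambda>h. sqrt (\<integral>x. (norm (h x :: 'b))\<^sup>2 \<partial>M)"
  let ?df = "\<lambda>k x. F k x - f x" and ?dg = "\<lambda>k x. G k x - g x"
  have df: "square_integrable M (?df k)" and dg: "square_integrable M (?dg k)" for k
    by (auto intro: square_integrable_diff f g)
  have "(\<lambda>k. (\<integral>x. F k x \<bullet> G k x \<partial>M) - (\<integral>x. f x \<bullet> g x \<partial>M)) \<longlonglongrightarrow> 0"
  proof (rule Lim_null_comparison)
    show "\<forall>\<^sub>F k in sequentially. norm ((\<integral>x. F k x \<bullet> G k x \<partial>M) - (\<integral>x. f x \<bullet> g x \<partial>M))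
        \<le> ?n (?df k) * ?n (?dg k) + ?n (?df k) * ?n g + ?n f * ?n (?dg k)"
    proof (intro always_eventually allI)
      fix k
      have "F k x \<bullet> G k x = ?df k x \<bullet> ?dg k x + ?df k x \<bullet> g x + f x \<bullet> ?dg k x + f x \<bullet> g x" for x
        by (simp add: inner_simps)
      then have "(\<integral>x. F k x \<bullet> G k x \<partial>M) - (\<integral>x. f x \<bullet> g x \<partial>M) =
          (\<integral>x. ?df k x \<bullet> ?dg k x \<partial>M) + (\<integral>x. ?df k x \<bullet> g x \<partial>M) + (\<integral>x. f x \<bullet> ?dg k x \<partial>M)"
        using df[of k] dg[of k] f(2) g(2)
        by (simp only:) (simp add: square_integrable_inner del: inner_diff_left inner_diff_right)
      then show "norm ((\<integral>x. F k x \<bullet> G k x \<partial>M) - (\<integral>x. f x \<bullet> g x \<partial>M))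
        \<le> ?n (?df k) * ?n (?dg k) + ?n (?df k) * ?n g + ?n f * ?n (?dg k)"
        using square_integrable_Cauchy_Schwarz[OF df[of k] dg[of k]]
          square_integrable_Cauchy_Schwarz[OF df[of k] g(2)]
          square_integrable_Cauchy_Schwarz[OF f(2) dg[of k]]
        unfolding real_norm_def by linarith
    qed
    have "(\<lambda>k. ?n (?df k) * ?n (?dg k) + ?n (?df k) * ?n g + ?n f * ?n (?dg k))
      \<longlonglongrightarrow> sqrt 0 * sqrt 0 + sqrt 0 * ?n g + ?n f * sqrt 0"
      by (intro tendsto_intros f g)
    then show "(\<lambda>k. ?n (?df k) * ?n (?dg k) + ?n (?df k) * ?n g + ?n f * ?n (?dg k)) \<longlonglongrightarrow> 0"
      by simp
  qed
  then show ?thesis by (simp add: LIM_zero_iff)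
qed

lemma L2_tendsto_inner:
  assumes "L2_tendsto M F f" "L2_tendsto M G g"
  shows "(\<lambda>k. \<integral>x. F k x * G k x \<partial>M) \<longlonglongrightarrow> (\<integral>x. f x * g x \<partial>M)"
  using square_integrable_tendsto_inner[of M F f G g] assms
  by (simp add: L2_tendsto_def L2_iff_square_integrable mult.commute)

text \<open>
  A map between \<open>L2\<close> spaces that preserves inner products is automatically linear: the squared
  norm of \<open>H - (a F + b G)\<close> is computed from the inner products of \<open>F\<close>, \<open>G\<close>, \<open>H\<close> alone.
\<close>

lemma L2_AE_linear_combination:
  assumes L2: "F \<in> L2 P" "G \<in> L2 P" "H \<in> L2 P"
    and FH: "(\<integral>\<omega>. F \<omega> * H \<omega> \<partial>P) = a * (\<integral>\<omega>. F \<omega> * F \<omega> \<partial>P) + b * (\<integral>\<omega>. F \<omega> * G \<omega> \<partial>P)"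
    and GH: "(\<integral>\<omega>. G \<omega> * H \<omega> \<partial>P) = a * (\<integral>\<omega>. G \<omega> * F \<omega> \<partial>P) + b * (\<integral>\<omega>. G \<omega> * G \<omega> \<partial>P)"
    and HH: "(\<integral>\<omega>. H \<omega> * H \<omega> \<partial>P) = a * (\<integral>\<omega>. H \<omega> * F \<omega> \<partial>P) + b * (\<integral>\<omega>. H \<omega> * G \<omega> \<partial>P)"
  shows "AE \<omega> in P. H \<omega> = a * F \<omega> + b * G \<omega>"
proof -
  define D where "D \<omega> = H \<omega> - (a * F \<omega> + b * G \<omega>)" for \<omega>
  have DL2: "D \<in> L2 P" unfolding D_def by (intro L2_diff L2_add L2_mult L2)
  have orth: "(\<integral>\<omega>. Z \<omega> * D \<omega> \<partial>P) =
      (\<integral>\<omega>. Z \<omega> * H \<omega> \<partial>P) - (a * (\<integral>\<omega>. Z \<omega> * F \<omega> \<partial>P) + b * (\<integral>\<omega>. Z \<omega> * G \<omega> \<partial>P))" if Z: "Z \<in> L2 P" for Z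
  proof -
    have "Z \<omega> * D \<omega> = Z \<omega> * H \<omega> - (a * (Z \<omega> * F \<omega>) + b * (Z \<omega> * G \<omega>))" for \<omega>
      by (simp add: D_def algebra_simps)
    then show ?thesis by (simp only:) (simp add: L2_integrable_mult L2 Z)
  qed
  have "(\<integral>\<omega>. (D \<omega>)\<^sup>2 \<partial>P) = (\<integral>\<omega>. D \<omega> * H \<omega> - (a * (D \<omega> * F \<omega>) + b * (D \<omega> * G \<omega>)) \<partial>P)"
    by (rule Bochner_Integration.integral_cong) (simp_all add: D_def algebra_simps power2_eq_square)
  also have "\<dots> = (\<integral>\<omega>. H \<omega> * D \<omega> \<partial>P) - (a * (\<integral>\<omega>. F \<omega> * D \<omega> \<partial>P) + b * (\<integral>\<omega>. G \<omega> * D \<omega> \<partial>P))"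
    by (simp add: L2_integrable_mult L2 DL2 mult.commute[of "D _"])
  also have "\<dots> = 0" using orth[OF L2(1)] orth[OF L2(2)] orth[OF L2(3)] FH GH HH by simp
  finally show ?thesis using L2_null_iff[OF DL2] by (auto simp: D_def)
qed

lemma L2_tendsto_const: "f \<in> L2 M \<Longrightarrow> L2_tendsto M (\<lambda>_. f) f"
  by (simp add: L2_tendsto_def)

lemma L2_tendsto_AE:
  assumes "L2_tendsto M Z Y" "\<And>k. Z' k \<in> borel_measurable M" "\<And>k. AE x in M. Z k x = Z' k x"
    "Y' \<in> borel_measurable M" "AE x in M. Y x = Y' x"
  shows "L2_tendsto M Z' Y'"
proof -
  have *: "Z' k \<in> L2 M" "Y' \<in> L2 M" for k
    using assms by (auto simp: L2_tendsto_def intro: L2_AE)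
  have Z: "Z k \<in> borel_measurable M" "Y \<in> borel_measurable M" for k
    using assms(1) by (auto simp: L2_tendsto_def L2_measurable)
  have "(\<integral>x. (Z' k x - Y' x)\<^sup>2 \<partial>M) = (\<integral>x. (Z k x - Y x)\<^sup>2 \<partial>M)" for k
  proof (rule integral_cong_AE)
    show "AE x in M. (Z' k x - Y' x)\<^sup>2 = (Z k x - Y x)\<^sup>2"
      using assms(3)[of k] assms(5) by eventually_elim simp
    show "(\<lambda>x. (Z' k x - Y' x)\<^sup>2) \<in> borel_measurable M" using *(1)[of k] *(2) by measurable
    show "(\<lambda>x. (Z k x - Y x)\<^sup>2) \<in> borel_measurable M"
      using Z by measurable
  qed
  then show ?thesis using assms(1) * by (simp add: L2_tendsto_def)
qed

lemma L2_tendsto_unique: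
  assumes "L2_tendsto M Z Y" "L2_tendsto M Z Y'"
  shows "AE x in M. Y x = Y' x"
proof -
  have Y: "Y \<in> L2 M" "Y' \<in> L2 M" using assms by (auto simp: L2_tendsto_def)
  let ?D = "\<integral>x. (Y x - Y' x)\<^sup>2 \<partial>M"
  have "(\<lambda>k. \<integral>x. Z k x * Z k x \<partial>M) \<longlonglongrightarrow> (\<integral>x. Y x * Y x \<partial>M)"
    and "(\<lambda>k. \<integral>x. Z k x * Z k x \<partial>M) \<longlonglongrightarrow> (\<integral>x. Y x * Y' x \<partial>M)"
    and "(\<lambda>k. \<integral>x. Z k x * Z k x \<partial>M) \<longlonglongrightarrow> (\<integral>x. Y' x * Y' x \<partial>M)"
    by (intro L2_tendsto_inner assms)+
  then have "(\<integral>x. Y x * Y x \<partial>M) = (\<integral>x. Y x * Y' x \<partial>M)"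
    "(\<integral>x. Y' x * Y' x \<partial>M) = (\<integral>x. Y x * Y' x \<partial>M)"
    by (auto dest: LIMSEQ_unique)
  then have "?D = 0" unfolding L2_diff_squared[OF Y] by (simp add: power2_eq_square)
  then show ?thesis using L2_null_iff[OF L2_diff[OF Y]] by simp
qed

lemma L2_tendsto_L2_lim: "L2_tendsto M Z Y \<Longrightarrow> L2_tendsto M Z (L2_lim M Z)"
  unfolding L2_lim_def by (rule someI[of "L2_tendsto M Z"])

section \<open>Completeness of \<open>L2\<close> and density of simple functions\<close>

text \<open>
  Fatou's lemma, in the form in which it is used to bound the distance from a fixed term of a Cauchy
  sequence to the limit.
\<close>

lemma nn_integral_limit_le:
  fixes u :: "nat \<Rightarrow> 'a \<Rightarrow> ennreal"
  assumes [measurable]: "\<And>j. u j \<in> borel_measurable M"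
    and lim: "AE x in M. (\<lambda>j. u j x) \<longlonglongrightarrow> v x"
    and le: "\<forall>\<^sub>F j in sequentially. (\<integral>\<^sup>+x. u j x \<partial>M) \<le> c"
  shows "(\<integral>\<^sup>+x. v x \<partial>M) \<le> c"
proof -
  have "(\<integral>\<^sup>+x. v x \<partial>M) = (\<integral>\<^sup>+x. liminf (\<lambda>j. u j x) \<partial>M)"
    by (rule nn_integral_cong_AE) (use lim in eventually_elim, simp add: lim_imp_Liminf)
  also have "\<dots> \<le> liminf (\<lambda>j. \<integral>\<^sup>+x. u j x \<partial>M)"
    by (rule nn_integral_liminf) simp
  also have "\<dots> \<le> limsup (\<lambda>j. \<integral>\<^sup>+x. u j x \<partial>M)"
    by (rule Liminf_le_Limsup) simp
  also have "\<dots> \<le> c" by (rule Limsup_bounded[OF le])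
  finally show ?thesis .
qed

text \<open>
  This turns fast convergence of increments in mean square into convergence almost everywhere. It
  serves twice: for the completeness of \<open>L2\<close>, and for representatives of gradients, where the
  increments are measured by a seminorm that depends on the point.
\<close>

lemma (in prob_space) AE_summable_of_square_integrals:
  assumes g: "\<And>k. square_integrable M (g k)"
    and le: "\<And>k. (\<integral>x. (norm (g k x))\<^sup>2 \<partial>M) \<le> (1/4) ^ k"
  shows "AE x in M. summable (\<lambda>k. norm (g k x))"
proof -
  have [measurable]: "g k \<in> borel_measurable M" for k using g by measurable
  have int: "(\<integral>\<^sup>+x. ennreal (norm (g k x)) \<partial>M) \<le> ennreal ((1/2) ^ k)" for k
  proof -
    let ?h = "\<lambda>x. ((1/2) ^ k + 2 ^ k * (norm (g k x))\<^sup>2) / 2"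
    have h: "integrable M ?h" using g[of k] by (simp add: square_integrable_def)
    \<comment> \<open>the arithmetic-geometric mean inequality, weighted so that both terms integrate to \<open>2\<^sup>-\<^sup>k\<close>\<close>
    have "norm (g k x) \<le> ?h x" for x
    proof -
      have "0 \<le> ((1/2) ^ k - norm (g k x))\<^sup>2" by simp
      then have "2 * (1/2) ^ k * norm (g k x) \<le> ((1/2) ^ k)\<^sup>2 + (norm (g k x))\<^sup>2"
        by (simp add: power2_diff)
      then have "2 ^ k * (2 * (1/2) ^ k * norm (g k x)) \<le> 2 ^ k * (((1/2) ^ k)\<^sup>2 + (norm (g k x))\<^sup>2)"
        by (rule mult_left_mono) simp
      also have "\<dots> = (2 ^ k * (1/2) ^ k) * (1/2) ^ k + 2 ^ k * (norm (g k x))\<^sup>2"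
        by (simp only: distrib_left power2_eq_square mult.assoc)
      finally have "2 * (2 ^ k * (1/2) ^ k) * norm (g k x) \<le>
          (2 ^ k * (1/2) ^ k) * (1/2) ^ k + 2 ^ k * (norm (g k x))\<^sup>2"
        by (simp only: mult_ac)
      moreover have "2 ^ k * (1/2::real) ^ k = 1" by (simp flip: power_mult_distrib)
      ultimately show ?thesis by simp
    qed
    then have "(\<integral>\<^sup>+x. ennreal (norm (g k x)) \<partial>M) \<le> (\<integral>\<^sup>+x. ennreal (?h x) \<partial>M)"
      by (intro nn_integral_mono ennreal_leI)
    also have "\<dots> = ennreal (\<integral>x. ?h x \<partial>M)"
      by (rule nn_integral_eq_integral[OF h]) simp
    also have "(\<integral>x. ?h x \<partial>M) = ((1/2) ^ k + 2 ^ k * (\<integral>x. (norm (g k x))\<^sup>2 \<partial>M)) / 2"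
      using g[of k] by (simp add: square_integrable_def prob_space)
    also have "\<dots> \<le> ((1/2) ^ k + 2 ^ k * (1/4) ^ k) / 2"
      using le[of k] by simp
    also have "\<dots> = (1/2) ^ k" by (simp flip: power_mult_distrib)
    finally show ?thesis by (simp add: ennreal_leI)
  qed
  have "(\<integral>\<^sup>+x. (\<Sum>k. ennreal (norm (g k x))) \<partial>M) = (\<Sum>k. \<integral>\<^sup>+x. ennreal (norm (g k x)) \<partial>M)"
    by (rule nn_integral_suminf) simp
  also have "\<dots> \<le> (\<Sum>k. ennreal ((1/2) ^ k))"
    by (intro suminf_le int) auto
  also have "\<dots> = ennreal (\<Sum>k. (1/2) ^ k)"
    by (rule suminf_ennreal_eq) (auto intro!: summable_sums summable_geometric)
  finally have "(\<integral>\<^sup>+x. (\<Sum>k. ennreal (norm (g k x))) \<partial>M) \<noteq> \<infinity>"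
    by (auto simp: top_unique)
  then have "AE x in M. (\<Sum>k. ennreal (norm (g k x))) \<noteq> \<infinity>"
    by (intro nn_integral_noteq_infinite) auto
  then show ?thesis
    by eventually_elim (auto intro: summable_suminf_not_top)
qed

lemma convergent_of_summable_norm_diff:
  fixes z :: "nat \<Rightarrow> 'b::banach"
  assumes "summable (\<lambda>k. norm (z (Suc k) - z k))"
  shows "convergent z"
proof -
  have "summable (\<lambda>k. z (Suc k) - z k)" by (rule summable_norm_cancel[OF assms])
  then have "convergent (\<lambda>n. \<Sum>k<n. z (Suc k) - z k)" by (simp add: summable_iff_convergent)
  then have "convergent (\<lambda>n. (z n - z 0) + z 0)"
    unfolding sum_lessThan_telescope by (intro convergent_add convergent_const)
  then show ?thesis by simp
qed

text \<open>
  The Riesz-Fischer theorem: a subsequence with summable increments converges almost everywhere,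
  and Fatou's lemma identifies its limit as the limit in mean square of the whole sequence.
\<close>

lemma (in prob_space) L2_complete:
  assumes Z: "\<And>k. Z k \<in> L2 M"
    and Cauchy: "\<And>\<epsilon>. \<epsilon> > 0 \<Longrightarrow> \<exists>n0. \<forall>k\<ge>n0. \<forall>l\<ge>n0. (\<integral>x. (Z k x - Z l x)\<^sup>2 \<partial>M) < \<epsilon>"
  shows "\<exists>Y. L2_tendsto M Z Y"
proof -
  have [measurable]: "Z k \<in> borel_measurable M" for k using Z by measurable
  have "\<exists>n0. \<forall>k\<ge>n0. \<forall>l\<ge>n0. (\<integral>x. (Z k x - Z l x)\<^sup>2 \<partial>M) < (1/4) ^ j" for j :: nat
    by (rule Cauchy) simp
  then obtain N where N: "\<And>j k l. k \<ge> N j \<Longrightarrow> l \<ge> N j \<Longrightarrow> (\<integral>x. (Z k x - Z l x)\<^sup>2 \<partial>M) < (1/4) ^ j"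
    by metis
  \<comment> \<open>a partial sum dominates each of its terms, so \<open>r k\<close> lies beyond all of \<open>N 0, \<dots>, N k\<close>\<close>
  define r where "r j = (\<Sum>i\<le>j. N i)" for j
  have r: "N j \<le> r k" if "j \<le> k" for j k
    unfolding r_def using that by (intro member_le_sum) auto
  have "AE x in M. summable (\<lambda>j. norm (Z (r (Suc j)) x - Z (r j) x))"
  proof (rule AE_summable_of_square_integrals)
    show "square_integrable M (\<lambda>x. Z (r (Suc j)) x - Z (r j) x)" for j
      using L2_diff[OF Z Z] by (simp add: L2_iff_square_integrable)
    show "(\<integral>x. (norm (Z (r (Suc j)) x - Z (r j) x))\<^sup>2 \<partial>M) \<le> (1/4) ^ j" for j
      using N[OF r[of j "Suc j"] r[of j j]] by simp
  qed
  then have conv: "AE x in M. convergent (\<lambda>j. Z (r j) x)"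
    by eventually_elim (rule convergent_of_summable_norm_diff)
  define Y where "Y x = lim (\<lambda>j. Z (r j) x)" for x
  have [measurable]: "Y \<in> borel_measurable M"
    unfolding Y_def by (rule borel_measurable_lim_metric) simp
  have lim: "AE x in M. (\<lambda>j. Z (r j) x) \<longlonglongrightarrow> Y x"
    using conv by eventually_elim (simp add: Y_def convergent_LIMSEQ_iff)
  have le: "(\<integral>\<^sup>+x. ennreal ((Z k x - Y x)\<^sup>2) \<partial>M) \<le> ennreal ((1/4) ^ j)" if k: "k \<ge> N j" for j k
  proof (rule nn_integral_limit_le)
    show "AE x in M. (\<lambda>i. ennreal ((Z k x - Z (r i) x)\<^sup>2)) \<longlonglongrightarrow> ennreal ((Z k x - Y x)\<^sup>2)"
      using lim by eventually_elim (intro tendsto_intros tendsto_ennrealI)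
    show "\<forall>\<^sub>F i in sequentially. (\<integral>\<^sup>+x. ennreal ((Z k x - Z (r i) x)\<^sup>2) \<partial>M) \<le> ennreal ((1/4) ^ j)"
    proof (intro eventually_sequentiallyI[of j])
      fix i assume "j \<le> i"
      have "(\<integral>\<^sup>+x. ennreal ((Z k x - Z (r i) x)\<^sup>2) \<partial>M) = ennreal (\<integral>x. (Z k x - Z (r i) x)\<^sup>2 \<partial>M)"
        using L2_diff[OF Z[of k] Z[of "r i"]] by (intro nn_integral_eq_integral) (auto simp: L2_def)
      also have "\<dots> \<le> ennreal ((1/4) ^ j)"
        using N[OF k r[OF \<open>j \<le> i\<close>]] by (intro ennreal_leI) simp
      finally show "(\<integral>\<^sup>+x. ennreal ((Z k x - Z (r i) x)\<^sup>2) \<partial>M) \<le> ennreal ((1/4) ^ j)" .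
    qed
  qed simp
  have ZY: "(\<lambda>x. Z k x - Y x) \<in> L2 M" if "k \<ge> N j" for k j
    using le[OF that] by (auto simp: L2_def integrable_iff_bounded intro: le_less_trans)
  have Y: "Y \<in> L2 M"
    using L2_diff[OF Z ZY[of 0 "N 0"], of "N 0"] by simp
  have "(\<lambda>k. \<integral>x. (Z k x - Y x)\<^sup>2 \<partial>M) \<longlonglongrightarrow> 0"
  proof (rule LIMSEQ_I)
    fix \<epsilon> :: real assume "\<epsilon> > 0"
    then obtain j where j: "(1/4) ^ j < \<epsilon>" using real_arch_pow_inv[of \<epsilon> "1/4"] by auto
    have "norm ((\<integral>x. (Z k x - Y x)\<^sup>2 \<partial>M) - 0) < \<epsilon>" if "k \<ge> N j" for k
    proof -
      have "ennreal (\<integral>x. (Z k x - Y x)\<^sup>2 \<partial>M) = (\<integral>\<^sup>+x. ennreal ((Z k x - Y x)\<^sup>2) \<partial>M)"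
        using ZY[OF that] by (intro nn_integral_eq_integral[symmetric]) (auto simp: L2_def)
      also have "\<dots> \<le> ennreal ((1/4) ^ j)" by (rule le[OF that])
      finally show ?thesis using j by (simp add: ennreal_le_iff)
    qed
    then show "\<exists>n0. \<forall>k\<ge>n0. norm ((\<integral>x. (Z k x - Y x)\<^sup>2 \<partial>M) - 0) < \<epsilon>" by blast
  qed
  then show ?thesis using Z Y by (auto simp: L2_tendsto_def)
qed

text \<open>
  Simple functions are dense, so a property of elements of \<open>L2\<close> may be checked on indicators if it
  passes to linear combinations and mean square limits. Two isometries, or two bilinear
  expressions, are compared in this way.
\<close>

lemma L2_induct [consumes 2, case_names indicator scale add lim]:
  assumes fin: "finite_measure M" and f: "f \<in> L2 M"
    and indicator: "\<And>A. A \<in> sets M \<Longrightarrow> Q (indicator A)"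
    and scale: "\<And>c g. g \<in> L2 M \<Longrightarrow> Q g \<Longrightarrow> Q (\<lambda>x. c * g x)"
    and add: "\<And>g h. g \<in> L2 M \<Longrightarrow> Q g \<Longrightarrow> h \<in> L2 M \<Longrightarrow> Q h \<Longrightarrow> Q (\<lambda>x. g x + h x)"
    and lim: "\<And>s g. (\<And>k. Q (s k)) \<Longrightarrow> L2_tendsto M s g \<Longrightarrow> Q g"
  shows "Q f"
proof -
  interpret finite_measure M by (rule fin)
  have [measurable]: "f \<in> borel_measurable M" using f by measurable
  obtain F where F: "\<And>i. simple_function M (F i)"
      "\<And>x. x \<in> space M \<Longrightarrow> (\<lambda>i. F i x) \<longlonglongrightarrow> f x"
      "\<And>i x. x \<in> space M \<Longrightarrow> dist (F i x) 0 \<le> 2 * dist (f x) 0"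
    using borel_measurable_implies_sequence_metric[of f M 0] by force
  define h where "h i x = (\<Sum>y\<in>F i ` space M. y * indicator (F i -` {y} \<inter> space M) x)" for i x
  have sets: "F i -` {y} \<inter> space M \<in> sets M" for i y
    using F(1) by (rule simple_functionD)
  have finite: "finite (F i ` space M)" for i using F(1) by (rule simple_functionD)
  have h: "h i x = F i x" if "x \<in> space M" for i x
  proof -
    have "h i x = (\<Sum>y\<in>F i ` space M. if y = F i x then y else 0)"
      unfolding h_def using that by (intro sum.cong) (auto split: split_indicator)
    then show ?thesis using finite that by simp
  qed
  have Q_sum: "Q (\<lambda>x. \<Sum>y\<in>Y. y * indicator (F i -` {y} \<inter> space M) x)" if "finite Y" for Y i
    using that
  proof induction
    case empty
    then show ?case using scale[OF L2_indicator[OF fin sets] indicator[OF sets], of 0] by simp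
  next
    case (insert y Y)
    have "Q (\<lambda>x. y * indicator (F i -` {y} \<inter> space M) x + (\<Sum>y\<in>Y. y * indicator (F i -` {y} \<inter> space M) x))"
    proof (rule add)
      show "(\<lambda>x. \<Sum>y\<in>Y. y * indicator (F i -` {y} \<inter> space M) x) \<in> L2 M"
        by (intro L2_sum L2_mult L2_indicator fin sets)
    qed (intro insert.IH L2_mult L2_indicator scale indicator fin sets)+
    then show ?case using insert.hyps by (simp only: sum.insert[OF insert.hyps])
  qed
  have hL2: "h i \<in> L2 M" for i
    unfolding h_def by (intro L2_sum L2_mult L2_indicator fin sets)
  have "(\<lambda>i. \<integral>x. (h i x - f x)\<^sup>2 \<partial>M) \<longlonglongrightarrow> (\<integral>x. 0 \<partial>M)"
  proof (rule integral_dominated_convergence[where w = "\<lambda>x. 9 * (f x)\<^sup>2"])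
    show "(\<lambda>x. (h i x - f x)\<^sup>2) \<in> borel_measurable M" for i
      using L2_measurable[OF hL2[of i]] by measurable
    show "integrable M (\<lambda>x. 9 * (f x)\<^sup>2)" using f by (simp add: L2_def)
    show "AE x in M. (\<lambda>i. (h i x - f x)\<^sup>2) \<longlonglongrightarrow> 0"
    proof (intro AE_I2)
      fix x assume x: "x \<in> space M"
      have "(\<lambda>i. (F i x - f x)\<^sup>2) \<longlonglongrightarrow> (f x - f x)\<^sup>2"
        by (intro tendsto_intros F x)
      then show "(\<lambda>i. (h i x - f x)\<^sup>2) \<longlonglongrightarrow> 0" using h[OF x] by simp
    qed
    show "AE x in M. norm ((h i x - f x)\<^sup>2) \<le> 9 * (f x)\<^sup>2" for i
    proof (intro AE_I2)
      fix x assume x: "x \<in> space M"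
      have "\<bar>h i x - f x\<bar> \<le> 3 * \<bar>f x\<bar>" using F(3)[OF x, of i] h[OF x, of i] by (simp add: dist_real_def)
      then have "\<bar>h i x - f x\<bar>\<^sup>2 \<le> (3 * \<bar>f x\<bar>)\<^sup>2" by (rule power_mono) simp
      then show "norm ((h i x - f x)\<^sup>2) \<le> 9 * (f x)\<^sup>2" by (simp add: power_mult_distrib)
    qed
  qed simp
  then have "L2_tendsto M h f" using hL2 f by (simp add: L2_tendsto_def)
  moreover have "Q (h i)" for i unfolding h_def using Q_sum[OF finite] by simp
  ultimately show ?thesis by (rule lim[rotated])
qed

section \<open>The integral against a scalar white noise\<close>

lemma centered_gaussian_second_moment:
  assumes "prob_space P" and Z: "centered_gaussian P Z v" and v: "v \<ge> 0"
  shows "(\<integral>\<omega>. (Z \<omega>)\<^sup>2 \<partial>P) = v" "(\<integral>\<omega>. Z \<omega> \<partial>P) = 0"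
proof -
  interpret prob_space P by fact
  have [measurable]: "Z \<in> borel_measurable P" using Z by (simp add: centered_gaussian_def)
  have "(\<integral>\<omega>. (Z \<omega>)\<^sup>2 \<partial>P) = v \<and> (\<integral>\<omega>. Z \<omega> \<partial>P) = 0"
  proof (cases "v = 0")
    case True
    then have ae: "AE \<omega> in P. Z \<omega> = 0" using Z by (simp add: centered_gaussian_def)
    have "(\<integral>\<omega>. (Z \<omega>)\<^sup>2 \<partial>P) = (\<integral>\<omega>. 0 \<partial>P)"
      by (rule integral_cong_AE) (use ae in auto)
    moreover have "(\<integral>\<omega>. Z \<omega> \<partial>P) = (\<integral>\<omega>. 0 \<partial>P)"
      by (rule integral_cong_AE) (use ae in auto)
    ultimately show ?thesis using True by simp
  next
    case False
    then have pos: "0 < sqrt v" using v by simp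
    have d: "distributed P lborel Z (normal_density 0 (sqrt v))"
      using Z False by (simp add: centered_gaussian_def)
    have "expectation Z = 0" by (rule normal_distributed_expectation[OF pos d])
    moreover have "variance Z = (sqrt v)\<^sup>2" by (rule normal_distributed_variance[OF pos d])
    ultimately show ?thesis using v by simp
  qed
  then show "(\<integral>\<omega>. (Z \<omega>)\<^sup>2 \<partial>P) = v" "(\<integral>\<omega>. Z \<omega> \<partial>P) = 0" by auto
qed

lemma white_noise_disjoint_Un:
  assumes lam: "white_noise P \<mu> lam" and A: "A \<in> sets \<mu>" and B: "B \<in> sets \<mu>" and dis: "A \<inter> B = {}"
  shows "AE \<omega> in P. lam (A \<union> B) \<omega> = lam A \<omega> + lam B \<omega>"
proof -
  interpret prob_space P using lam by (simp add: white_noise_def)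
  have L2: "lam C \<in> L2 P" if "C \<in> sets \<mu>" for C using lam that by (simp add: white_noise_def)
  have "centered_gaussian P (lam {}) (measure \<mu> {})"
    using lam by (simp only: white_noise_def) blast
  then have "(\<integral>\<omega>. (lam {} \<omega>)\<^sup>2 \<partial>P) = 0"
    using centered_gaussian_second_moment(1)[of P "lam {}" 0] lam
    by (simp add: white_noise_def)
  then have empty: "AE \<omega> in P. lam {} \<omega> = 0" using L2_null_iff[OF L2[of "{}"]] by simp
  \<comment> \<open>padding by empty sets, whose noise vanishes because its variance does\<close>
  define C where "C i = (if i = 0 then A else if i = 1 then B else {})" for i :: nat
  have "disjoint_family C" using dis by (auto simp: C_def disjoint_family_on_def)
  moreover have "range C \<subseteq> sets \<mu>" using A B by (auto simp: C_def)
  ultimately have lim: "L2_tendsto P (\<lambda>k \<omega>. \<Sum>i<k. lam (C i) \<omega>) (lam (\<Union>i. C i))"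
    using lam by (simp add: white_noise_def)
  have UN: "(\<Union>i. C i) = A \<union> B" by (auto simp: C_def split: if_splits)
  have lim2: "L2_tendsto P (\<lambda>k \<omega>. \<Sum>i<k+2. lam (C i) \<omega>) (lam (A \<union> B))"
    using lim LIMSEQ_ignore_initial_segment[of "\<lambda>k. \<integral>\<omega>. ((\<Sum>i<k. lam (C i) \<omega>) - lam (A \<union> B) \<omega>)\<^sup>2 \<partial>P" 0 2]
    unfolding UN L2_tendsto_def by blast
  have sums: "AE \<omega> in P. (\<Sum>i<k+2. lam (C i) \<omega>) = lam A \<omega> + lam B \<omega>" for k
  proof -
    have "(\<Sum>i<k+2. lam (C i) \<omega>) = lam A \<omega> + lam B \<omega>" if "lam {} \<omega> = 0" for \<omega>
    proof (induction k)
      case 0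
      then show ?case by (simp add: C_def numeral_2_eq_2)
    next
      case (Suc k)
      then show ?case using that by (simp add: C_def)
    qed
    then show ?thesis using empty by auto
  qed
  have "L2_tendsto P (\<lambda>k \<omega>. lam A \<omega> + lam B \<omega>) (lam (A \<union> B))"
    by (rule L2_tendsto_AE[OF lim2 _ sums]) (use A B in \<open>auto intro!: L2_measurable L2 L2_add\<close>)
  from L2_tendsto_unique[OF this L2_tendsto_const[OF L2_add[OF L2[OF A] L2[OF B]]]]
  show ?thesis .
qed

text \<open>
  The covariance of a white noise follows from its variances and its additivity: on disjoint sets,
  comparing the variance of \<open>lam (C \<union> D)\<close> with those of \<open>lam C\<close> and \<open>lam D\<close> leaves no room
  for a cross term.
\<close>

lemma white_noise_covariance:
  assumes lam: "white_noise P \<mu> lam" and A: "A \<in> sets \<mu>" and B: "B \<in> sets \<mu>"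
  shows "(\<integral>\<omega>. lam A \<omega> * lam B \<omega> \<partial>P) = measure \<mu> (A \<inter> B)"
proof -
  interpret prob_space P using lam by (simp add: white_noise_def)
  interpret mu: finite_measure \<mu> using lam by (simp add: white_noise_def)
  have L2: "lam C \<in> L2 P" if "C \<in> sets \<mu>" for C using lam that by (simp add: white_noise_def)
  have var: "(\<integral>\<omega>. (lam C \<omega>)\<^sup>2 \<partial>P) = measure \<mu> C" if "C \<in> sets \<mu>" for C
    using centered_gaussian_second_moment(1)[of P "lam C" "measure \<mu> C"] lam that
    by (simp add: white_noise_def)
  have disj: "(\<integral>\<omega>. lam C \<omega> * lam D \<omega> \<partial>P) = 0"
    if CD: "C \<in> sets \<mu>" "D \<in> sets \<mu>" "C \<inter> D = {}" for C D
  proof -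
    have [measurable]: "lam C \<in> borel_measurable P" "lam D \<in> borel_measurable P"
      "lam (C \<union> D) \<in> borel_measurable P" using L2 CD by (auto intro: L2_measurable)
    have "measure \<mu> C + measure \<mu> D = (\<integral>\<omega>. (lam (C \<union> D) \<omega>)\<^sup>2 \<partial>P)"
      using CD by (simp add: var mu.finite_measure_Union)
    also have "\<dots> = (\<integral>\<omega>. (lam C \<omega>)\<^sup>2 + (lam D \<omega>)\<^sup>2 + 2 * (lam C \<omega> * lam D \<omega>) \<partial>P)"
      by (rule integral_cong_AE)
         (use white_noise_disjoint_Un[OF lam CD] in \<open>auto simp: power2_sum\<close>)
    also have "\<dots> = measure \<mu> C + measure \<mu> D + 2 * (\<integral>\<omega>. lam C \<omega> * lam D \<omega> \<partial>P)"
      using L2[OF CD(1)] L2[OF CD(2)] L2_integrable_mult[OF L2[OF CD(1)] L2[OF CD(2)]] CD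
      by (simp add: L2_def var)
    finally show ?thesis by simp
  qed
  have AB: "A \<inter> B \<in> sets \<mu>" "A - B \<in> sets \<mu>" "B - A \<in> sets \<mu>" using A B by auto
  have [measurable]: "lam A \<in> borel_measurable P" "lam B \<in> borel_measurable P"
      "lam (A \<inter> B) \<in> borel_measurable P" "lam (A - B) \<in> borel_measurable P"
      "lam (B - A) \<in> borel_measurable P" using L2 AB A B by (auto intro: L2_measurable)
  have "(A \<inter> B) \<union> (A - B) = A" "(A \<inter> B) \<union> (B - A) = B"
    "(A \<inter> B) \<inter> (A - B) = {}" "(A \<inter> B) \<inter> (B - A) = {}" by auto
  then have ae1: "AE \<omega> in P. lam A \<omega> = lam (A \<inter> B) \<omega> + lam (A - B) \<omega>"
    and ae2: "AE \<omega> in P. lam B \<omega> = lam (A \<inter> B) \<omega> + lam (B - A) \<omega>"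
    using white_noise_disjoint_Un[OF lam AB(1,2)] white_noise_disjoint_Un[OF lam AB(1,3)] by simp_all
  have "(\<integral>\<omega>. lam A \<omega> * lam B \<omega> \<partial>P) = (\<integral>\<omega>. (lam (A \<inter> B) \<omega>)\<^sup>2 + lam (A \<inter> B) \<omega> * lam (B - A) \<omega>
      + lam (A - B) \<omega> * lam (A \<inter> B) \<omega> + lam (A - B) \<omega> * lam (B - A) \<omega> \<partial>P)"
  proof (rule integral_cong_AE)
    show "AE \<omega> in P. lam A \<omega> * lam B \<omega> = (lam (A \<inter> B) \<omega>)\<^sup>2 + lam (A \<inter> B) \<omega> * lam (B - A) \<omega>
      + lam (A - B) \<omega> * lam (A \<inter> B) \<omega> + lam (A - B) \<omega> * lam (B - A) \<omega>"
      using ae1 ae2 by eventually_elim (simp add: algebra_simps power2_eq_square)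
  qed auto
  also have "\<dots> = measure \<mu> (A \<inter> B) + (\<integral>\<omega>. lam (A \<inter> B) \<omega> * lam (B - A) \<omega> \<partial>P)
      + (\<integral>\<omega>. lam (A - B) \<omega> * lam (A \<inter> B) \<omega> \<partial>P) + (\<integral>\<omega>. lam (A - B) \<omega> * lam (B - A) \<omega> \<partial>P)"
    using L2[OF AB(1)] L2_integrable_mult[OF L2 L2] AB
    by (simp add: L2_def var)
  also have "\<dots> = measure \<mu> (A \<inter> B)"
  proof -
    have "(A \<inter> B) \<inter> (B - A) = {}" "(A - B) \<inter> (A \<inter> B) = {}" "(A - B) \<inter> (B - A) = {}" by auto
    then show ?thesis by (simp only: disj AB)
  qed
  finally show ?thesis .
qed

text \<open>
  The graph of the integral of simple functions. Being a relation rather than a function, it needs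
  no canonical form of a simple function; that the integral is well defined (up to null sets) is a
  consequence of the isometry property below.
\<close>

inductive simple_integral :: "'e measure \<Rightarrow> ('e set \<Rightarrow> 'o \<Rightarrow> real) \<Rightarrow> ('e \<Rightarrow> real) \<Rightarrow> ('o \<Rightarrow> real) \<Rightarrow> bool"
  for \<mu> lam where
  indicator: "A \<in> sets \<mu> \<Longrightarrow> simple_integral \<mu> lam (indicator A) (lam A)"
| scale: "simple_integral \<mu> lam f Y \<Longrightarrow> simple_integral \<mu> lam (\<lambda>x. c * f x) (\<lambda>\<omega>. c * Y \<omega>)"
| add: "simple_integral \<mu> lam f Y \<Longrightarrow> simple_integral \<mu> lam g Z \<Longrightarrow>
    simple_integral \<mu> lam (\<lambda>x. f x + g x) (\<lambda>\<omega>. Y \<omega> + Z \<omega>)"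

lemma simple_integral_L2:
  assumes "white_noise P \<mu> lam" "simple_integral \<mu> lam f Y"
  shows "f \<in> L2 \<mu> \<and> Y \<in> L2 P"
  using assms(2)
  by induction (use assms(1) in \<open>auto simp: white_noise_def intro: L2_indicator L2_mult L2_add\<close>)

lemma simple_integral_isometry:
  assumes lam: "white_noise P \<mu> lam"
    and f: "simple_integral \<mu> lam f Y" and g: "simple_integral \<mu> lam g Z"
  shows "(\<integral>\<omega>. Y \<omega> * Z \<omega> \<partial>P) = (\<integral>x. f x * g x \<partial>\<mu>)"
proof -
  note L2 = simple_integral_L2[OF lam]
  have ind: "(\<integral>\<omega>. Y \<omega> * lam A \<omega> \<partial>P) = (\<integral>x. f x * indicator A x \<partial>\<mu>)"
    if A: "A \<in> sets \<mu>" for A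
    using f
  proof induction
    case (indicator B)
    have "(\<lambda>x. indicator B x * indicator A x :: real) = indicator (B \<inter> A)"
      by (auto split: split_indicator)
    then show ?case using white_noise_covariance[OF lam indicator A] indicator A by simp
  next
    case (scale f Y c)
    then show ?case by (simp add: mult.assoc)
  next
    case (add f Y g Z)
    have i: "simple_integral \<mu> lam (indicator A) (lam A)" by (rule simple_integral.indicator[OF A])
    show ?case
      using add L2[OF add.hyps(1)] L2[OF add.hyps(2)] L2[OF i]
      by (simp add: distrib_right L2_integrable_mult)
  qed
  show ?thesis using g
  proof induction
    case (indicator A)
    then show ?case by (rule ind)
  next
    case (scale g Z c)
    then show ?case by (simp add: mult.left_commute[of _ c])
  next
    case (add g Z h W)
    then show ?case
      using L2[OF add.hyps(1)] L2[OF add.hyps(2)] L2[OF f]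
      by (simp add: distrib_left L2_integrable_mult)
  qed
qed

lemma simple_integral_dense:
  assumes lam: "white_noise P \<mu> lam" and f: "f \<in> L2 \<mu>" and "\<epsilon> > 0"
  shows "\<exists>s Y. simple_integral \<mu> lam s Y \<and> (\<integral>x. (s x - f x)\<^sup>2 \<partial>\<mu>) < \<epsilon>"
proof -
  have fin: "finite_measure \<mu>" using lam by (simp add: white_noise_def)
  note L2 = simple_integral_L2[OF lam]
  from fin f show ?thesis using \<open>\<epsilon> > 0\<close>
  proof (induction arbitrary: \<epsilon> rule: L2_induct)
    case (indicator A)
    then show ?case using simple_integral.indicator[of A \<mu> lam] by (intro exI[of _ "indicator A"]) auto
  next
    case (scale c g)
    \<comment> \<open>the summand \<open>1\<close> covers \<open>c = 0\<close>\<close>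
    let ?d = "\<epsilon> / (c\<^sup>2 + 1)"
    have pos: "c\<^sup>2 + 1 > 0" by (smt (verit) zero_le_power2)
    then have "?d > 0" using scale.prems by simp
    from scale.IH[OF this] obtain s Y where s: "simple_integral \<mu> lam s Y"
      and le: "(\<integral>x. (s x - g x)\<^sup>2 \<partial>\<mu>) < ?d" by auto
    let ?I = "\<integral>x. (s x - g x)\<^sup>2 \<partial>\<mu>"
    have "(c * s x - c * g x)\<^sup>2 = c\<^sup>2 * (s x - g x)\<^sup>2" for x
      by (simp add: power_mult_distrib flip: right_diff_distrib)
    then have "(\<integral>x. (c * s x - c * g x)\<^sup>2 \<partial>\<mu>) = c\<^sup>2 * ?I" by simp
    also have "\<dots> \<le> (c\<^sup>2 + 1) * ?I" by (intro mult_right_mono) auto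
    also have "\<dots> < \<epsilon>" using le pos by (simp add: field_simps)
    finally show ?case using simple_integral.scale[OF s, of c] by blast
  next
    case (add g h)
    have e: "\<epsilon> / 4 > 0" using add.prems by simp
    from add.IH(1)[OF e] obtain s Y where s: "simple_integral \<mu> lam s Y"
      and s_le: "(\<integral>x. (s x - g x)\<^sup>2 \<partial>\<mu>) < \<epsilon> / 4" by auto
    from add.IH(2)[OF e] obtain t Z where t: "simple_integral \<mu> lam t Z"
      and t_le: "(\<integral>x. (t x - h x)\<^sup>2 \<partial>\<mu>) < \<epsilon> / 4" by auto
    have "(\<integral>x. ((s x - g x) + (t x - h x))\<^sup>2 \<partial>\<mu>) \<le>
        2 * (\<integral>x. (s x - g x)\<^sup>2 \<partial>\<mu>) + 2 * (\<integral>x. (t x - h x)\<^sup>2 \<partial>\<mu>)"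
      using L2[OF s] L2[OF t] add.hyps by (intro L2_sum_squared_le L2_diff) auto
    also have "\<dots> < \<epsilon>" using s_le t_le by simp
    finally have "(\<integral>x. ((s x + t x) - (g x + h x))\<^sup>2 \<partial>\<mu>) < \<epsilon>" by (simp add: algebra_simps)
    then show ?case using simple_integral.add[OF s t] by blast
  next
    case (lim s g)
    have e: "\<epsilon> / 4 > 0" using lim.prems by simp
    then obtain k where k: "(\<integral>x. (s k x - g x)\<^sup>2 \<partial>\<mu>) < \<epsilon> / 4"
      using lim.hyps LIMSEQ_D[of "\<lambda>k. \<integral>x. (s k x - g x)\<^sup>2 \<partial>\<mu>" 0 "\<epsilon>/4"]
      by (auto simp: L2_tendsto_def)
    from lim.IH[OF e, of k] obtain t Z where t: "simple_integral \<mu> lam t Z"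
      and t_le: "(\<integral>x. (t x - s k x)\<^sup>2 \<partial>\<mu>) < \<epsilon> / 4" by auto
    have "(\<integral>x. ((t x - s k x) + (s k x - g x))\<^sup>2 \<partial>\<mu>) \<le>
        2 * (\<integral>x. (t x - s k x)\<^sup>2 \<partial>\<mu>) + 2 * (\<integral>x. (s k x - g x)\<^sup>2 \<partial>\<mu>)"
      using L2[OF t] lim.hyps by (intro L2_sum_squared_le L2_diff) (auto simp: L2_tendsto_def)
    also have "\<dots> < \<epsilon>" using k t_le by simp
    finally show ?case using t by auto
  qed
qed

text \<open>
  The graph \<open>simple_integral\<close> is isometric and has dense domain, hence its closure is the graph of
  an isometry defined on all of \<open>L2 \<mu>\<close>; linearity comes for free from the isometry property.
\<close>

lemma wn_extension_exists:
  assumes lam: "white_noise P \<mu> lam"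
  shows "\<exists>J. wn_extension P \<mu> lam J"
proof -
  interpret prob_space P using lam by (simp add: white_noise_def)
  interpret mu: finite_measure \<mu> using lam by (simp add: white_noise_def)
  note L2 = simple_integral_L2[OF lam]
  have "\<exists>Y. \<exists>s Z. (\<forall>k. simple_integral \<mu> lam (s k) (Z k)) \<and> L2_tendsto \<mu> s f \<and> L2_tendsto P Z Y"
    if f: "f \<in> L2 \<mu>" for f
  proof -
    have "\<exists>s Z. simple_integral \<mu> lam s Z \<and> (\<integral>x. (s x - f x)\<^sup>2 \<partial>\<mu>) < inverse (Suc k)" for k :: nat
      by (rule simple_integral_dense[OF lam f]) simp
    then obtain s Z where s: "\<And>k. simple_integral \<mu> lam (s k) (Z k)"
      and le: "\<And>k. (\<integral>x. (s k x - f x)\<^sup>2 \<partial>\<mu>) < inverse (Suc k)" by metis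
    have "(\<lambda>k. \<integral>x. (s k x - f x)\<^sup>2 \<partial>\<mu>) \<longlonglongrightarrow> 0"
      by (rule tendsto_sandwich[OF _ _ tendsto_const LIMSEQ_inverse_real_of_nat])
         (auto intro!: always_eventually less_imp_le[OF le] simp del: of_nat_Suc)
    then have lim: "L2_tendsto \<mu> s f" using L2[OF s] f by (auto simp: L2_tendsto_def)
    have "\<exists>Y. L2_tendsto P Z Y"
    proof (rule L2_complete)
      show "Z k \<in> L2 P" for k using L2[OF s] by blast
      fix \<epsilon> :: real assume "\<epsilon> > 0"
      then obtain n0 where n0: "\<And>k. k \<ge> n0 \<Longrightarrow> (\<integral>x. (s k x - f x)\<^sup>2 \<partial>\<mu>) < \<epsilon> / 4"
        using lim LIMSEQ_D[of "\<lambda>k. \<integral>x. (s k x - f x)\<^sup>2 \<partial>\<mu>" 0 "\<epsilon>/4"]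
        by (auto simp: L2_tendsto_def)
      have "(\<integral>\<omega>. (Z k \<omega> - Z l \<omega>)\<^sup>2 \<partial>P) < \<epsilon>" if "k \<ge> n0" "l \<ge> n0" for k l
      proof -
        have "simple_integral \<mu> lam (\<lambda>x. s k x + (-1) * s l x) (\<lambda>\<omega>. Z k \<omega> + (-1) * Z l \<omega>)"
          by (intro simple_integral.add simple_integral.scale s)
        from simple_integral_isometry[OF lam this this]
        have "(\<integral>\<omega>. (Z k \<omega> - Z l \<omega>)\<^sup>2 \<partial>P) = (\<integral>x. ((s k x - f x) + (-1) * (s l x - f x))\<^sup>2 \<partial>\<mu>)"
          by (simp add: power2_eq_square)
        also have "\<dots> \<le> 2 * (\<integral>x. (s k x - f x)\<^sup>2 \<partial>\<mu>) + 2 * (\<integral>x. ((-1) * (s l x - f x))\<^sup>2 \<partial>\<mu>)"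
          by (intro L2_sum_squared_le L2_mult L2_diff f) (use L2[OF s] in auto)
        also have "\<dots> < \<epsilon>" using n0[OF that(1)] n0[OF that(2)] by (simp add: power2_commute)
        finally show ?thesis .
      qed
      then show "\<exists>n0. \<forall>k\<ge>n0. \<forall>l\<ge>n0. (\<integral>\<omega>. (Z k \<omega> - Z l \<omega>)\<^sup>2 \<partial>P) < \<epsilon>" by blast
    qed
    then show ?thesis using s lim by blast
  qed
  then obtain J where J: "\<And>f. f \<in> L2 \<mu> \<Longrightarrow> \<exists>s Z. (\<forall>k. simple_integral \<mu> lam (s k) (Z k)) \<and>
      L2_tendsto \<mu> s f \<and> L2_tendsto P Z (J f)" by metis
  have JL2: "J f \<in> L2 P" if "f \<in> L2 \<mu>" for f using J[OF that] by (auto simp: L2_tendsto_def)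
  have iso: "(\<integral>\<omega>. J f \<omega> * J g \<omega> \<partial>P) = (\<integral>x. f x * g x \<partial>\<mu>)" if f: "f \<in> L2 \<mu>" and g: "g \<in> L2 \<mu>" for f g
  proof -
    obtain s Z where s: "\<And>k. simple_integral \<mu> lam (s k) (Z k)" "L2_tendsto \<mu> s f" "L2_tendsto P Z (J f)"
      using J[OF f] by blast
    obtain t W where t: "\<And>k. simple_integral \<mu> lam (t k) (W k)" "L2_tendsto \<mu> t g" "L2_tendsto P W (J g)"
      using J[OF g] by blast
    have "(\<lambda>k. \<integral>\<omega>. Z k \<omega> * W k \<omega> \<partial>P) \<longlonglongrightarrow> (\<integral>\<omega>. J f \<omega> * J g \<omega> \<partial>P)"
      by (rule L2_tendsto_inner[OF s(3) t(3)])
    moreover have "(\<lambda>k. \<integral>\<omega>. Z k \<omega> * W k \<omega> \<partial>P) \<longlonglongrightarrow> (\<integral>x. f x * g x \<partial>\<mu>)"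
      using L2_tendsto_inner[OF s(2) t(2)] simple_integral_isometry[OF lam s(1) t(1)] by simp
    ultimately show ?thesis by (rule LIMSEQ_unique)
  qed
  have ind: "AE \<omega> in P. J (indicator A) \<omega> = lam A \<omega>" if A: "A \<in> sets \<mu>" for A
  proof -
    have iA: "(indicator A :: _ \<Rightarrow> real) \<in> L2 \<mu>" by (rule L2_indicator[OF mu.finite_measure_axioms A])
    note sA = simple_integral.indicator[OF A, of lam]
    obtain s Z where s: "\<And>k. simple_integral \<mu> lam (s k) (Z k)" "L2_tendsto \<mu> s (indicator A)"
      "L2_tendsto P Z (J (indicator A))"
      using J[OF iA] by blast
    have "(\<lambda>k. \<integral>\<omega>. Z k \<omega> * lam A \<omega> \<partial>P) \<longlonglongrightarrow> (\<integral>\<omega>. J (indicator A) \<omega> * lam A \<omega> \<partial>P)"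
      using L2[OF sA] by (intro L2_tendsto_inner[OF s(3)] L2_tendsto_const) auto
    moreover have "(\<lambda>k. \<integral>\<omega>. Z k \<omega> * lam A \<omega> \<partial>P) \<longlonglongrightarrow> (\<integral>x. indicator A x * indicator A x \<partial>\<mu>)"
      using L2_tendsto_inner[OF s(2) L2_tendsto_const[OF iA]] simple_integral_isometry[OF lam s(1) sA] by simp
    ultimately have "(\<integral>\<omega>. J (indicator A) \<omega> * lam A \<omega> \<partial>P) = (\<integral>x. indicator A x * indicator A x \<partial>\<mu>)"
      by (rule LIMSEQ_unique)
    then have "(\<integral>\<omega>. (J (indicator A) \<omega> - lam A \<omega>)\<^sup>2 \<partial>P) = 0"
      using iso[OF iA iA] simple_integral_isometry[OF lam sA sA] L2_diff_squared[OF JL2[OF iA], of "lam A"] L2[OF sA]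
      by (simp add: power2_eq_square)
    then show ?thesis using L2_null_iff[OF L2_diff[OF JL2[OF iA], of "lam A"]] L2[OF sA] by simp
  qed
  have J_linear: "AE \<omega> in P. J (\<lambda>x. a * f x + b * g x) \<omega> = a * J f \<omega> + b * J g \<omega>"
    if f: "f \<in> L2 \<mu>" and g: "g \<in> L2 \<mu>" for a b f g
  proof -
    let ?h = "\<lambda>x. a * f x + b * g x"
    have h: "?h \<in> L2 \<mu>" by (intro L2_add L2_mult f g)
    have lin: "(\<integral>\<omega>. J q \<omega> * J ?h \<omega> \<partial>P) = a * (\<integral>\<omega>. J q \<omega> * J f \<omega> \<partial>P) + b * (\<integral>\<omega>. J q \<omega> * J g \<omega> \<partial>P)"
      if q: "q \<in> L2 \<mu>" for q
    proof -
      have "q x * ?h x = a * (q x * f x) + b * (q x * g x)" for x by (simp add: algebra_simps)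
      then have "(\<integral>x. q x * ?h x \<partial>\<mu>) = a * (\<integral>x. q x * f x \<partial>\<mu>) + b * (\<integral>x. q x * g x \<partial>\<mu>)"
        by (simp only:) (simp add: L2_integrable_mult q f g)
      then show ?thesis by (simp only: iso q f g h)
    qed
    show ?thesis by (rule L2_AE_linear_combination) (intro JL2 f g h lin)+
  qed
  have "wn_extension P \<mu> lam J"
    unfolding wn_extension_def
  proof (intro conjI ballI allI)
    show "J f \<in> L2 P" if "f \<in> L2 \<mu>" for f by (rule JL2[OF that])
    show "(\<integral>\<omega>. (J f \<omega>)\<^sup>2 \<partial>P) = (\<integral>x. (f x)\<^sup>2 \<partial>\<mu>)" if "f \<in> L2 \<mu>" for f
      using iso[OF that that] by (simp add: power2_eq_square)
    show "AE \<omega> in P. J (\<lambda>x. f x + g x) \<omega> = J f \<omega> + J g \<omega>" if "f \<in> L2 \<mu>" "g \<in> L2 \<mu>" for f g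
      using J_linear[OF that, of 1 1] by simp
    show "AE \<omega> in P. J (\<lambda>x. c * f x) \<omega> = c * J f \<omega>" if "f \<in> L2 \<mu>" for f c
      using J_linear[OF that that, of c 0] by simp
  qed (rule ind)
  then show ?thesis by blast
qed

lemma wn_extension_wn_integral:
  "wn_extension P \<mu> lam J \<Longrightarrow> wn_extension P \<mu> lam (wn_integral P \<mu> lam)"
  unfolding wn_integral_def by (rule someI[of "wn_extension P \<mu> lam"])

lemma wn_extension_L2: "wn_extension P \<mu> lam J \<Longrightarrow> f \<in> L2 \<mu> \<Longrightarrow> J f \<in> L2 P"
  by (simp add: wn_extension_def)

lemma wn_extension_linear:
  assumes J: "wn_extension P \<mu> lam J" and f: "f \<in> L2 \<mu>" and g: "g \<in> L2 \<mu>"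
  shows "AE \<omega> in P. J (\<lambda>x. a * f x + b * g x) \<omega> = a * J f \<omega> + b * J g \<omega>"
proof -
  have "AE \<omega> in P. J (\<lambda>x. a * f x + b * g x) \<omega> = J (\<lambda>x. a * f x) \<omega> + J (\<lambda>x. b * g x) \<omega>"
    using J L2_mult[OF f] L2_mult[OF g] by (simp add: wn_extension_def)
  moreover have "AE \<omega> in P. J (\<lambda>x. a * f x) \<omega> = a * J f \<omega>" "AE \<omega> in P. J (\<lambda>x. b * g x) \<omega> = b * J g \<omega>"
    using J f g by (simp_all add: wn_extension_def)
  ultimately show ?thesis by eventually_elim simp
qed

lemma wn_extension_norm_diff:
  assumes J: "wn_extension P \<mu> lam J" and f: "f \<in> L2 \<mu>" and g: "g \<in> L2 \<mu>"
  shows "(\<integral>\<omega>. (J f \<omega> - J g \<omega>)\<^sup>2 \<partial>P) = (\<integral>x. (f x - g x)\<^sup>2 \<partial>\<mu>)"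
proof -
  have L2: "(\<lambda>x. f x - g x) \<in> L2 \<mu>" by (rule L2_diff[OF f g])
  have "(\<integral>\<omega>. (J f \<omega> - J g \<omega>)\<^sup>2 \<partial>P) = (\<integral>\<omega>. (J (\<lambda>x. f x - g x) \<omega>)\<^sup>2 \<partial>P)"
  proof (rule integral_cong_AE)
    show "AE \<omega> in P. (J f \<omega> - J g \<omega>)\<^sup>2 = (J (\<lambda>x. f x - g x) \<omega>)\<^sup>2"
      using wn_extension_linear[OF J f g, of 1 "-1"] by eventually_elim simp
    show "(\<lambda>\<omega>. (J f \<omega> - J g \<omega>)\<^sup>2) \<in> borel_measurable P"
      using L2_measurable[OF wn_extension_L2[OF J f]] L2_measurable[OF wn_extension_L2[OF J g]]
      by measurable
    show "(\<lambda>\<omega>. (J (\<lambda>x. f x - g x) \<omega>)\<^sup>2) \<in> borel_measurable P"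
      using L2_measurable[OF wn_extension_L2[OF J L2]] by measurable
  qed
  also have "\<dots> = (\<integral>x. (f x - g x)\<^sup>2 \<partial>\<mu>)" using J L2 by (simp add: wn_extension_def)
  finally show ?thesis .
qed

lemma wn_extension_isometry:
  assumes J: "wn_extension P \<mu> lam J" and f: "f \<in> L2 \<mu>" and g: "g \<in> L2 \<mu>"
  shows "(\<integral>\<omega>. J f \<omega> * J g \<omega> \<partial>P) = (\<integral>x. f x * g x \<partial>\<mu>)"
proof -
  have "(\<integral>\<omega>. (J h \<omega>)\<^sup>2 \<partial>P) = (\<integral>x. (h x)\<^sup>2 \<partial>\<mu>)" if "h \<in> L2 \<mu>" for h
    using J that by (simp add: wn_extension_def)
  then show ?thesis
    using wn_extension_norm_diff[OF J f g] L2_diff_squared[OF f g]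
      L2_diff_squared[OF wn_extension_L2[OF J f] wn_extension_L2[OF J g]] f g
    by simp
qed

lemma wn_extension_tendsto:
  assumes J: "wn_extension P \<mu> lam J" and s: "L2_tendsto \<mu> s f"
  shows "L2_tendsto P (\<lambda>k. J (s k)) (J f)"
proof -
  have sf: "s k \<in> L2 \<mu>" "f \<in> L2 \<mu>" for k using s by (auto simp: L2_tendsto_def)
  show ?thesis
    using s sf by (simp add: L2_tendsto_def wn_extension_norm_diff[OF J] wn_extension_L2[OF J])
qed

text \<open>
  The integral against a white noise is a choice among extensions. Since any two of them agree
  almost surely, it may be computed from whichever extension is at hand.
\<close>

lemma wn_extension_unique:
  assumes fin: "finite_measure \<mu>" and J: "wn_extension P \<mu> lam J" and K: "wn_extension P \<mu> lam K"
    and f: "f \<in> L2 \<mu>"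
  shows "AE \<omega> in P. J f \<omega> = K f \<omega>"
  using fin f
proof (induction rule: L2_induct)
  case (indicator A)
  then have "AE \<omega> in P. J (indicator A) \<omega> = lam A \<omega>" "AE \<omega> in P. K (indicator A) \<omega> = lam A \<omega>"
    using J K by (simp_all add: wn_extension_def)
  then show ?case by eventually_elim simp
next
  case (scale c g)
  then show ?case
    using wn_extension_linear[OF J scale.hyps scale.hyps, of c 0]
      wn_extension_linear[OF K scale.hyps scale.hyps, of c 0]
    by auto
next
  case (add g h)
  show ?case
    using add.IH wn_extension_linear[OF J add.hyps, of 1 1] wn_extension_linear[OF K add.hyps, of 1 1]
    by auto
next
  case (lim s g)
  note Js = wn_extension_tendsto[OF J lim.hyps] and Ks = wn_extension_tendsto[OF K lim.hyps]
  have "L2_tendsto P (\<lambda>k. K (s k)) (J g)"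
    by (rule L2_tendsto_AE[OF Js _ lim.IH])
       (use Js Ks in \<open>auto simp: L2_tendsto_def intro: L2_measurable\<close>)
  from L2_tendsto_unique[OF this Ks] show ?case .
qed

text \<open>
  Orthogonality of two white noises is inherited by their integrals, one factor at a time.
\<close>

lemma wn_extension_uncorrelated:
  assumes fin: "finite_measure \<mu>" "finite_measure \<mu>'"
    and J: "wn_extension P \<mu> lam J" and K: "wn_extension P \<mu>' lam' K"
    and unc: "\<And>A B. A \<in> sets \<mu> \<Longrightarrow> B \<in> sets \<mu>' \<Longrightarrow> (\<integral>\<omega>. J (indicator A) \<omega> * K (indicator B) \<omega> \<partial>P) = 0"
    and f: "f \<in> L2 \<mu>" and g: "g \<in> L2 \<mu>'"
  shows "(\<integral>\<omega>. J f \<omega> * K g \<omega> \<partial>P) = 0"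
proof -
  \<comment> \<open>one induction, used for each of the two factors\<close>
  have step: "(\<integral>\<omega>. J f \<omega> * Y \<omega> \<partial>P) = 0"
    if fin: "finite_measure \<mu>" and J: "wn_extension P \<mu> lam J" and f: "f \<in> L2 \<mu>" and Y: "Y \<in> L2 P"
      and ind: "\<And>A. A \<in> sets \<mu> \<Longrightarrow> (\<integral>\<omega>. J (indicator A) \<omega> * Y \<omega> \<partial>P) = 0"
    for \<mu> :: "'x measure" and lam J f Y
    using fin f
  proof (induction rule: L2_induct)
    case (indicator A)
    then show ?case by (rule ind)
  next
    case (scale c g)
    note J' = wn_extension_L2[OF J]
    have "(\<integral>\<omega>. J (\<lambda>x. c * g x) \<omega> * Y \<omega> \<partial>P) = (\<integral>\<omega>. c * (J g \<omega> * Y \<omega>) \<partial>P)"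
    proof (rule integral_cong_AE)
      show "AE \<omega> in P. J (\<lambda>x. c * g x) \<omega> * Y \<omega> = c * (J g \<omega> * Y \<omega>)"
        using wn_extension_linear[OF J scale.hyps scale.hyps, of c 0] by auto
    qed (use L2_measurable[OF J'[OF L2_mult[OF scale.hyps(1), of c]]]
        L2_measurable[OF J'[OF scale.hyps]] L2_measurable[OF Y] in measurable)
    then show ?case using scale.IH by simp
  next
    case (add g h)
    note J' = wn_extension_L2[OF J]
    have "(\<integral>\<omega>. J (\<lambda>x. g x + h x) \<omega> * Y \<omega> \<partial>P) = (\<integral>\<omega>. J g \<omega> * Y \<omega> + J h \<omega> * Y \<omega> \<partial>P)"
    proof (rule integral_cong_AE)
      show "AE \<omega> in P. J (\<lambda>x. g x + h x) \<omega> * Y \<omega> = J g \<omega> * Y \<omega> + J h \<omega> * Y \<omega>"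
        using wn_extension_linear[OF J add.hyps, of 1 1] by (auto simp: distrib_right)
    qed (use L2_measurable[OF J'[OF L2_add[OF add.hyps]]]
        L2_measurable[OF J'[OF add.hyps(1)]] L2_measurable[OF J'[OF add.hyps(2)]] L2_measurable[OF Y] in measurable)
    also have "\<dots> = 0"
      using add.IH L2_integrable_mult[OF J'[OF add.hyps(1)] Y] L2_integrable_mult[OF J'[OF add.hyps(2)] Y]
      by simp
    finally show ?case .
  next
    case (lim s g)
    have "(\<lambda>k. \<integral>\<omega>. J (s k) \<omega> * Y \<omega> \<partial>P) \<longlonglongrightarrow> (\<integral>\<omega>. J g \<omega> * Y \<omega> \<partial>P)"
      by (rule L2_tendsto_inner[OF wn_extension_tendsto[OF J lim.hyps] L2_tendsto_const[OF Y]])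
    then show ?case using lim.IH by (simp add: LIMSEQ_const_iff)
  qed
  show ?thesis
  proof (rule step[OF fin(1) J f wn_extension_L2[OF K g]])
    fix A assume A: "A \<in> sets \<mu>"
    show "(\<integral>\<omega>. J (indicator A) \<omega> * K g \<omega> \<partial>P) = 0"
      using step[OF fin(2) K g wn_extension_L2[OF J L2_indicator[OF fin(1) A]] ]
      unc[OF A] by (simp add: mult.commute)
  qed
qed

lemma hilbert_white_noise_uncorrelated:
  assumes \<nu>: "hilbert_white_noise P M N e \<nu>" and ij: "i \<in> N" "j \<in> N" "i \<noteq> j"
    and A: "A \<in> sets M" and B: "B \<in> sets M"
  shows "(\<integral>\<omega>. \<nu> i A \<omega> * \<nu> j B \<omega> \<partial>P) = 0"
proof -
  interpret prob_space P using \<nu> by (simp add: hilbert_white_noise_def)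
  have wn: "white_noise P M (\<nu> n)" if "n \<in> N" for n using \<nu> that by (simp add: hilbert_white_noise_def)
  have L2: "\<nu> n C \<in> L2 P" if "n \<in> N" "C \<in> sets M" for n C using wn that by (simp add: white_noise_def)
  define C where "C n = (if n = i then A else B)" for n
  have C: "C n \<in> sets M" for n using A B by (simp add: C_def)
  have "indep_vars (\<lambda>_. Pi\<^sub>M (sets M) (\<lambda>_. borel)) (\<lambda>n \<omega>. \<lambda>A\<in>sets M. \<nu> n A \<omega>) {i, j}"
    by (rule indep_vars_subset[of _ _ N]) (use \<nu> ij in \<open>auto simp: hilbert_white_noise_def\<close>)
  then have "indep_vars (\<lambda>_. borel) (\<lambda>n \<omega>. (\<lambda>A\<in>sets M. \<nu> n A \<omega>) (C n)) {i, j}"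
    by (rule indep_vars_compose2[where Y = "\<lambda>n f. f (C n)"])
       (intro measurable_component_singleton C)
  then have ind: "indep_vars (\<lambda>_. borel) (\<lambda>n. \<nu> n (C n)) {i, j}" by (simp add: C)
  have int: "integrable P (\<nu> n (C n))" if "n \<in> {i, j}" for n
    using L2_integrable_mult[OF L2[of n "C n"], of "\<lambda>_. 1"] that ij C by (auto simp: L2_def)
  have "(\<integral>\<omega>. (\<Prod>n\<in>{i, j}. \<nu> n (C n) \<omega>) \<partial>P) = (\<Prod>n\<in>{i, j}. \<integral>\<omega>. \<nu> n (C n) \<omega> \<partial>P)"
    by (rule indep_vars_lebesgue_integral[OF _ ind int]) auto
  moreover have "(\<integral>\<omega>. \<nu> i A \<omega> \<partial>P) = 0"
    using wn[OF ij(1)] A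
    by (intro centered_gaussian_second_moment(2)[OF prob_space_axioms, of _ "measure M A"])
       (auto simp: white_noise_def)
  ultimately show ?thesis using ij by (simp add: C_def)
qed

section \<open>Expansion in an orthonormal system\<close>

text \<open>
  The orthogonal projection onto the span of the first vectors of the orthonormal system.
\<close>

definition partial_expansion :: "nat set \<Rightarrow> (nat \<Rightarrow> 'h::real_inner) \<Rightarrow> nat \<Rightarrow> 'h \<Rightarrow> 'h" where
  "partial_expansion N e k x = (\<Sum>n\<in>N \<inter> {..<k}. (x \<bullet> e n) *\<^sub>R e n)"

lemma partial_expansion_inner:
  "partial_expansion N e k x \<bullet> y = (\<Sum>n\<in>N \<inter> {..<k}. (x \<bullet> e n) * (y \<bullet> e n))"
  by (simp add: partial_expansion_def inner_sum_left inner_commute[of y])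

lemma partial_expansion_add:
  "partial_expansion N e k (x + y) = partial_expansion N e k x + partial_expansion N e k y"
  by (simp add: partial_expansion_def inner_add_left scaleR_left_distrib sum.distrib)

lemma partial_expansion_scaleR:
  "partial_expansion N e k (c *\<^sub>R x) = c *\<^sub>R partial_expansion N e k x"
  by (simp add: partial_expansion_def scaleR_sum_right)

lemma norm_partial_expansion_le:
  assumes e: "complete_orthonormal N e"
  shows "norm (partial_expansion N e k x) \<le> norm x"
proof -
  let ?p = "partial_expansion N e k x"
  have "?p \<bullet> e n = x \<bullet> e n" if "n \<in> N \<inter> {..<k}" for n
  proof -
    have "?p \<bullet> e n = (\<Sum>m\<in>N \<inter> {..<k}. if m = n then x \<bullet> e n else 0)"
      unfolding partial_expansion_def inner_sum_left
      using e that by (intro sum.cong) (auto simp: complete_orthonormal_def)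
    then show ?thesis using that by simp
  qed
  then have "?p \<bullet> ?p = ?p \<bullet> x"
    unfolding partial_expansion_inner[of _ _ _ _ ?p] partial_expansion_inner[of _ _ _ _ x] by simp
  also have "\<dots> \<le> norm ?p * norm x" by (rule norm_cauchy_schwarz)
  finally show ?thesis
    by (cases "?p = 0") (auto simp: power2_norm_eq_inner[symmetric] power2_eq_square)
qed

text \<open>
  The vectors for which the projections converge form a closed subspace that contains the
  orthonormal system.
\<close>

lemma partial_expansion_tendsto:
  assumes e: "complete_orthonormal N e"
  shows "(\<lambda>k. partial_expansion N e k x) \<longlonglongrightarrow> x"
proof -
  let ?p = "partial_expansion N e"
  define S where "S = {x. (\<lambda>k. ?p k x) \<longlonglongrightarrow> x}"
  have "subspace S"
    unfolding subspace_def S_def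
    by (auto simp: partial_expansion_add partial_expansion_scaleR intro: tendsto_intros)
       (simp add: partial_expansion_def)
  moreover have "e ` N \<subseteq> S"
  proof
    fix y assume "y \<in> e ` N"
    then obtain i where i: "i \<in> N" "y = e i" by auto
    have "?p k y = y" if "k > i" for k
    proof -
      have "?p k y = (\<Sum>n\<in>N \<inter> {..<k}. if n = i then e i else 0)"
        unfolding partial_expansion_def i(2)
        using e i(1) by (intro sum.cong) (auto simp: complete_orthonormal_def)
      then show ?thesis using that i by simp
    qed
    then have "(\<lambda>k. ?p k y) \<longlonglongrightarrow> y"
      by (intro tendsto_eventually) (auto simp: eventually_sequentially intro: exI[of _ "Suc i"])
    then show "y \<in> S" by (simp add: S_def)
  qed
  ultimately have S: "span (e ` N) \<subseteq> S" by (intro span_minimal)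
  have "x \<in> closure (span (e ` N))" using e by (simp add: complete_orthonormal_def)
  show ?thesis
  proof (rule LIMSEQ_I)
    fix \<epsilon> :: real assume \<epsilon>: "\<epsilon> > 0"
    then obtain y where y: "y \<in> S" "norm (y - x) < \<epsilon> / 3"
      using \<open>x \<in> closure _\<close> S unfolding closure_approachable dist_norm
      by (meson subsetD zero_less_divide_iff zero_less_numeral)
    then obtain k0 where k0: "\<And>k. k \<ge> k0 \<Longrightarrow> norm (?p k y - y) < \<epsilon> / 3"
      using \<epsilon> LIMSEQ_D[of "\<lambda>k. ?p k y" y "\<epsilon> / 3"] by (auto simp: S_def)
    have "norm (?p k x - x) < \<epsilon>" if "k \<ge> k0" for k
    proof -
      have "?p k x = ?p k (x - y) + ?p k y" by (simp flip: partial_expansion_add)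
      then have "norm (?p k x - x) = norm (?p k (x - y) + (?p k y - y) + (y - x))" by simp
      also have "\<dots> \<le> norm (?p k (x - y)) + norm (?p k y - y) + norm (y - x)"
        by (intro order_trans[OF norm_triangle_ineq] add_right_mono norm_triangle_ineq)
      also have "\<dots> < \<epsilon>"
        using norm_partial_expansion_le[OF e, of k "x - y"] k0[OF that] y(2)
        by (simp add: norm_minus_commute)
      finally show ?thesis .
    qed
    then show "\<exists>k0. \<forall>k\<ge>k0. norm (?p k x - x) < \<epsilon>" by blast
  qed
qed

section \<open>The scalar noise of a vector field\<close>

text \<open>
  Below, \<open>J n\<close> is the integral against the \<open>n\<close>-th component of the noise, and \<open>I \<psi> A\<close> is the value
  on \<open>A\<close> of the scalar noise obtained by pairing the vector field \<open>\<psi>\<close> with the \<open>H\<close>-valued noise.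
\<close>

locale hilbert_noise =
  fixes P :: "'o measure" and M :: "'w measure" and N :: "nat set"
    and e :: "nat \<Rightarrow> 'h::{real_inner, second_countable_topology}"
    and \<nu> :: "nat \<Rightarrow> 'w set \<Rightarrow> 'o \<Rightarrow> real"
  assumes noise: "hilbert_white_noise P M N e \<nu>"
    and finite_M: "finite_measure M"
begin

sublocale P: prob_space P
  using noise by (simp add: hilbert_white_noise_def)

abbreviation "J n \<equiv> wn_integral P M (\<nu> n)"
abbreviation "I \<equiv> wn_inner P M N e \<nu>"

lemma orthonormal: "complete_orthonormal N e"
  using noise by (simp add: hilbert_white_noise_def)

lemma J_extension: "n \<in> N \<Longrightarrow> wn_extension P M (\<nu> n) (J n)"
  using noise wn_extension_exists[of P M "\<nu> n"] wn_extension_wn_integral[of P M "\<nu> n"]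
  by (auto simp: hilbert_white_noise_def)

lemmas J_L2 = wn_extension_L2[OF J_extension]

lemma J_covariance:
  assumes n: "n \<in> N" and m: "m \<in> N" and f: "f \<in> L2 M" and g: "g \<in> L2 M"
  shows "(\<integral>\<omega>. J n f \<omega> * J m g \<omega> \<partial>P) = (if n = m then \<integral>x. f x * g x \<partial>M else 0)"
proof (cases "n = m")
  case True
  then show ?thesis using wn_extension_isometry[OF J_extension[OF n] f g] by simp
next
  case False
  have "(\<integral>\<omega>. J n (indicator A) \<omega> * J m (indicator B) \<omega> \<partial>P) = 0"
    if A: "A \<in> sets M" and B: "B \<in> sets M" for A B
  proof -
    have [measurable]: "\<nu> n A \<in> borel_measurable P" "\<nu> m B \<in> borel_measurable P"
      using noise n m A B by (auto simp: hilbert_white_noise_def white_noise_def intro: L2_measurable)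
    have [measurable]: "J n (indicator A) \<in> borel_measurable P" "J m (indicator B) \<in> borel_measurable P"
      by (intro L2_measurable J_L2 n m L2_indicator finite_M A B)+
    have "AE \<omega> in P. J n (indicator A) \<omega> = \<nu> n A \<omega>" "AE \<omega> in P. J m (indicator B) \<omega> = \<nu> m B \<omega>"
      using J_extension[OF n] J_extension[OF m] A B by (simp_all add: wn_extension_def)
    then have "AE \<omega> in P. J n (indicator A) \<omega> * J m (indicator B) \<omega> = \<nu> n A \<omega> * \<nu> m B \<omega>"
      by eventually_elim simp
    then have "(\<integral>\<omega>. J n (indicator A) \<omega> * J m (indicator B) \<omega> \<partial>P) = (\<integral>\<omega>. \<nu> n A \<omega> * \<nu> m B \<omega> \<partial>P)"
      by (intro integral_cong_AE) auto
    then show ?thesis using hilbert_white_noise_uncorrelated[OF noise n m False A B] by simp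
  qed
  then show ?thesis
    using wn_extension_uncorrelated[OF finite_M finite_M J_extension[OF n] J_extension[OF m] _ f g] False
    by simp
qed

definition coordinate :: "('w \<Rightarrow> 'h) \<Rightarrow> 'w set \<Rightarrow> nat \<Rightarrow> 'w \<Rightarrow> real" where
  "coordinate \<psi> A n w = indicator A w * (\<psi> w \<bullet> e n)"

definition partial_noise :: "('w \<Rightarrow> 'h) \<Rightarrow> 'w set \<Rightarrow> nat \<Rightarrow> 'o \<Rightarrow> real" where
  "partial_noise \<psi> A k \<omega> = (\<Sum>n\<in>N \<inter> {..<k}. J n (coordinate \<psi> A n) \<omega>)"

lemma coordinate_L2:
  assumes \<psi>: "square_integrable M \<psi>" and A: "A \<in> sets M" and n: "n \<in> N"
  shows "coordinate \<psi> A n \<in> L2 M"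
  unfolding L2_iff_square_integrable
proof (rule square_integrable_bound)
  show "square_integrable M (\<lambda>w. norm (\<psi> w))"
    using \<psi> square_integrable_measurable[OF \<psi>]
    by (auto simp: square_integrable_def intro: borel_measurable_norm)
  show "coordinate \<psi> A n \<in> borel_measurable M"
    unfolding coordinate_def using \<psi> A by measurable
  have "norm (e n) = 1" using orthonormal n by (simp add: complete_orthonormal_def norm_eq_1)
  then have "norm (coordinate \<psi> A n w) \<le> norm (norm (\<psi> w))" for w
    using Cauchy_Schwarz_ineq2[of "\<psi> w" "e n"] by (simp add: coordinate_def split: split_indicator)
  then show "AE w in M. norm (coordinate \<psi> A n w) \<le> norm (norm (\<psi> w))" by simp
qed

lemma partial_noise_L2:
  assumes "square_integrable M \<psi>" "A \<in> sets M"
  shows "partial_noise \<psi> A k \<in> L2 P"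
  unfolding partial_noise_def by (intro L2_sum J_L2 coordinate_L2 assms) auto

text \<open>
  The components are orthogonal, so only the diagonal terms of the double sum survive; they add up
  to an inner product with a partial expansion. Both the convergence of the series and the
  covariance of its sum are read off from this formula.
\<close>

lemma partial_noise_covariance:
  assumes \<psi>: "square_integrable M \<psi>" and A: "A \<in> sets M"
    and \<phi>: "square_integrable M \<phi>" and B: "B \<in> sets M"
  shows "(\<integral>\<omega>. partial_noise \<psi> A k \<omega> * partial_noise \<phi> B l \<omega> \<partial>P) =
    (\<integral>w. indicator (A \<inter> B) w * (partial_expansion N e (min k l) (\<psi> w) \<bullet> \<phi> w) \<partial>M)"
proof -
  have L: "J n (coordinate \<psi> A n) \<in> L2 P" "J n (coordinate \<phi> B n) \<in> L2 P" if "n \<in> N" for n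
    by (intro J_L2 coordinate_L2 that \<psi> \<phi> A B)+
  let ?J = "\<lambda>n m \<omega>. J n (coordinate \<psi> A n) \<omega> * J m (coordinate \<phi> B m) \<omega>"
  have int: "integrable P (?J n m)" if "n \<in> N \<inter> {..<k}" "m \<in> N \<inter> {..<l}" for n m
    using that by (intro L2_integrable_mult L) auto
  have "(\<integral>\<omega>. partial_noise \<psi> A k \<omega> * partial_noise \<phi> B l \<omega> \<partial>P) =
    (\<integral>\<omega>. (\<Sum>n\<in>N \<inter> {..<k}. \<Sum>m\<in>N \<inter> {..<l}. ?J n m \<omega>) \<partial>P)"
    unfolding partial_noise_def sum_product ..
  also have "\<dots> = (\<Sum>n\<in>N \<inter> {..<k}. \<integral>\<omega>. (\<Sum>m\<in>N \<inter> {..<l}. ?J n m \<omega>) \<partial>P)"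
    by (rule Bochner_Integration.integral_sum) (rule Bochner_Integration.integrable_sum, rule int)
  also have "\<dots> = (\<Sum>n\<in>N \<inter> {..<k}. \<Sum>m\<in>N \<inter> {..<l}. \<integral>\<omega>. ?J n m \<omega> \<partial>P)"
    by (rule sum.cong[OF refl]) (rule Bochner_Integration.integral_sum, rule int)
  also have "\<dots> = (\<Sum>n\<in>N \<inter> {..<k}. \<Sum>m\<in>N \<inter> {..<l}.
      if n = m then \<integral>w. coordinate \<psi> A n w * coordinate \<phi> B n w \<partial>M else 0)"
    by (rule sum.cong[OF refl], rule sum.cong[OF refl])
       (simp add: J_covariance coordinate_L2 \<psi> \<phi> A B)
  also have "\<dots> = (\<Sum>n\<in>N \<inter> {..<k}. if n < l then \<integral>w. coordinate \<psi> A n w * coordinate \<phi> B n w \<partial>M else 0)"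
    by (rule sum.cong[OF refl]) auto
  also have "\<dots> = (\<Sum>n\<in>N \<inter> {..<min k l}. \<integral>w. coordinate \<psi> A n w * coordinate \<phi> B n w \<partial>M)"
    by (rule sum.mono_neutral_cong_right) auto
  also have "\<dots> = (\<integral>w. (\<Sum>n\<in>N \<inter> {..<min k l}. coordinate \<psi> A n w * coordinate \<phi> B n w) \<partial>M)"
    by (intro Bochner_Integration.integral_sum[symmetric] L2_integrable_mult coordinate_L2 \<psi> \<phi> A B) auto
  also have "\<dots> = (\<integral>w. indicator (A \<inter> B) w * (partial_expansion N e (min k l) (\<psi> w) \<bullet> \<phi> w) \<partial>M)"
    by (intro Bochner_Integration.integral_cong refl)
       (auto simp: coordinate_def partial_expansion_inner split: split_indicator)
  finally show ?thesis .
qed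

lemma partial_expansion_integral_tendsto:
  assumes \<psi>: "square_integrable M \<psi>" and \<phi>: "square_integrable M \<phi>" and C: "C \<in> sets M"
  shows "(\<lambda>k. \<integral>w. indicator C w * (partial_expansion N e k (\<psi> w) \<bullet> \<phi> w) \<partial>M)
    \<longlonglongrightarrow> (\<integral>w. indicator C w * (\<psi> w \<bullet> \<phi> w) \<partial>M)"
proof (rule integral_dominated_convergence[where w = "\<lambda>w. norm (\<psi> w) * norm (\<phi> w)"])
  have [measurable]: "\<psi> \<in> borel_measurable M" "\<phi> \<in> borel_measurable M" "C \<in> sets M"
    using \<psi> \<phi> C by (auto intro: square_integrable_measurable)
  show "(\<lambda>w. indicator C w * (\<psi> w \<bullet> \<phi> w)) \<in> borel_measurable M" by measurable
  show "(\<lambda>w. indicator C w * (partial_expansion N e k (\<psi> w) \<bullet> \<phi> w)) \<in> borel_measurable M" for k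
    unfolding partial_expansion_inner by measurable
  show "integrable M (\<lambda>w. norm (\<psi> w) * norm (\<phi> w))"
    using \<psi> \<phi> by (intro L2_integrable_mult) (auto simp: L2_def square_integrable_def)
  show "AE w in M. (\<lambda>k. indicator C w * (partial_expansion N e k (\<psi> w) \<bullet> \<phi> w))
      \<longlonglongrightarrow> indicator C w * (\<psi> w \<bullet> \<phi> w)"
    by (intro AE_I2 tendsto_intros partial_expansion_tendsto[OF orthonormal])
  show "AE w in M. norm (indicator C w * (partial_expansion N e k (\<psi> w) \<bullet> \<phi> w)) \<le> norm (\<psi> w) * norm (\<phi> w)" for k
  proof (intro AE_I2)
    fix w
    have "\<bar>partial_expansion N e k (\<psi> w) \<bullet> \<phi> w\<bar> \<le> norm (partial_expansion N e k (\<psi> w)) * norm (\<phi> w)"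
      by (rule Cauchy_Schwarz_ineq2)
    also have "\<dots> \<le> norm (\<psi> w) * norm (\<phi> w)"
      by (intro mult_right_mono norm_partial_expansion_le[OF orthonormal]) simp
    finally show "norm (indicator C w * (partial_expansion N e k (\<psi> w) \<bullet> \<phi> w)) \<le> norm (\<psi> w) * norm (\<phi> w)"
      by (auto split: split_indicator)
  qed
qed

lemma partial_noise_tendsto:
  assumes \<psi>: "square_integrable M \<psi>" and A: "A \<in> sets M"
  shows "L2_tendsto P (partial_noise \<psi> A) (I \<psi> A)"
proof -
  have "\<exists>Y. L2_tendsto P (partial_noise \<psi> A) Y"
  proof (rule P.L2_complete)
    let ?c = "\<lambda>k. \<integral>w. indicator A w * (partial_expansion N e k (\<psi> w) \<bullet> \<psi> w) \<partial>M"
    fix \<epsilon> :: real assume "\<epsilon> > 0"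
    have "Cauchy ?c"
      by (rule LIMSEQ_imp_Cauchy[OF partial_expansion_integral_tendsto[OF \<psi> \<psi> A]])
    from CauchyD[OF this, of "\<epsilon> / 2"] \<open>\<epsilon> > 0\<close>
    obtain n0 where n0: "\<forall>k\<ge>n0. \<forall>l\<ge>n0. norm (?c k - ?c l) < \<epsilon> / 2" by auto
    have "(\<integral>\<omega>. (partial_noise \<psi> A k \<omega> - partial_noise \<psi> A l \<omega>)\<^sup>2 \<partial>P) < \<epsilon>"
      if "k \<ge> n0" "l \<ge> n0" for k l
    proof -
      have "(\<integral>\<omega>. (partial_noise \<psi> A k \<omega> - partial_noise \<psi> A l \<omega>)\<^sup>2 \<partial>P) = ?c k - 2 * ?c (min k l) + ?c l"
        using L2_diff_squared[OF partial_noise_L2[OF \<psi> A] partial_noise_L2[OF \<psi> A], of k l]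
          partial_noise_covariance[OF \<psi> A \<psi> A]
        by (simp add: power2_eq_square)
      also have "\<dots> < \<epsilon>"
      proof -
        have "norm (?c k - ?c (min k l)) < \<epsilon> / 2" "norm (?c l - ?c (min k l)) < \<epsilon> / 2"
          using n0 that by (simp_all only: min.bounded_iff)
        then show ?thesis unfolding real_norm_def by linarith
      qed
      finally show ?thesis .
    qed
    then show "\<exists>n0. \<forall>k\<ge>n0. \<forall>l\<ge>n0. (\<integral>\<omega>. (partial_noise \<psi> A k \<omega> - partial_noise \<psi> A l \<omega>)\<^sup>2 \<partial>P) < \<epsilon>"
      by blast
  qed (rule partial_noise_L2[OF \<psi> A])
  then have "L2_tendsto P (partial_noise \<psi> A) (L2_lim P (partial_noise \<psi> A))"
    using L2_tendsto_L2_lim by blast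
  then show ?thesis
    by (simp add: wn_inner_def partial_noise_def[abs_def] coordinate_def[abs_def])
qed

lemma wn_inner_L2: "square_integrable M \<psi> \<Longrightarrow> A \<in> sets M \<Longrightarrow> I \<psi> A \<in> L2 P"
  using partial_noise_tendsto[of \<psi> A] by (simp add: L2_tendsto_def)

text \<open>
  The map that takes the vector field \<open>1\<^sub>A \<psi>\<close> to the random variable \<open>I \<psi> A\<close> is an isometry. All
  the facts on the noise that are needed in the sequel are consequences: the noise determines the
  vector field, and it depends on it linearly and continuously.
\<close>

lemma wn_inner_covariance:
  assumes \<psi>: "square_integrable M \<psi>" and A: "A \<in> sets M"
    and \<phi>: "square_integrable M \<phi>" and B: "B \<in> sets M"
  shows "(\<integral>\<omega>. I \<psi> A \<omega> * I \<phi> B \<omega> \<partial>P) = (\<integral>w. (indicator A w *\<^sub>R \<psi> w) \<bullet> (indicator B w *\<^sub>R \<phi> w) \<partial>M)"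
proof -
  have "(\<lambda>k. \<integral>\<omega>. partial_noise \<psi> A k \<omega> * partial_noise \<phi> B k \<omega> \<partial>P) \<longlonglongrightarrow> (\<integral>\<omega>. I \<psi> A \<omega> * I \<phi> B \<omega> \<partial>P)"
    by (intro L2_tendsto_inner partial_noise_tendsto \<psi> \<phi> A B)
  then have "(\<lambda>k. \<integral>w. indicator (A \<inter> B) w * (partial_expansion N e k (\<psi> w) \<bullet> \<phi> w) \<partial>M)
      \<longlonglongrightarrow> (\<integral>\<omega>. I \<psi> A \<omega> * I \<phi> B \<omega> \<partial>P)"
    by (simp add: partial_noise_covariance \<psi> \<phi> A B)
  then have "(\<integral>\<omega>. I \<psi> A \<omega> * I \<phi> B \<omega> \<partial>P) = (\<integral>w. indicator (A \<inter> B) w * (\<psi> w \<bullet> \<phi> w) \<partial>M)"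
    using partial_expansion_integral_tendsto[OF \<psi> \<phi> sets.Int[OF A B]] by (rule LIMSEQ_unique)
  also have "\<dots> = (\<integral>w. (indicator A w *\<^sub>R \<psi> w) \<bullet> (indicator B w *\<^sub>R \<phi> w) \<partial>M)"
    by (intro Bochner_Integration.integral_cong) (auto split: split_indicator)
  finally show ?thesis .
qed

lemma square_integrable_indicator:
  "square_integrable M \<psi> \<Longrightarrow> A \<in> sets M \<Longrightarrow> square_integrable M (\<lambda>w. indicator A w *\<^sub>R \<psi> w)"
  by (rule square_integrable_bound[of M \<psi>]) (auto split: split_indicator intro!: borel_measurable_scaleR)

lemma wn_inner_norm_diff:
  assumes \<psi>: "square_integrable M \<psi>" and A: "A \<in> sets M"
    and \<phi>: "square_integrable M \<phi>" and B: "B \<in> sets M"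
  shows "(\<integral>\<omega>. (I \<psi> A \<omega> - I \<phi> B \<omega>)\<^sup>2 \<partial>P) =
    (\<integral>w. (norm (indicator A w *\<^sub>R \<psi> w - indicator B w *\<^sub>R \<phi> w))\<^sup>2 \<partial>M)"
proof -
  have "(\<integral>\<omega>. (I \<xi> C \<omega>)\<^sup>2 \<partial>P) = (\<integral>w. (norm (indicator C w *\<^sub>R \<xi> w))\<^sup>2 \<partial>M)"
    if "square_integrable M \<xi>" "C \<in> sets M" for \<xi> C
    using wn_inner_covariance[OF that that] by (simp only: power2_eq_square[of "I _ _ _"] power2_norm_eq_inner)
  then show ?thesis
    by (simp only: L2_diff_squared[OF wn_inner_L2[OF \<psi> A] wn_inner_L2[OF \<phi> B]]
        square_integrable_norm_diff[OF square_integrable_indicator[OF \<psi> A] square_integrable_indicator[OF \<phi> B]]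
        wn_inner_covariance[OF \<psi> A \<phi> B] \<psi> \<phi> A B)
qed

lemma wn_inner_eq_iff:
  assumes \<psi>: "square_integrable M \<psi>" and A: "A \<in> sets M"
    and \<phi>: "square_integrable M \<phi>" and B: "B \<in> sets M"
  shows "(AE \<omega> in P. I \<psi> A \<omega> = I \<phi> B \<omega>) \<longleftrightarrow>
    (AE w in M. indicator A w *\<^sub>R \<psi> w = indicator B w *\<^sub>R \<phi> w)"
proof -
  have "(AE \<omega> in P. I \<psi> A \<omega> = I \<phi> B \<omega>) \<longleftrightarrow> (\<integral>\<omega>. (I \<psi> A \<omega> - I \<phi> B \<omega>)\<^sup>2 \<partial>P) = 0"
    using L2_null_iff[OF L2_diff[OF wn_inner_L2[OF \<psi> A] wn_inner_L2[OF \<phi> B]]] by simp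
  also have "\<dots> \<longleftrightarrow> (AE w in M. indicator A w *\<^sub>R \<psi> w = indicator B w *\<^sub>R \<phi> w)"
    unfolding wn_inner_norm_diff[OF assms]
    using square_integrable_null_iff[OF square_integrable_diff[OF
        square_integrable_indicator[OF \<psi> A] square_integrable_indicator[OF \<phi> B]]] by simp
  finally show ?thesis .
qed

lemma wn_inner_linear:
  assumes \<psi>: "square_integrable M \<psi>" and \<phi>: "square_integrable M \<phi>" and A: "A \<in> sets M"
  shows "AE \<omega> in P. I (\<lambda>w. a *\<^sub>R \<psi> w + b *\<^sub>R \<phi> w) A \<omega> = a * I \<psi> A \<omega> + b * I \<phi> A \<omega>"
proof -
  let ?\<theta> = "\<lambda>w. a *\<^sub>R \<psi> w + b *\<^sub>R \<phi> w"
  have \<theta>: "square_integrable M ?\<theta>"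
    by (intro square_integrable_add square_integrable_scaleR \<psi> \<phi>)
  have lin: "(\<integral>\<omega>. I \<xi> A \<omega> * I ?\<theta> A \<omega> \<partial>P) = a * (\<integral>\<omega>. I \<xi> A \<omega> * I \<psi> A \<omega> \<partial>P) + b * (\<integral>\<omega>. I \<xi> A \<omega> * I \<phi> A \<omega> \<partial>P)"
    if \<xi>: "square_integrable M \<xi>" for \<xi>
  proof -
    let ?i = "\<lambda>\<psi> w. indicator A w *\<^sub>R \<psi> w :: 'h"
    have int: "integrable M (\<lambda>w. ?i \<xi> w \<bullet> ?i \<eta> w)" if "square_integrable M \<eta>" for \<eta>
      by (intro square_integrable_inner square_integrable_indicator \<xi> that A)
    have "?i \<xi> w \<bullet> ?i ?\<theta> w = a * (?i \<xi> w \<bullet> ?i \<psi> w) + b * (?i \<xi> w \<bullet> ?i \<phi> w)" for w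
      by (simp add: inner_add_right algebra_simps)
    then have "(\<integral>w. ?i \<xi> w \<bullet> ?i ?\<theta> w \<partial>M) =
        a * (\<integral>w. ?i \<xi> w \<bullet> ?i \<psi> w \<partial>M) + b * (\<integral>w. ?i \<xi> w \<bullet> ?i \<phi> w \<partial>M)"
      using int[OF \<psi>] int[OF \<phi>]
      by (simp only:) (simp del: inner_scaleR_left inner_scaleR_right)
    then show ?thesis by (simp only: wn_inner_covariance[OF \<xi> A _ A] \<theta> \<psi> \<phi>)
  qed
  show ?thesis
    by (rule L2_AE_linear_combination) (intro wn_inner_L2 \<psi> \<phi> \<theta> A lin)+
qed

end

section \<open>Conditional expectation given a random vector\<close>

lemma borel_measurable_vec:
  fixes f :: "'a \<Rightarrow> real^'n"
  assumes "\<And>i. (\<lambda>x. f x $ i) \<in> borel_measurable M"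
  shows "f \<in> borel_measurable M"
  using assms by (subst borel_measurable_euclidean_space) (auto simp: Basis_vec_def inner_axis)

lemma borel_measurable_vec_nth:
  fixes f :: "'a \<Rightarrow> real^'n"
  shows "f \<in> borel_measurable M \<Longrightarrow> (\<lambda>x. f x $ i) \<in> borel_measurable M"
  by (rule measurable_compose[OF _ borel_measurable_nth])

text \<open>
  The Doob-Dynkin lemma, by induction on the construction of measurable functions.
\<close>

lemma vimage_algebra_factorization_ennreal:
  fixes f :: "'a \<Rightarrow> ennreal"
  assumes X: "X \<in> S \<rightarrow> space N" and f: "f \<in> borel_measurable (vimage_algebra S X N)"
  shows "\<exists>g\<in>borel_measurable N. \<forall>x\<in>S. f x = g (X x)"
  using f
proof (induction rule: borel_measurable_induct)
  case (cong f g)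
  then show ?case by auto
next
  case (set A)
  then have "A \<in> {X -` B \<inter> S |B. B \<in> sets N}"
    unfolding sets_vimage_algebra2[OF X] .
  then obtain B where B: "B \<in> sets N" "A = X -` B \<inter> S" by blast
  have "\<forall>x\<in>S. indicator A x = (indicator B (X x) :: ennreal)"
    unfolding B(2) by (simp add: indicator_def)
  with borel_measurable_indicator[OF B(1)] show ?case by (intro bexI[of _ "indicator B"])
next
  case (mult u c)
  then obtain g where g: "g \<in> borel_measurable N" "\<forall>x\<in>S. u x = g (X x)" by blast
  have "(\<lambda>y. c * g y) \<in> borel_measurable N" using g(1) by measurable
  with g(2) show ?case by (intro bexI[of _ "\<lambda>y. c * g y"]) simp_all
next
  case (add u v)
  then obtain g h where g: "g \<in> borel_measurable N" "\<forall>x\<in>S. u x = g (X x)"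
    and h: "h \<in> borel_measurable N" "\<forall>x\<in>S. v x = h (X x)" by blast
  have "(\<lambda>y. h y + g y) \<in> borel_measurable N" using g(1) h(1) by measurable
  with g(2) h(2) show ?case by (intro bexI[of _ "\<lambda>y. h y + g y"]) simp_all
next
  case (seq U)
  from seq.IH have "\<forall>i. \<exists>g. g \<in> borel_measurable N \<and> (\<forall>x\<in>S. U i x = g (X x))" by blast
  then obtain g where g: "\<And>i. g i \<in> borel_measurable N" "\<And>i x. x \<in> S \<Longrightarrow> U i x = g i (X x)" by metis
  have "(\<lambda>y. SUP i. g i y) \<in> borel_measurable N" using g(1) by measurable
  moreover have "\<forall>x\<in>S. (SUP i. U i) x = (SUP i. g i (X x))" by (simp add: g(2) image_comp)
  ultimately show ?case by (intro bexI[of _ "\<lambda>y. SUP i. g i y"])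
qed

lemma vimage_algebra_factorization:
  fixes f :: "'a \<Rightarrow> real"
  assumes X: "X \<in> S \<rightarrow> space N" and f: "f \<in> borel_measurable (vimage_algebra S X N)"
  shows "\<exists>g\<in>borel_measurable N. \<forall>x\<in>S. f x = g (X x)"
proof -
  note [measurable] = f
  obtain g where [measurable]: "g \<in> borel_measurable N" and g: "\<And>x. x \<in> S \<Longrightarrow> ennreal (f x) = g (X x)"
    using vimage_algebra_factorization_ennreal[OF X, of "\<lambda>x. ennreal (f x)"] by auto
  obtain h where [measurable]: "h \<in> borel_measurable N" and h: "\<And>x. x \<in> S \<Longrightarrow> ennreal (- f x) = h (X x)"
    using vimage_algebra_factorization_ennreal[OF X, of "\<lambda>x. ennreal (- f x)"] by auto
  have "f x = enn2real (g (X x)) - enn2real (h (X x))" if "x \<in> S" for x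
    unfolding g[OF that, symmetric] h[OF that, symmetric]
    by (cases "f x \<ge> 0") (auto simp: ennreal_neg)
  then show ?thesis by (intro bexI[of _ "\<lambda>y. enn2real (g y) - enn2real (h y)"]) auto
qed

lemma integrable_bounded_mult:
  fixes f h :: "'a \<Rightarrow> real"
  assumes f: "integrable M f" and h: "h \<in> borel_measurable M" and bound: "\<And>x. \<bar>h x\<bar> \<le> c"
  shows "integrable M (\<lambda>x. h x * f x)"
proof (rule Bochner_Integration.integrable_bound)
  show "integrable M (\<lambda>x. c * f x)" using f by simp
  show "(\<lambda>x. h x * f x) \<in> borel_measurable M" using f h by measurable
  show "AE x in M. norm (h x * f x) \<le> norm (c * f x)"
    using bound by (intro AE_I2) (auto simp: abs_mult intro!: mult_right_mono intro: order_trans[OF _ abs_ge_self])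
qed

lemma (in prob_space) cond_exp_at_factors:
  fixes X :: "'a \<Rightarrow> real^'d"
  assumes X: "X \<in> borel_measurable M"
  shows "cond_exp_at M X f \<in> borel_measurable borel"
    and "AE w in M. cond_exp_at M X f (X w) = real_cond_exp M (vimage_algebra (space M) X borel) f w"
proof -
  let ?F = "vimage_algebra (space M) X borel"
  have "\<exists>g\<in>borel_measurable borel. \<forall>w\<in>space M. real_cond_exp M ?F f w = g (X w)"
    by (rule vimage_algebra_factorization) auto
  then have "\<exists>g. g \<in> borel_measurable borel \<and> (AE w in M. g (X w) = real_cond_exp M ?F f w)"
    by auto
  from someI_ex[OF this] show "cond_exp_at M X f \<in> borel_measurable borel"
    and "AE w in M. cond_exp_at M X f (X w) = real_cond_exp M ?F f w"
    unfolding cond_exp_at_def by blast+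
qed

text \<open>
  Conditional expectations given \<open>X\<close> enter integrals through this identity; bounded functions \<open>h\<close>
  suffice, because fields are truncated before their forms are integrated.
\<close>

lemma (in prob_space) integral_cond_exp_at:
  fixes X :: "'a \<Rightarrow> real^'d"
  assumes X: "X \<in> borel_measurable M" and f: "integrable M f"
    and h: "h \<in> borel_measurable borel" and bound: "\<And>x. \<bar>h x\<bar> \<le> c"
  shows "integrable M (\<lambda>w. h (X w) * cond_exp_at M X f (X w))"
    and "(\<integral>w. h (X w) * cond_exp_at M X f (X w) \<partial>M) = (\<integral>w. h (X w) * f w \<partial>M)"
proof -
  let ?F = "vimage_algebra (space M) X borel"
  have "subalgebra M ?F"
    using X by (auto simp: subalgebra_def sets_vimage_algebra2 intro: measurable_sets)
  then interpret finite_measure_subalgebra M ?F by unfold_locales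
  have [measurable]: "X \<in> borel_measurable M" "h \<in> borel_measurable borel" "f \<in> borel_measurable M"
    "cond_exp_at M X f \<in> borel_measurable borel"
    using X f h cond_exp_at_factors(1)[OF X] by auto
  have XF: "(\<lambda>w. h (X w)) \<in> borel_measurable ?F"
    by (rule measurable_compose[OF measurable_vimage_algebra1 h]) auto
  have int: "integrable M (\<lambda>w. h (X w) * f w)"
    by (rule integrable_bounded_mult[OF f _ bound]) measurable
  note ce = real_cond_exp_intg[OF int XF borel_measurable_integrable[OF f]]
  have ae: "AE w in M. h (X w) * real_cond_exp M ?F f w = h (X w) * cond_exp_at M X f (X w)"
    using cond_exp_at_factors(2)[OF X, of f] by eventually_elim simp
  show "integrable M (\<lambda>w. h (X w) * cond_exp_at M X f (X w))"
    by (rule integrable_cong_AE_imp[OF ce(1)]) (use ae in auto)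
  have "(\<integral>w. h (X w) * cond_exp_at M X f (X w) \<partial>M) = (\<integral>w. h (X w) * real_cond_exp M ?F f w \<partial>M)"
    by (rule integral_cong_AE) (use ae ce(1) in auto)
  then show "(\<integral>w. h (X w) * cond_exp_at M X f (X w) \<partial>M) = (\<integral>w. h (X w) * f w \<partial>M)"
    using ce(2) by simp
qed

section \<open>The matrix $\Gamma_X[I]$ as a conditional Gram matrix\<close>

locale gradient_structure = error_structure M \<D> \<Gamma>
  for M :: "'w measure" and \<D> :: "('w \<Rightarrow> real) set"
    and \<Gamma> :: "('w \<Rightarrow> real) \<Rightarrow> ('w \<Rightarrow> real) \<Rightarrow> 'w \<Rightarrow> real" +
  fixes Dg :: "('w \<Rightarrow> real) \<Rightarrow> 'w \<Rightarrow> 'h::{real_inner, banach, second_countable_topology}"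
  assumes gradient: "D_gradient M \<D> \<Gamma> Dg"
begin

lemma gradient_square_integrable: "u \<in> \<D> \<Longrightarrow> square_integrable M (Dg u)"
  using gradient by (simp add: D_gradient_def square_integrable_def)

lemma gradient_norm: "u \<in> \<D> \<Longrightarrow> AE w in M. (norm (Dg u w))\<^sup>2 = \<Gamma> u u w"
  using gradient by (simp add: D_gradient_def)

lemma domain_linear: "u \<in> \<D> \<Longrightarrow> v \<in> \<D> \<Longrightarrow> (\<lambda>w. a * u w + b * v w) \<in> \<D>"
  by (intro domain_add domain_scale)

lemma gradient_linear:
  assumes u: "u \<in> \<D>" and v: "v \<in> \<D>"
  shows "AE w in M. Dg (\<lambda>w. a * u w + b * v w) w = a *\<^sub>R Dg u w + b *\<^sub>R Dg v w"
proof -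
  have "AE w in M. Dg (\<lambda>w. a * u w + b * v w) w = Dg (\<lambda>w. a * u w) w + Dg (\<lambda>w. b * v w) w"
    using gradient domain_scale[OF u, of a] domain_scale[OF v, of b] by (simp add: D_gradient_def)
  moreover have "AE w in M. Dg (\<lambda>w. a * u w) w = a *\<^sub>R Dg u w" "AE w in M. Dg (\<lambda>w. b * v w) w = b *\<^sub>R Dg v w"
    using gradient u v by (simp_all add: D_gradient_def)
  ultimately show ?thesis by eventually_elim simp
qed

lemma Gamma_linear_diagonal:
  assumes u: "u \<in> \<D>" and v: "v \<in> \<D>"
  shows "AE w in M. \<Gamma> (\<lambda>w. a * u w + b * v w) (\<lambda>w. a * u w + b * v w) w = (norm (a *\<^sub>R Dg u w + b *\<^sub>R Dg v w))\<^sup>2"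
  using gradient_linear[OF u v, of a b] gradient_norm[OF domain_linear[OF u v, of a b]]
  by eventually_elim simp

definition admissible :: "('w \<Rightarrow> real^'d) \<Rightarrow> bool" where
  "admissible X \<longleftrightarrow> (\<forall>i. (\<lambda>w. X w $ i) \<in> \<D>)"

text \<open>
  For \<open>\<phi> = grad u\<close> this is the right-hand side of the chain rule for \<open>u \<circ> X\<close>. The map \<open>\<phi> \<mapsto> pullback X \<phi>\<close>
  carries \<open>L2_Gamma M \<Gamma> X\<close> isometrically into $L^2(m, H)$, and replaces computations
  with the matrix $\Gamma_X[I]$ by computations with vector fields.
\<close>

definition pullback :: "('w \<Rightarrow> real^'d) \<Rightarrow> (real^'d \<Rightarrow> real^'d) \<Rightarrow> 'w \<Rightarrow> 'h" where
  "pullback X \<phi> w = (\<Sum>i\<in>UNIV. (\<phi> (X w) $ i) *\<^sub>R Dg (\<lambda>w. X w $ i) w)"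

lemma admissible_gradient_measurable:
  "admissible X \<Longrightarrow> Dg (\<lambda>w. X w $ i) \<in> borel_measurable M"
  using gradient_square_integrable by (auto simp: admissible_def intro: square_integrable_measurable)

lemma admissible_measurable:
  fixes X :: "'w \<Rightarrow> real^'d"
  assumes "admissible X"
  shows "X \<in> borel_measurable M"
  by (rule borel_measurable_vec) (use assms domain_L2 in \<open>auto simp: admissible_def intro: L2_measurable\<close>)

lemma pullback_measurable:
  fixes X :: "'w \<Rightarrow> real^'d"
  assumes X: "admissible X" and \<phi>: "\<phi> \<in> borel_measurable borel"
  shows "pullback X \<phi> \<in> borel_measurable M"
proof -
  have "(\<lambda>w. \<phi> (X w) $ i) \<in> borel_measurable M" for i
    by (rule borel_measurable_vec_nth[OF measurable_compose[OF admissible_measurable[OF X] \<phi>]])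
  then show ?thesis
    unfolding pullback_def
    by (intro borel_measurable_sum borel_measurable_scaleR admissible_gradient_measurable[OF X])
qed

lemma pullback_linear:
  "pullback X (\<lambda>x. a *\<^sub>R \<phi> x + b *\<^sub>R \<psi> x) w = a *\<^sub>R pullback X \<phi> w + b *\<^sub>R pullback X \<psi> w"
  by (simp add: pullback_def scaleR_left_distrib sum.distrib scaleR_sum_right)

lemma pullback_diff: "pullback X (\<lambda>x. \<phi> x - \<psi> x) w = pullback X \<phi> w - pullback X \<psi> w"
  using pullback_linear[of X 1 \<phi> "-1" \<psi> w] by simp

lemma pullback_indicator:
  "pullback X (\<lambda>x. indicator A x *\<^sub>R \<phi> x) w = indicator A (X w) *\<^sub>R pullback X \<phi> w"
  by (simp add: pullback_def scaleR_sum_right)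

lemma norm_pullback:
  "(norm (pullback X \<phi> w))\<^sup>2 = (\<Sum>i\<in>UNIV. \<Sum>j\<in>UNIV.
    (\<phi> (X w) $ i * \<phi> (X w) $ j) * (Dg (\<lambda>w. X w $ i) w \<bullet> Dg (\<lambda>w. X w $ j) w))"
  unfolding power2_norm_eq_inner pullback_def inner_sum_left inner_sum_right
  by (intro sum.cong refl) (simp add: inner_commute)

lemma Gamma_matrix_measurable:
  fixes X :: "'w \<Rightarrow> real^'d"
  assumes X: "admissible X"
  shows "(\<lambda>x. Gamma_matrix M \<Gamma> X x $ i $ j) \<in> borel_measurable borel"
  unfolding Gamma_matrix_def image_Gamma_def image_Gamma1_def
  by (simp add: cond_exp_at_factors(1)[OF admissible_measurable[OF X]] borel_measurable_diff borel_measurable_divide)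

text \<open>
  Polarization shows that the entries of $\Gamma_X[I]$ are the conditional expectations given \<open>X\<close> of the
  inner products of the gradients of the coordinates of \<open>X\<close>.
\<close>

lemma Gamma_matrix_integral:
  fixes X :: "'w \<Rightarrow> real^'d"
  assumes X: "admissible X" and h: "h \<in> borel_measurable borel" and bound: "\<And>x. \<bar>h x\<bar> \<le> c"
  shows "integrable M (\<lambda>w. h (X w) * Gamma_matrix M \<Gamma> X (X w) $ i $ j)"
    and "integrable M (\<lambda>w. h (X w) * (Dg (\<lambda>w. X w $ i) w \<bullet> Dg (\<lambda>w. X w $ j) w))"
    and "(\<integral>w. h (X w) * Gamma_matrix M \<Gamma> X (X w) $ i $ j \<partial>M) =
      (\<integral>w. h (X w) * (Dg (\<lambda>w. X w $ i) w \<bullet> Dg (\<lambda>w. X w $ j) w) \<partial>M)"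
proof -
  note Xm = admissible_measurable[OF X]
  let ?u = "\<lambda>w. X w $ i" and ?v = "\<lambda>w. X w $ j"
  have u: "?u \<in> \<D>" and v: "?v \<in> \<D>" using X by (simp_all add: admissible_def)
  let ?p = "\<Gamma> (\<lambda>w. ?u w + ?v w) (\<lambda>w. ?u w + ?v w)" and ?m = "\<Gamma> (\<lambda>w. ?u w - ?v w) (\<lambda>w. ?u w - ?v w)"
  have "(\<lambda>w. ?u w + ?v w) \<in> \<D>" "(\<lambda>w. ?u w - ?v w) \<in> \<D>"
    using domain_linear[OF u v, of 1 1] domain_linear[OF u v, of 1 "-1"] by simp_all
  then have int: "integrable M ?p" "integrable M ?m" by (auto intro: Gamma_integrable)
  have polar: "AE w in M. (?p w - ?m w) / 4 = Dg ?u w \<bullet> Dg ?v w"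
    using Gamma_linear_diagonal[OF u v, of 1 1] Gamma_linear_diagonal[OF u v, of 1 "-1"]
    by eventually_elim (simp add: power2_norm_eq_inner inner_simps inner_commute)
  have G: "h (X w) * Gamma_matrix M \<Gamma> X (X w) $ i $ j =
      (h (X w) * cond_exp_at M X ?p (X w) - h (X w) * cond_exp_at M X ?m (X w)) / 4" for w
    by (simp add: Gamma_matrix_def image_Gamma_def image_Gamma1_def algebra_simps)
  note p = integral_cond_exp_at[OF Xm int(1) h bound] and m = integral_cond_exp_at[OF Xm int(2) h bound]
  show "integrable M (\<lambda>w. h (X w) * Gamma_matrix M \<Gamma> X (X w) $ i $ j)"
    unfolding G using p(1) m(1) by simp
  have [measurable]: "(\<lambda>w. h (X w)) \<in> borel_measurable M" by (rule measurable_compose[OF Xm h])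
  have bd: "integrable M (\<lambda>w. h (X w) * f w)" if f: "integrable M f" for f
    by (rule integrable_bounded_mult[OF f _ bound]) measurable
  have inn: "integrable M (\<lambda>w. Dg ?u w \<bullet> Dg ?v w)"
    by (intro square_integrable_inner gradient_square_integrable u v)
  show int_h: "integrable M (\<lambda>w. h (X w) * (Dg ?u w \<bullet> Dg ?v w))" by (rule bd[OF inn])
  have "(\<integral>w. h (X w) * Gamma_matrix M \<Gamma> X (X w) $ i $ j \<partial>M) =
      (\<integral>w. (h (X w) * ?p w - h (X w) * ?m w) / 4 \<partial>M)"
    unfolding G using p m bd[OF int(1)] bd[OF int(2)] by simp
  also have "\<dots> = (\<integral>w. h (X w) * (Dg ?u w \<bullet> Dg ?v w) \<partial>M)"
  proof (rule integral_cong_AE)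
    show "AE w in M. (h (X w) * ?p w - h (X w) * ?m w) / 4 = h (X w) * (Dg ?u w \<bullet> Dg ?v w)"
      using polar by eventually_elim (simp add: field_simps)
    show "(\<lambda>w. (h (X w) * ?p w - h (X w) * ?m w) / 4) \<in> borel_measurable M"
      using bd[OF int(1)] bd[OF int(2)] by measurable
    show "(\<lambda>w. h (X w) * (Dg ?u w \<bullet> Dg ?v w)) \<in> borel_measurable M"
      using int_h by (rule borel_measurable_integrable)
  qed
  finally show "(\<integral>w. h (X w) * Gamma_matrix M \<Gamma> X (X w) $ i $ j \<partial>M) =
      (\<integral>w. h (X w) * (Dg ?u w \<bullet> Dg ?v w) \<partial>M)" .
qed

lemma Gamma_matrix_symmetric:
  fixes X :: "'w \<Rightarrow> real^'d"
  assumes X: "admissible X"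
  shows "AE w in M. transpose (Gamma_matrix M \<Gamma> X (X w)) = Gamma_matrix M \<Gamma> X (X w)"
proof -
  have "AE w in M. Gamma_matrix M \<Gamma> X (X w) $ i $ j = Gamma_matrix M \<Gamma> X (X w) $ j $ i" for i j
  proof -
    define f where "f x = Gamma_matrix M \<Gamma> X x $ i $ j - Gamma_matrix M \<Gamma> X x $ j $ i" for x
    have [measurable]: "f \<in> borel_measurable borel"
      unfolding f_def by (intro borel_measurable_diff Gamma_matrix_measurable[OF X])
    \<comment> \<open>testing the difference against its own sign\<close>
    have s: "(\<lambda>x. sgn (f x)) \<in> borel_measurable borel" by measurable
    have sb: "\<bar>sgn (f x)\<bar> \<le> 1" for x by (simp add: sgn_if)
    note G = Gamma_matrix_integral[OF X s sb]
    have abs: "\<bar>f (X w)\<bar> = sgn (f (X w)) * Gamma_matrix M \<Gamma> X (X w) $ i $ j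
        - sgn (f (X w)) * Gamma_matrix M \<Gamma> X (X w) $ j $ i" for w
      unfolding abs_sgn by (simp add: f_def algebra_simps)
    have int: "integrable M (\<lambda>w. \<bar>f (X w)\<bar>)" unfolding abs using G(1) by simp
    have "(\<integral>w. \<bar>f (X w)\<bar> \<partial>M) = 0" unfolding abs using G(1,3) by (simp add: inner_commute)
    then have "AE w in M. \<bar>f (X w)\<bar> = 0" using integral_nonneg_eq_0_iff_AE[OF int] by simp
    then show ?thesis by eventually_elim (simp add: f_def)
  qed
  then have "AE w in M. \<forall>i j. Gamma_matrix M \<Gamma> X (X w) $ i $ j = Gamma_matrix M \<Gamma> X (X w) $ j $ i"
    by (simp add: AE_all_countable)
  then show ?thesis by eventually_elim (simp add: transpose_def vec_eq_iff)
qed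

lemma Gamma_form_sum:
  "Gamma_form M \<Gamma> X \<phi> x = (\<Sum>i\<in>UNIV. \<Sum>j\<in>UNIV. (\<phi> x $ i * \<phi> x $ j) * Gamma_matrix M \<Gamma> X x $ i $ j)"
  by (simp add: Gamma_form_def inner_vec_def matrix_vector_mult_def sum_distrib_left mult_ac)

lemma Gamma_form_scaleR: "Gamma_form M \<Gamma> X (\<lambda>x. c x *\<^sub>R \<phi> x) x = (c x)\<^sup>2 * Gamma_form M \<Gamma> X \<phi> x"
  by (simp add: Gamma_form_def matrix_vector_mult_scaleR power2_eq_square)

lemma Gamma_form_measurable:
  fixes X :: "'w \<Rightarrow> real^'d"
  assumes X: "admissible X" and \<phi>: "\<phi> \<in> borel_measurable borel"
  shows "Gamma_form M \<Gamma> X \<phi> \<in> borel_measurable borel"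
  unfolding Gamma_form_sum[abs_def]
  by (intro borel_measurable_sum borel_measurable_times Gamma_matrix_measurable[OF X]
      borel_measurable_vec_nth[OF \<phi>])

lemma Gamma_form_integral_bounded:
  fixes X :: "'w \<Rightarrow> real^'d"
  assumes X: "admissible X" and \<phi>: "\<phi> \<in> borel_measurable borel" and bound: "\<And>x. norm (\<phi> x) \<le> c"
    and B: "B \<in> sets borel"
  shows "integrable M (\<lambda>w. indicator B (X w) * Gamma_form M \<Gamma> X \<phi> (X w))"
    and "integrable M (\<lambda>w. indicator B (X w) * (norm (pullback X \<phi> w))\<^sup>2)"
    and "(\<integral>w. indicator B (X w) * Gamma_form M \<Gamma> X \<phi> (X w) \<partial>M) =
      (\<integral>w. indicator B (X w) * (norm (pullback X \<phi> w))\<^sup>2 \<partial>M)"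
proof -
  let ?h = "\<lambda>i j x. indicator B x * (\<phi> x $ i * \<phi> x $ j)"
  have "(\<lambda>x. \<phi> x $ i) \<in> borel_measurable borel" for i
    by (rule borel_measurable_vec_nth[OF \<phi>])
  then have h: "?h i j \<in> borel_measurable borel" for i j using B by measurable
  have hb: "\<bar>?h i j x\<bar> \<le> c * c" for i j x
  proof -
    have "\<bar>\<phi> x $ i\<bar> \<le> c" for i using component_le_norm_cart[of "\<phi> x" i] bound[of x] by simp
    then have "\<bar>\<phi> x $ i\<bar> * \<bar>\<phi> x $ j\<bar> \<le> c * c" by (intro mult_mono) (auto intro: order_trans[OF abs_ge_zero])
    moreover have "0 \<le> c * c" by simp
    ultimately show ?thesis by (auto simp: abs_mult split: split_indicator)
  qed
  note G = Gamma_matrix_integral[OF X h hb]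
  have form: "indicator B (X w) * Gamma_form M \<Gamma> X \<phi> (X w) =
      (\<Sum>i\<in>UNIV. \<Sum>j\<in>UNIV. ?h i j (X w) * Gamma_matrix M \<Gamma> X (X w) $ i $ j)" for w
    by (simp add: Gamma_form_sum sum_distrib_left mult.assoc)
  have nrm: "indicator B (X w) * (norm (pullback X \<phi> w))\<^sup>2 = (\<Sum>i\<in>UNIV. \<Sum>j\<in>UNIV.
      ?h i j (X w) * (Dg (\<lambda>w. X w $ i) w \<bullet> Dg (\<lambda>w. X w $ j) w))" for w
    by (simp add: norm_pullback sum_distrib_left mult.assoc)
  show "integrable M (\<lambda>w. indicator B (X w) * Gamma_form M \<Gamma> X \<phi> (X w))"
    unfolding form by (intro Bochner_Integration.integrable_sum G(1))
  show "integrable M (\<lambda>w. indicator B (X w) * (norm (pullback X \<phi> w))\<^sup>2)"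
    unfolding nrm by (intro Bochner_Integration.integrable_sum G(2))
  show "(\<integral>w. indicator B (X w) * Gamma_form M \<Gamma> X \<phi> (X w) \<partial>M) =
      (\<integral>w. indicator B (X w) * (norm (pullback X \<phi> w))\<^sup>2 \<partial>M)"
    unfolding form nrm using G by simp
qed

text \<open>
  A field \<open>\<phi>\<close> in \<open>L2_Gamma M \<Gamma> X\<close> need not be bounded, and the separate terms of the quadratic form
  \<open>Gamma_form M \<Gamma> X \<phi>\<close> need not be integrable. Truncation reduces every statement about \<open>\<phi>\<close> to the
  bounded case, where conditional expectations may be taken term by term.
\<close>

definition truncate :: "(real^'d \<Rightarrow> real^'d) \<Rightarrow> nat \<Rightarrow> real^'d \<Rightarrow> real^'d" where
  "truncate \<phi> k x = indicator {x. norm (\<phi> x) \<le> real k} x *\<^sub>R \<phi> x"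

lemma truncate_measurable:
  assumes [measurable]: "\<phi> \<in> borel_measurable borel"
  shows "{x. norm (\<phi> x) \<le> real k} \<in> sets borel" "truncate \<phi> k \<in> borel_measurable borel"
proof -
  show [measurable]: "{x. norm (\<phi> x) \<le> real k} \<in> sets borel" by measurable
  show "truncate \<phi> k \<in> borel_measurable borel"
    unfolding truncate_def[abs_def] by (intro borel_measurable_scaleR borel_measurable_indicator) measurable
qed

lemma norm_truncate_le: "norm (truncate \<phi> k x) \<le> real k"
  by (auto simp: truncate_def split: split_indicator)

lemma Gamma_form_truncate:
  "Gamma_form M \<Gamma> X (truncate \<phi> k) x = indicator {x. norm (\<phi> x) \<le> real k} x * Gamma_form M \<Gamma> X \<phi> x"
  unfolding truncate_def[abs_def] Gamma_form_scaleR by (auto split: split_indicator)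

lemma pullback_truncate:
  "pullback X (truncate \<phi> k) w = indicator {x. norm (\<phi> x) \<le> real k} (X w) *\<^sub>R pullback X \<phi> w"
  unfolding truncate_def[abs_def] pullback_indicator ..

text \<open>
  On the set where the form is negative, its integral is an integral of \<open>(norm (pullback X \<phi> w))\<^sup>2\<close>,
  which is nonnegative; so this set is null.
\<close>

lemma Gamma_form_nonneg:
  fixes X :: "'w \<Rightarrow> real^'d"
  assumes X: "admissible X" and \<phi>: "\<phi> \<in> borel_measurable borel"
  shows "AE w in M. 0 \<le> Gamma_form M \<Gamma> X \<phi> (X w)"
proof -
  have "AE w in M. 0 \<le> Gamma_form M \<Gamma> X (truncate \<phi> k) (X w)" for k
  proof -
    \<comment> \<open>for a bounded field, the negative part of the form is tested against its own support\<close>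
    let ?f = "Gamma_form M \<Gamma> X (truncate \<phi> k)"
    note t = truncate_measurable(2)[OF \<phi>, of k]
    have [measurable]: "?f \<in> borel_measurable borel" by (rule Gamma_form_measurable[OF X t])
    define B where "B = {x. ?f x < 0}"
    have B: "B \<in> sets borel" unfolding B_def by measurable
    note int = Gamma_form_integral_bounded[OF X t norm_truncate_le B]
    have "0 \<le> (\<integral>w. indicator B (X w) * ?f (X w) \<partial>M)" unfolding int(3) by simp
    moreover have nonneg: "0 \<le> - (indicator B x * ?f x)" for x
      by (auto simp: B_def split: split_indicator)
    ultimately have "(\<integral>w. - (indicator B (X w) * ?f (X w)) \<partial>M) = 0"
      using Bochner_Integration.integral_nonneg[of M "\<lambda>w. - (indicator B (X w) * ?f (X w))"] by simp
    then have "AE w in M. - (indicator B (X w) * ?f (X w)) = 0"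
      using integral_nonneg_eq_0_iff_AE[OF Bochner_Integration.integrable_minus[OF int(1)]] nonneg by simp
    then show ?thesis by eventually_elim (auto simp: B_def split: split_indicator_asm)
  qed
  then have "AE w in M. \<forall>k. 0 \<le> Gamma_form M \<Gamma> X (truncate \<phi> k) (X w)"
    by (simp add: AE_all_countable)
  then show ?thesis
  proof eventually_elim
    case (elim w)
    obtain k :: nat where "norm (\<phi> (X w)) \<le> real k" using real_arch_simple by blast
    then show ?case using elim[rule_format, of k] by (simp add: Gamma_form_truncate)
  qed
qed

text \<open>
  For a single vector this is nonnegativity of the form of a constant field; a countable dense set
  of vectors gives an exceptional null set that does not depend on the vector.
\<close>

lemma Gamma_matrix_positive:
  fixes X :: "'w \<Rightarrow> real^'d"
  assumes X: "admissible X"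
  shows "AE w in M. \<forall>v. 0 \<le> v \<bullet> (Gamma_matrix M \<Gamma> X (X w) *v v)"
proof -
  obtain D :: "(real^'d) set" where D: "countable D" "\<And>S. open S \<Longrightarrow> S \<noteq> {} \<Longrightarrow> \<exists>d\<in>D. d \<in> S"
    using countable_dense_setE by blast
  have "AE w in M. \<forall>v\<in>D. 0 \<le> v \<bullet> (Gamma_matrix M \<Gamma> X (X w) *v v)"
    using Gamma_form_nonneg[OF X, of "\<lambda>_. _"] D(1)
    by (simp add: AE_ball_countable Gamma_form_def)
  then show ?thesis
  proof eventually_elim
    case (elim w)
    let ?q = "\<lambda>v. v \<bullet> (Gamma_matrix M \<Gamma> X (X w) *v v)"
    have cont: "continuous_on UNIV ?q"
      by (intro continuous_intros matrix_vector_mult_linear_continuous_on)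
    show ?case
    proof (rule ccontr)
      assume "\<not> (\<forall>v. 0 \<le> ?q v)"
      then have "{v. ?q v < 0} \<noteq> {}" by (auto simp: not_le)
      moreover have "open {v. ?q v < 0}" by (intro open_Collect_less cont continuous_on_const)
      ultimately show False using D(2)[of "{v. ?q v < 0}"] elim by fastforce
    qed
  qed
qed

lemma Gamma_form_nn_integral:
  fixes X :: "'w \<Rightarrow> real^'d"
  assumes X: "admissible X" and \<phi>: "\<phi> \<in> borel_measurable borel"
  shows "(\<integral>\<^sup>+w. ennreal (Gamma_form M \<Gamma> X \<phi> (X w)) \<partial>M) = (\<integral>\<^sup>+w. ennreal ((norm (pullback X \<phi> w))\<^sup>2) \<partial>M)"
proof -
  note Xm = admissible_measurable[OF X]
  have sup: "(\<integral>\<^sup>+w. f w \<partial>M) = (SUP k. \<integral>\<^sup>+w. indicator {x. norm (\<phi> x) \<le> real k} (X w) * f w \<partial>M)"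
    if [measurable]: "f \<in> borel_measurable M" for f :: "'w \<Rightarrow> ennreal"
  proof -
    have "(SUP k. indicator {x. norm (\<phi> x) \<le> real k} (X w) * f w) = f w" for w
    proof (rule antisym)
      show "(SUP k. indicator {x. norm (\<phi> x) \<le> real k} (X w) * f w) \<le> f w"
        by (rule SUP_least) (auto split: split_indicator)
      obtain k :: nat where "norm (\<phi> (X w)) \<le> real k" using real_arch_simple by blast
      then show "f w \<le> (SUP k. indicator {x. norm (\<phi> x) \<le> real k} (X w) * f w)"
        by (intro SUP_upper2[of k]) auto
    qed
    then have "(\<integral>\<^sup>+w. f w \<partial>M) = (\<integral>\<^sup>+w. (SUP k. indicator {x. norm (\<phi> x) \<le> real k} (X w) * f w) \<partial>M)"
      by simp
    also have "\<dots> = (SUP k. \<integral>\<^sup>+w. indicator {x. norm (\<phi> x) \<le> real k} (X w) * f w \<partial>M)"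
    proof (rule nn_integral_monotone_convergence_SUP)
      show "incseq (\<lambda>k w. indicator {x. norm (\<phi> x) \<le> real k} (X w) * f w)"
        by (auto simp: incseq_def le_fun_def split: split_indicator)
      have "(\<lambda>w. indicator {x. norm (\<phi> x) \<le> real k} (X w) :: ennreal) \<in> borel_measurable M" for k
        by (rule measurable_compose[OF Xm borel_measurable_indicator[OF truncate_measurable(1)[OF \<phi>]]])
      then show "(\<lambda>w. indicator {x. norm (\<phi> x) \<le> real k} (X w) * f w) \<in> borel_measurable M" for k
        by measurable
    qed
    finally show ?thesis .
  qed
  have eq: "(\<integral>\<^sup>+w. indicator {x. norm (\<phi> x) \<le> real k} (X w) * ennreal (Gamma_form M \<Gamma> X \<phi> (X w)) \<partial>M) =
      (\<integral>\<^sup>+w. indicator {x. norm (\<phi> x) \<le> real k} (X w) * ennreal ((norm (pullback X \<phi> w))\<^sup>2) \<partial>M)" for k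
  proof -
    let ?B = "{x. norm (\<phi> x) \<le> real k}"
    note t = truncate_measurable(2)[OF \<phi>, of k]
    note int = Gamma_form_integral_bounded[OF X t norm_truncate_le, of UNIV, simplified]
    have "(\<integral>\<^sup>+w. indicator ?B (X w) * ennreal (Gamma_form M \<Gamma> X \<phi> (X w)) \<partial>M) =
        (\<integral>\<^sup>+w. ennreal (Gamma_form M \<Gamma> X (truncate \<phi> k) (X w)) \<partial>M)"
      by (intro nn_integral_cong) (auto simp: Gamma_form_truncate split: split_indicator)
    also have "\<dots> = ennreal (\<integral>w. Gamma_form M \<Gamma> X (truncate \<phi> k) (X w) \<partial>M)"
      by (rule nn_integral_eq_integral[OF int(1) Gamma_form_nonneg[OF X t]])
    also have "\<dots> = ennreal (\<integral>w. (norm (pullback X (truncate \<phi> k) w))\<^sup>2 \<partial>M)"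
      unfolding int(3) ..
    also have "\<dots> = (\<integral>\<^sup>+w. ennreal ((norm (pullback X (truncate \<phi> k) w))\<^sup>2) \<partial>M)"
      by (rule nn_integral_eq_integral[OF int(2), symmetric]) simp
    also have "\<dots> = (\<integral>\<^sup>+w. indicator ?B (X w) * ennreal ((norm (pullback X \<phi> w))\<^sup>2) \<partial>M)"
      by (intro nn_integral_cong) (auto simp: pullback_truncate split: split_indicator)
    finally show ?thesis .
  qed
  have m1: "(\<lambda>w. ennreal (Gamma_form M \<Gamma> X \<phi> (X w))) \<in> borel_measurable M"
    using measurable_compose[OF Xm Gamma_form_measurable[OF X \<phi>]] by measurable
  have m2: "(\<lambda>w. ennreal ((norm (pullback X \<phi> w))\<^sup>2)) \<in> borel_measurable M"
    using pullback_measurable[OF X \<phi>] by measurable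
  show ?thesis unfolding sup[OF m1] sup[OF m2] eq ..
qed

text \<open>
  The isometry property of \<open>pullback\<close>. When the common value of the two nonnegative integrals is
  infinite, both Bochner integrals are \<open>0\<close>.
\<close>

lemma Gamma_form_integral:
  fixes X :: "'w \<Rightarrow> real^'d"
  assumes X: "admissible X" and \<phi>: "\<phi> \<in> borel_measurable borel"
  shows "(\<integral>x. Gamma_form M \<Gamma> X \<phi> x \<partial>distr M borel X) = (\<integral>w. (norm (pullback X \<phi> w))\<^sup>2 \<partial>M)"
proof -
  note Xm = admissible_measurable[OF X] and fm = Gamma_form_measurable[OF X \<phi>]
  have "(\<integral>x. Gamma_form M \<Gamma> X \<phi> x \<partial>distr M borel X) = (\<integral>w. Gamma_form M \<Gamma> X \<phi> (X w) \<partial>M)"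
    by (rule integral_distr[OF Xm fm])
  also have "\<dots> = enn2real (\<integral>\<^sup>+w. ennreal (Gamma_form M \<Gamma> X \<phi> (X w)) \<partial>M)"
    by (rule integral_eq_nn_integral[OF measurable_compose[OF Xm fm] Gamma_form_nonneg[OF X \<phi>]])
  also have "\<dots> = enn2real (\<integral>\<^sup>+w. ennreal ((norm (pullback X \<phi> w))\<^sup>2) \<partial>M)"
    by (simp only: Gamma_form_nn_integral[OF X \<phi>])
  also have "\<dots> = (\<integral>w. (norm (pullback X \<phi> w))\<^sup>2 \<partial>M)"
    using pullback_measurable[OF X \<phi>] by (intro integral_eq_nn_integral[symmetric]) auto
  finally show ?thesis .
qed

lemma L2_Gamma_iff:
  fixes X :: "'w \<Rightarrow> real^'d"
  assumes X: "admissible X" and \<phi>: "\<phi> \<in> borel_measurable borel"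
  shows "\<phi> \<in> L2_Gamma M \<Gamma> X \<longleftrightarrow> square_integrable M (pullback X \<phi>)"
proof -
  note Xm = admissible_measurable[OF X] and fm = Gamma_form_measurable[OF X \<phi>]
  have "\<phi> \<in> L2_Gamma M \<Gamma> X \<longleftrightarrow> integrable M (\<lambda>w. Gamma_form M \<Gamma> X \<phi> (X w))"
    using integrable_distr_eq[OF Xm fm] \<phi> by (simp add: L2_Gamma_def)
  also have "\<dots> \<longleftrightarrow> (\<integral>\<^sup>+w. ennreal (Gamma_form M \<Gamma> X \<phi> (X w)) \<partial>M) < \<infinity>"
  proof -
    have "(\<integral>\<^sup>+w. ennreal (norm (Gamma_form M \<Gamma> X \<phi> (X w))) \<partial>M) = (\<integral>\<^sup>+w. ennreal (Gamma_form M \<Gamma> X \<phi> (X w)) \<partial>M)"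
      by (rule nn_integral_cong_AE) (use Gamma_form_nonneg[OF X \<phi>] in eventually_elim, simp)
    then show ?thesis using measurable_compose[OF Xm fm] by (simp add: integrable_iff_bounded)
  qed
  also have "\<dots> \<longleftrightarrow> square_integrable M (pullback X \<phi>)"
    using pullback_measurable[OF X \<phi>]
    by (simp add: Gamma_form_nn_integral[OF X \<phi>] square_integrable_def integrable_iff_bounded)
  finally show ?thesis .
qed

end

section \<open>Measurable solution of positive semidefinite systems\<close>

definition matrix_sum_abs :: "real^'n^'n \<Rightarrow> real" where
  "matrix_sum_abs A = (\<Sum>i\<in>UNIV. \<Sum>j\<in>UNIV. \<bar>A $ i $ j\<bar>)"

lemma norm_matrix_vector_mult_le: "norm (A *v v) \<le> matrix_sum_abs A * norm v"
proof -
  have "norm (A *v v) \<le> (\<Sum>i\<in>UNIV. \<bar>(A *v v) $ i\<bar>)" by (rule norm_le_l1_cart)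
  also have "\<dots> \<le> (\<Sum>i\<in>UNIV. \<Sum>j\<in>UNIV. \<bar>A $ i $ j\<bar> * norm v)"
  proof (rule sum_mono)
    fix i
    have "\<bar>(A *v v) $ i\<bar> \<le> (\<Sum>j\<in>UNIV. \<bar>A $ i $ j * v $ j\<bar>)"
      by (simp add: matrix_vector_mult_def sum_abs)
    also have "\<dots> \<le> (\<Sum>j\<in>UNIV. \<bar>A $ i $ j\<bar> * norm v)"
      by (intro sum_mono) (auto simp: abs_mult intro!: mult_left_mono component_le_norm_cart)
    finally show "\<bar>(A *v v) $ i\<bar> \<le> (\<Sum>j\<in>UNIV. \<bar>A $ i $ j\<bar> * norm v)" .
  qed
  also have "\<dots> = matrix_sum_abs A * norm v" by (simp add: matrix_sum_abs_def sum_distrib_right)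
  finally show ?thesis .
qed

lemma matrix_sum_abs_nonneg: "0 \<le> matrix_sum_abs A"
  by (simp add: matrix_sum_abs_def sum_nonneg)

text \<open>
  Richardson's iteration for \<open>A v = b\<close>. For a singular matrix there is no inverse to apply, and a
  solution must be selected in a way that depends measurably on \<open>A\<close> and \<open>b\<close>. Each iterate is a
  rational function of the entries of \<open>A\<close> and \<open>b\<close> and of their absolute values, hence measurable,
  and the step size \<open>1 / (1 + matrix_sum_abs A)\<close> makes the iteration converge for every positive
  semidefinite \<open>A\<close> and every \<open>b\<close> in its range.
\<close>

fun richardson :: "real^'n^'n \<Rightarrow> real^'n \<Rightarrow> nat \<Rightarrow> real^'n" where
  "richardson A b 0 = 0"
| "richardson A b (Suc n) =
    richardson A b n + (1 / (1 + matrix_sum_abs A)) *\<^sub>R (b - A *v richardson A b n)"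

definition solve :: "real^'n^'n \<Rightarrow> real^'n \<Rightarrow> real^'n" where
  "solve A b = lim (richardson A b)"

locale positive_matrix =
  fixes A :: "real^'n^'n"
  assumes symmetric: "transpose A = A"
    and nonneg: "0 \<le> v \<bullet> (A *v v)"
begin

lemma self_adjoint: "u \<bullet> (A *v v) = (A *v u) \<bullet> v"
proof -
  have "A *v u = u v* A" using transpose_matrix_vector[of A u] by (simp only: symmetric)
  then show ?thesis by (simp only: dot_lmul_matrix)
qed

definition energy :: "real^'n \<Rightarrow> real" where
  "energy v = v \<bullet> (A *v v)"

lemma energy_nonneg: "0 \<le> energy v"
  using nonneg by (simp add: energy_def)

lemma energy_add: "energy (u + v) = energy u + 2 * (u \<bullet> (A *v v)) + energy v"
proof -
  have "v \<bullet> (A *v u) = u \<bullet> (A *v v)" by (metis self_adjoint inner_commute)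
  then show ?thesis by (simp add: energy_def matrix_vector_right_distrib inner_add_left inner_add_right)
qed

lemma energy_scaleR: "energy (c *\<^sub>R v) = c\<^sup>2 * energy v"
  by (simp add: energy_def matrix_vector_mult_scaleR power2_eq_square)

lemma energy_minus_commute: "energy (u - v) = energy (v - u)"
  using energy_scaleR[of "-1" "u - v"] by simp

lemma energy_Cauchy_Schwarz: "\<bar>u \<bullet> (A *v v)\<bar> \<le> sqrt (energy u) * sqrt (energy v)"
proof (rule discriminant_le)
  show "0 \<le> energy u + 2 * t * (u \<bullet> (A *v v)) + t\<^sup>2 * energy v" for t
    using energy_nonneg[of "u + t *\<^sub>R v"]
    by (simp add: energy_add energy_scaleR matrix_vector_mult_scaleR)
qed (rule energy_nonneg)+

lemma sqrt_energy_triangle: "sqrt (energy (u + v)) \<le> sqrt (energy u) + sqrt (energy v)"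
proof (rule real_le_lsqrt)
  show "0 \<le> sqrt (energy u) + sqrt (energy v)" by (simp add: energy_nonneg)
  show "energy (u + v) \<le> (sqrt (energy u) + sqrt (energy v))\<^sup>2"
    using energy_Cauchy_Schwarz[of u v] by (simp add: energy_add power2_sum energy_nonneg)
qed

text \<open>
  The Cauchy-Schwarz inequality for the form, applied to \<open>A v\<close> and \<open>v\<close>. It shows that vectors which
  are close for the form have close images under \<open>A\<close>.
\<close>

lemma norm_image_le: "(norm (A *v v))\<^sup>2 \<le> matrix_sum_abs A * energy v"
proof -
  let ?w = "A *v v" and ?K = "matrix_sum_abs A"
  have le: "energy ?w \<le> ?K * (norm ?w)\<^sup>2"
  proof -
    have "energy ?w \<le> norm ?w * norm (A *v ?w)" unfolding energy_def by (rule norm_cauchy_schwarz)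
    also have "\<dots> \<le> norm ?w * (?K * norm ?w)"
      by (intro mult_left_mono norm_matrix_vector_mult_le) simp
    finally show ?thesis by (simp add: power2_eq_square mult_ac)
  qed
  show ?thesis
  proof (cases "?w = 0")
    case True
    then show ?thesis by (simp add: energy_nonneg matrix_sum_abs_nonneg)
  next
    case False
    have "(norm ?w)\<^sup>2 \<le> sqrt (energy ?w) * sqrt (energy v)"
      using energy_Cauchy_Schwarz[of ?w v] by (simp add: power2_norm_eq_inner)
    then have "((norm ?w)\<^sup>2)\<^sup>2 \<le> (sqrt (energy ?w) * sqrt (energy v))\<^sup>2"
      by (rule power_mono) simp
    also have "\<dots> = energy ?w * energy v" by (simp add: power_mult_distrib energy_nonneg)
    also have "\<dots> \<le> (?K * (norm ?w)\<^sup>2) * energy v" by (intro mult_right_mono le energy_nonneg)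
    finally have "(norm ?w)\<^sup>2 * (norm ?w)\<^sup>2 \<le> (norm ?w)\<^sup>2 * (?K * energy v)"
      by (simp add: power2_eq_square mult_ac)
    moreover have "0 < (norm ?w)\<^sup>2" using False by simp
    ultimately show ?thesis by (metis mult_le_cancel_left_pos)
  qed
qed

text \<open>
  The errors are \<open>A (f n)\<close>, where \<open>f\<close> runs through the homogeneous iteration started at \<open>u\<close>. The squared
  norms of \<open>f n\<close> decrease, and each decrease controls the square of the error, which therefore
  tends to \<open>0\<close>.
\<close>

lemma richardson_tendsto:
  assumes z: "z = A *v u"
  shows "richardson A (A *v z) \<longlonglongrightarrow> z"
proof -
  define K where "K = 1 + matrix_sum_abs A"
  have K: "K \<ge> 1" using matrix_sum_abs_nonneg[of A] by (simp add: K_def)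
  \<comment> \<open>preimages under \<open>A\<close> of the errors\<close>
  define f where "f n = ((\<lambda>f. f - (1 / K) *\<^sub>R (A *v f)) ^^ n) u" for n
  have f_Suc: "f (Suc n) = f n - (1 / K) *\<^sub>R (A *v f n)" for n by (simp add: f_def)
  have image: "(norm (A *v v))\<^sup>2 \<le> K * energy v" for v
    using norm_image_le[of v] energy_nonneg[of v] by (simp add: K_def algebra_simps)
  have err: "z - richardson A (A *v z) n = A *v f n" for n
  proof (induction n)
    case 0
    then show ?case by (simp add: f_def z)
  next
    case (Suc n)
    have "z - richardson A (A *v z) (Suc n) =
        (z - richardson A (A *v z) n) - (1 / K) *\<^sub>R (A *v (z - richardson A (A *v z) n))"
      by (simp add: K_def matrix_vector_mult_diff_distrib)
    also have "\<dots> = A *v f (Suc n)"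
      by (simp add: Suc.IH f_Suc matrix_vector_mult_diff_distrib matrix_vector_mult_scaleR)
    finally show ?case .
  qed
  have decrease: "(norm (A *v f n))\<^sup>2 \<le> K\<^sup>2 * ((norm (f n))\<^sup>2 - (norm (f (Suc n)))\<^sup>2)" for n
  proof -
    have "(norm (f (Suc n)))\<^sup>2 = (norm (f n))\<^sup>2 - 2 / K * energy (f n) + (1 / K)\<^sup>2 * (norm (A *v f n))\<^sup>2"
      unfolding f_Suc power2_norm_eq_inner
      by (simp add: inner_simps energy_def inner_commute power2_eq_square)
    also have "(1 / K)\<^sup>2 * (norm (A *v f n))\<^sup>2 \<le> (1 / K)\<^sup>2 * (K * energy (f n))"
      by (intro mult_left_mono image) simp
    also have "(1 / K)\<^sup>2 * (K * energy (f n)) = 1 / K * energy (f n)"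
      using K by (simp add: power2_eq_square field_simps)
    finally have "1 / K * energy (f n) \<le> (norm (f n))\<^sup>2 - (norm (f (Suc n)))\<^sup>2" by simp
    then have "K\<^sup>2 * (1 / K * energy (f n)) \<le> K\<^sup>2 * ((norm (f n))\<^sup>2 - (norm (f (Suc n)))\<^sup>2)"
      by (rule mult_left_mono) simp
    moreover have "K\<^sup>2 * (1 / K * energy (f n)) = K * energy (f n)"
      using K by (simp add: power2_eq_square)
    ultimately show ?thesis using image[of "f n"] by simp
  qed
  have "(norm (f (Suc n)))\<^sup>2 \<le> (norm (f n))\<^sup>2" for n
  proof -
    have "0 \<le> K\<^sup>2 * ((norm (f n))\<^sup>2 - (norm (f (Suc n)))\<^sup>2)"
      by (rule order_trans[OF _ decrease]) simp
    then show ?thesis using K by (simp add: zero_le_mult_iff)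
  qed
  then have "decseq (\<lambda>n. (norm (f n))\<^sup>2)" by (simp add: decseq_Suc_iff)
  then obtain L where L: "(\<lambda>n. (norm (f n))\<^sup>2) \<longlonglongrightarrow> L"
    using decseq_convergent[of "\<lambda>n. (norm (f n))\<^sup>2" 0] by auto
  have "(\<lambda>n. K\<^sup>2 * ((norm (f n))\<^sup>2 - (norm (f (Suc n)))\<^sup>2)) \<longlonglongrightarrow> K\<^sup>2 * (L - L)"
    by (intro tendsto_intros L LIMSEQ_Suc[OF L])
  then have zero: "(\<lambda>n. K\<^sup>2 * ((norm (f n))\<^sup>2 - (norm (f (Suc n)))\<^sup>2)) \<longlonglongrightarrow> 0" by simp
  have "(\<lambda>n. (norm (A *v f n))\<^sup>2) \<longlonglongrightarrow> 0"
    by (rule tendsto_sandwich[OF always_eventually always_eventually tendsto_const zero])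
       (use decrease in auto)
  then have "(\<lambda>n. sqrt ((norm (A *v f n))\<^sup>2)) \<longlonglongrightarrow> sqrt 0" by (rule tendsto_real_sqrt)
  then have "(\<lambda>n. A *v f n) \<longlonglongrightarrow> 0" by (simp add: tendsto_norm_zero_iff)
  then have "(\<lambda>n. z - (z - richardson A (A *v z) n)) \<longlonglongrightarrow> z - 0"
    unfolding err by (intro tendsto_intros)
  then show ?thesis by simp
qed

text \<open>
  The iteration converges to a solution in the range of \<open>A\<close>. Such a solution exists, because the
  component of a given solution orthogonal to the range lies in the kernel, \<open>A\<close> being symmetric.
\<close>

lemma matrix_vector_solve:
  assumes "b \<in> range ((*v) A)"
  shows "A *v solve A b = b"
proof -
  obtain y where y: "b = A *v y" using assms by auto
  have "subspace (range ((*v) A))"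
    by (rule linear_subspace_image[OF matrix_vector_mul_linear subspace_UNIV])
  then have span: "span (range ((*v) A)) = range ((*v) A)" by (simp only: span_eq_iff)
  obtain z k where z: "z \<in> span (range ((*v) A))"
    and k: "\<And>w. w \<in> span (range ((*v) A)) \<Longrightarrow> orthogonal k w" and yzk: "y = z + k"
    using orthogonal_subspace_decomp_exists by blast
  have "(A *v k) \<bullet> (A *v k) = k \<bullet> (A *v (A *v k))" by (simp add: self_adjoint)
  also have "\<dots> = 0" using k[of "A *v (A *v k)"] by (simp add: span orthogonal_def)
  finally have "A *v k = 0" by simp
  then have b: "b = A *v z" by (simp add: y yzk matrix_vector_right_distrib)
  obtain u where "z = A *v u" using z unfolding span by auto
  then have "solve A b = z" unfolding solve_def b by (intro limI richardson_tendsto)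
  then show ?thesis by (simp add: b)
qed

text \<open>
  A sequence that is Cauchy for the form may well diverge along the kernel of \<open>A\<close>, but the images
  under \<open>A\<close> converge, and a solution of the limiting equation is a limit of the sequence for the
  form.
\<close>

lemma energy_limit:
  assumes sum: "summable (\<lambda>k. sqrt (energy (v (Suc k) - v k)))"
  shows "(\<lambda>l. energy (v k - v l)) \<longlonglongrightarrow> energy (v k - solve A (lim (\<lambda>l. A *v v l)))"
proof -
  define b where "b = lim (\<lambda>l. A *v v l)"
  define \<phi> where "\<phi> = solve A b"
  have "norm (A *v v (Suc k) - A *v v k) \<le> sqrt (matrix_sum_abs A) * sqrt (energy (v (Suc k) - v k))" for k
    using real_sqrt_le_mono[OF norm_image_le[of "v (Suc k) - v k"]]
    by (simp add: real_sqrt_mult matrix_vector_mult_diff_distrib)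
  then have "summable (\<lambda>k. norm (A *v v (Suc k) - A *v v k))"
    by (intro summable_comparison_test'[OF summable_mult[OF sum, of "sqrt (matrix_sum_abs A)"], of 0]) auto
  then have "convergent (\<lambda>k. A *v v k)" by (rule convergent_of_summable_norm_diff)
  then have b: "(\<lambda>k. A *v v k) \<longlonglongrightarrow> b" by (simp add: b_def convergent_LIMSEQ_iff)
  have "closed (range ((*v) A))"
    by (intro closed_subspace linear_subspace_image matrix_vector_mul_linear subspace_UNIV)
  then have "b \<in> range ((*v) A)"
    by (rule closed_sequentially[OF _ _ b]) auto
  then have A\<phi>: "A *v \<phi> = b" unfolding \<phi>_def by (rule matrix_vector_solve)
  define d where "d l = v l - \<phi>" for l
  have Ad: "(\<lambda>l. A *v d l) \<longlonglongrightarrow> 0"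
    using tendsto_diff[OF b tendsto_const[of b]] by (simp add: d_def matrix_vector_mult_diff_distrib A\<phi>)
  have dd: "d l - d m = v l - v m" for l m by (simp add: d_def)
  \<comment> \<open>the distance between two terms is at most the tail \<open>t l\<close> of the series of increments\<close>
  have tail: "sqrt (energy (v (l + n) - v l)) \<le> (\<Sum>i. sqrt (energy (v (Suc (i + l)) - v (i + l))))" for l n
  proof -
    have "sqrt (energy (v (l + n) - v l)) \<le> (\<Sum>i<n. sqrt (energy (v (Suc (i + l)) - v (i + l))))"
    proof (induction n)
      case 0
      then show ?case by (simp add: energy_def)
    next
      case (Suc n)
      have eq: "v (l + Suc n) - v l = (v (l + n) - v l) + (v (Suc (n + l)) - v (n + l))"
        by (simp add: add.commute)
      have "sqrt (energy (v (l + Suc n) - v l)) \<le>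
          sqrt (energy (v (l + n) - v l)) + sqrt (energy (v (Suc (n + l)) - v (n + l)))"
        unfolding eq by (rule sqrt_energy_triangle)
      then show ?case using Suc.IH by simp
    qed
    also have "\<dots> \<le> (\<Sum>i. sqrt (energy (v (Suc (i + l)) - v (i + l))))"
      by (rule sum_le_suminf) (use summable_ignore_initial_segment[OF sum, of l] in \<open>auto simp: energy_nonneg\<close>)
    finally show ?thesis .
  qed
  define t where "t l = (\<Sum>i. sqrt (energy (v (Suc (i + l)) - v (i + l))))" for l
  have t: "t \<longlonglongrightarrow> 0" unfolding t_def by (rule suminf_exist_split2[OF sum])
  have d_le: "sqrt (energy (d l)) \<le> t l" for l
  proof -
    \<comment> \<open>\<open>energy (d l)\<close> is split as \<open>d l \<bullet> A (d l - d m) + d l \<bullet> A (d m)\<close>; the second term vanishes as \<open>m\<close> grows\<close>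
    have "(\<lambda>m. sqrt (energy (d l)) * t l + d l \<bullet> (A *v d m)) \<longlonglongrightarrow> sqrt (energy (d l)) * t l + d l \<bullet> 0"
      by (intro tendsto_intros Ad)
    moreover have "energy (d l) \<le> sqrt (energy (d l)) * t l + d l \<bullet> (A *v d m)" if "m \<ge> l" for m
    proof -
      have "energy (d l) = d l \<bullet> (A *v (d l - d m)) + d l \<bullet> (A *v d m)"
        by (simp add: energy_def matrix_vector_mult_diff_distrib inner_diff_right)
      also have "d l \<bullet> (A *v (d l - d m)) \<le> sqrt (energy (d l)) * sqrt (energy (d l - d m))"
        using energy_Cauchy_Schwarz[of "d l" "d l - d m"] by simp
      also have "sqrt (energy (d l - d m)) \<le> t l"
        using tail[of l "m - l"] that by (simp add: t_def dd energy_minus_commute[of "v l"])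
      finally show ?thesis by (simp add: mult_left_mono energy_nonneg)
    qed
    ultimately have "energy (d l) \<le> sqrt (energy (d l)) * t l + d l \<bullet> 0"
      by (intro LIMSEQ_le_const) blast+
    then have le: "sqrt (energy (d l)) * sqrt (energy (d l)) \<le> sqrt (energy (d l)) * t l"
      by (simp add: energy_nonneg)
    show ?thesis
    proof (cases "energy (d l) = 0")
      case True
      then show ?thesis using tail[of l 0] by (simp add: t_def energy_def)
    next
      case False
      then have "0 < sqrt (energy (d l))" using energy_nonneg[of "d l"] by simp
      then show ?thesis using le mult_le_cancel_left_pos by blast
    qed
  qed
  have "(\<lambda>l. sqrt (energy (d l))) \<longlonglongrightarrow> 0"
    by (rule tendsto_sandwich[OF always_eventually always_eventually tendsto_const t])
       (use d_le in \<open>auto simp: energy_nonneg\<close>)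
  then have "(\<lambda>l. (sqrt (energy (d l)))\<^sup>2) \<longlonglongrightarrow> 0\<^sup>2" by (intro tendsto_intros)
  then have "(\<lambda>l. energy (d l)) \<longlonglongrightarrow> 0" by (simp add: energy_nonneg)
  then have "(\<lambda>l. energy (d k) - 2 * (d k \<bullet> (A *v d l)) + energy (d l)) \<longlonglongrightarrow> energy (d k) - 2 * (d k \<bullet> 0) + 0"
    by (intro tendsto_intros Ad)
  moreover have "energy (v k - v l) = energy (d k) - 2 * (d k \<bullet> (A *v d l)) + energy (d l)" for l
  proof -
    have "A *v ((-1) *\<^sub>R d l) = (-1) *\<^sub>R (A *v d l)" by (rule matrix_vector_mult_scaleR)
    then show ?thesis
      using energy_add[of "d k" "(-1) *\<^sub>R d l"] energy_scaleR[of "-1" "d l"] dd[of k l] by simp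
  qed
  ultimately show ?thesis by (simp add: d_def \<phi>_def b_def)
qed

end

lemma borel_measurable_matrix_vector_mult:
  fixes A :: "'a \<Rightarrow> real^'n^'n"
  assumes "\<And>i j. (\<lambda>x. A x $ i $ j) \<in> borel_measurable M" "f \<in> borel_measurable M"
  shows "(\<lambda>x. A x *v f x) \<in> borel_measurable M"
  unfolding matrix_vector_mult_def
  by (rule borel_measurable_vec) (simp add: assms borel_measurable_sum borel_measurable_times borel_measurable_vec_nth)

lemma borel_measurable_solve:
  fixes A :: "'a \<Rightarrow> real^'n^'n"
  assumes A: "\<And>i j. (\<lambda>x. A x $ i $ j) \<in> borel_measurable M" and b: "b \<in> borel_measurable M"
  shows "(\<lambda>x. solve (A x) (b x)) \<in> borel_measurable M"
proof -
  have K: "(\<lambda>x. 1 / (1 + matrix_sum_abs (A x))) \<in> borel_measurable M"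
    unfolding matrix_sum_abs_def using A by measurable
  have "(\<lambda>x. richardson (A x) (b x) n) \<in> borel_measurable M" for n
  proof (induction n)
    case (Suc n)
    then show ?case
      unfolding richardson.simps
      by (intro borel_measurable_add borel_measurable_scaleR borel_measurable_diff K b
          borel_measurable_matrix_vector_mult A)
  qed simp
  then show ?thesis unfolding solve_def by (rule borel_measurable_lim_metric)
qed

section \<open>Completeness of the space of fields\<close>

context gradient_structure
begin

text \<open>
  The space \<open>L2_Gamma M \<Gamma> X\<close> is complete, although $\Gamma_X[I]$ may be degenerate. Along a fast
  approximating sequence \<open>f k\<close> the increments are summable almost everywhere for the form given by
  the matrix at the point, and \<open>solve\<close> selects a limit measurably; Fatou's lemma then controls its
  distance to \<open>f k\<close> in mean square.
\<close>

lemma pullback_range_closed: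
  fixes X :: "'w \<Rightarrow> real^'d"
  assumes X: "admissible X" and \<Psi>: "square_integrable M \<Psi>"
    and approx: "\<And>\<epsilon>. \<epsilon> > 0 \<Longrightarrow> \<exists>\<phi>\<in>borel_measurable borel. square_integrable M (pullback X \<phi>) \<and>
      (\<integral>w. (norm (pullback X \<phi> w - \<Psi> w))\<^sup>2 \<partial>M) < \<epsilon>"
  shows "\<exists>\<phi>\<in>borel_measurable borel. AE w in M. \<Psi> w = pullback X \<phi> w"
proof -
  let ?G = "Gamma_matrix M \<Gamma> X"
  \<comment> \<open>the factor \<open>1/4\<close> leaves room for doubling twice, in the Cauchy estimate below\<close>
  have "\<exists>f. \<forall>k::nat. f k \<in> borel_measurable borel \<and> square_integrable M (pullback X (f k)) \<and>
      (\<integral>w. (norm (pullback X (f k) w - \<Psi> w))\<^sup>2 \<partial>M) < (1/4) ^ k / 4"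
  proof (rule choice, rule allI)
    fix k :: nat
    have "(0::real) < (1/4) ^ k / 4" by simp
    from approx[OF this] show "\<exists>\<phi>. \<phi> \<in> borel_measurable borel \<and> square_integrable M (pullback X \<phi>) \<and>
      (\<integral>w. (norm (pullback X \<phi> w - \<Psi> w))\<^sup>2 \<partial>M) < (1/4) ^ k / 4" by blast
  qed
  then obtain f where f: "\<And>k. f k \<in> borel_measurable borel" and sq: "\<And>k. square_integrable M (pullback X (f k))"
    and fast: "\<And>k. (\<integral>w. (norm (pullback X (f k) w - \<Psi> w))\<^sup>2 \<partial>M) < (1/4) ^ k / 4" by blast
  define \<phi> where "\<phi> x = solve (?G x) (lim (\<lambda>k. ?G x *v f k x))" for x
  note Gm = Gamma_matrix_measurable[OF X]
  have "(\<lambda>x. lim (\<lambda>k. ?G x *v f k x)) \<in> borel_measurable borel"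
    by (rule borel_measurable_lim_metric) (rule borel_measurable_matrix_vector_mult[OF Gm f])
  from borel_measurable_solve[OF Gm this] have \<phi>: "\<phi> \<in> borel_measurable borel"
    by (simp only: \<phi>_def[abs_def])
  have diff_m: "(\<lambda>x. f k x - f l x) \<in> borel_measurable borel" for k l by (intro borel_measurable_diff f)
  have diff_sq: "square_integrable M (pullback X (\<lambda>x. f k x - f l x))" for k l
    unfolding pullback_diff[abs_def] by (intro square_integrable_diff sq)
  have Cauchy: "(\<integral>w. (norm (pullback X (\<lambda>x. f k x - f l x) w))\<^sup>2 \<partial>M) \<le> (1/4) ^ k" if "l \<ge> k" for k l
  proof -
    let ?d = "\<lambda>k w. pullback X (f k) w - \<Psi> w"
    have d: "square_integrable M (?d k)" for k by (intro square_integrable_diff sq \<Psi>)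
    have "(\<integral>w. (norm (pullback X (\<lambda>x. f k x - f l x) w))\<^sup>2 \<partial>M) = (\<integral>w. (norm (?d k w + (-1) *\<^sub>R ?d l w))\<^sup>2 \<partial>M)"
      by (simp add: pullback_diff)
    also have "\<dots> \<le> 2 * (\<integral>w. (norm (?d k w))\<^sup>2 \<partial>M) + 2 * (\<integral>w. (norm ((-1) *\<^sub>R ?d l w))\<^sup>2 \<partial>M)"
      by (intro square_integrable_norm_sum_le square_integrable_scaleR d)
    also have "(\<integral>w. (norm ((-1) *\<^sub>R ?d l w))\<^sup>2 \<partial>M) = (\<integral>w. (norm (?d l w))\<^sup>2 \<partial>M)"
      by (simp add: norm_minus_commute)
    also have "2 * (\<integral>w. (norm (?d k w))\<^sup>2 \<partial>M) + 2 * (\<integral>w. (norm (?d l w))\<^sup>2 \<partial>M) \<le> (1/4) ^ k"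
    proof -
      have "(1/4::real) ^ l \<le> (1/4) ^ k" by (rule power_decreasing[OF that]) auto
      then show ?thesis using fast[of k] fast[of l] by linarith
    qed
    finally show ?thesis .
  qed
  have energy: "Gamma_form M \<Gamma> X \<psi> x = positive_matrix.energy (?G x) (\<psi> x)"
    if "positive_matrix (?G x)" for \<psi> x
    using positive_matrix.energy_def[OF that] by (simp add: Gamma_form_def)
  have pos: "AE w in M. positive_matrix (?G (X w))"
    using Gamma_matrix_symmetric[OF X] Gamma_matrix_positive[OF X]
    by eventually_elim (simp add: positive_matrix_def)
  have "AE w in M. summable (\<lambda>k. norm (sqrt (Gamma_form M \<Gamma> X (\<lambda>x. f (Suc k) x - f k x) (X w))))"
  proof (rule AE_summable_of_square_integrals)
    fix k
    let ?g = "\<lambda>w. sqrt (Gamma_form M \<Gamma> X (\<lambda>x. f (Suc k) x - f k x) (X w))"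
    have fm: "(\<lambda>w. Gamma_form M \<Gamma> X (\<lambda>x. f (Suc k) x - f k x) (X w)) \<in> borel_measurable M"
      by (rule measurable_compose[OF admissible_measurable[OF X] Gamma_form_measurable[OF X diff_m]])
    have sq_eq: "AE w in M. (norm (?g w))\<^sup>2 = Gamma_form M \<Gamma> X (\<lambda>x. f (Suc k) x - f k x) (X w)"
      using Gamma_form_nonneg[OF X diff_m, of "Suc k" k] by eventually_elim simp
    have int: "integrable M (\<lambda>w. Gamma_form M \<Gamma> X (\<lambda>x. f (Suc k) x - f k x) (X w))"
      using L2_Gamma_iff[OF X diff_m, of "Suc k" k] diff_sq[of "Suc k" k]
        integrable_distr_eq[OF admissible_measurable[OF X] Gamma_form_measurable[OF X diff_m]]
      by (simp add: L2_Gamma_def)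
    show "square_integrable M ?g"
      unfolding square_integrable_def
    proof
      show gm: "?g \<in> borel_measurable M" using fm by measurable
      show "integrable M (\<lambda>w. (norm (?g w))\<^sup>2)"
        by (rule integrable_cong_AE_imp[OF int]) (use gm sq_eq in auto)
    qed
    have "(\<integral>w. (norm (?g w))\<^sup>2 \<partial>M) = (\<integral>w. Gamma_form M \<Gamma> X (\<lambda>x. f (Suc k) x - f k x) (X w) \<partial>M)"
      by (rule integral_cong_AE) (use fm sq_eq in auto)
    also have "\<dots> = (\<integral>w. (norm (pullback X (\<lambda>x. f (Suc k) x - f k x) w))\<^sup>2 \<partial>M)"
      using Gamma_form_integral[OF X diff_m, of "Suc k" k]
        integral_distr[OF admissible_measurable[OF X] Gamma_form_measurable[OF X diff_m], of "Suc k" k] by simp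
    also have "\<dots> = (\<integral>w. (norm (pullback X (\<lambda>x. f k x - f (Suc k) x) w))\<^sup>2 \<partial>M)"
      by (simp add: pullback_diff norm_minus_commute)
    also have "\<dots> \<le> (1/4) ^ k" by (rule Cauchy) simp
    finally show "(\<integral>w. (norm (?g w))\<^sup>2 \<partial>M) \<le> (1/4) ^ k" .
  qed
  then have lim: "AE w in M. \<forall>k. (\<lambda>l. Gamma_form M \<Gamma> X (\<lambda>x. f k x - f l x) (X w))
      \<longlonglongrightarrow> Gamma_form M \<Gamma> X (\<lambda>x. f k x - \<phi> x) (X w)"
    using pos
  proof eventually_elim
    case (elim w)
    interpret positive_matrix "?G (X w)" by (rule elim(2))
    note en = energy[OF elim(2)]
    from elim(1) have "summable (\<lambda>k. sqrt (energy (f (Suc k) (X w) - f k (X w))))"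
      by (simp add: en energy_nonneg)
    from energy_limit[OF this] show ?case by (simp add: en \<phi>_def)
  qed
  \<comment> \<open>the distance to the limit is bounded as the distance to later terms of the sequence\<close>
  have \<phi>_le: "(\<integral>\<^sup>+w. ennreal ((norm (pullback X (\<lambda>x. f k x - \<phi> x) w))\<^sup>2) \<partial>M) \<le> ennreal ((1/4) ^ k)" for k
  proof -
    have "(\<integral>\<^sup>+w. ennreal (Gamma_form M \<Gamma> X (\<lambda>x. f k x - \<phi> x) (X w)) \<partial>M) \<le> ennreal ((1/4) ^ k)"
    proof (rule nn_integral_limit_le)
      show "(\<lambda>w. ennreal (Gamma_form M \<Gamma> X (\<lambda>x. f k x - f l x) (X w))) \<in> borel_measurable M" for l
        using measurable_compose[OF admissible_measurable[OF X] Gamma_form_measurable[OF X diff_m[of k l]]] by measurable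
      show "AE w in M. (\<lambda>l. ennreal (Gamma_form M \<Gamma> X (\<lambda>x. f k x - f l x) (X w)))
          \<longlonglongrightarrow> ennreal (Gamma_form M \<Gamma> X (\<lambda>x. f k x - \<phi> x) (X w))"
        using lim by eventually_elim (auto intro: tendsto_ennrealI)
      show "\<forall>\<^sub>F l in sequentially. (\<integral>\<^sup>+w. ennreal (Gamma_form M \<Gamma> X (\<lambda>x. f k x - f l x) (X w)) \<partial>M) \<le> ennreal ((1/4) ^ k)"
      proof (rule eventually_sequentiallyI[of k])
        fix l assume "k \<le> l"
        have "(\<integral>\<^sup>+w. ennreal (Gamma_form M \<Gamma> X (\<lambda>x. f k x - f l x) (X w)) \<partial>M) =
            ennreal (\<integral>w. (norm (pullback X (\<lambda>x. f k x - f l x) w))\<^sup>2 \<partial>M)"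
          unfolding Gamma_form_nn_integral[OF X diff_m]
          by (rule nn_integral_eq_integral[OF square_integrable_integrable[OF diff_sq]]) simp
        also have "\<dots> \<le> ennreal ((1/4) ^ k)" by (intro ennreal_leI Cauchy \<open>k \<le> l\<close>)
        finally show "(\<integral>\<^sup>+w. ennreal (Gamma_form M \<Gamma> X (\<lambda>x. f k x - f l x) (X w)) \<partial>M) \<le> ennreal ((1/4) ^ k)" .
      qed
    qed
    then show ?thesis by (simp only: Gamma_form_nn_integral[OF X borel_measurable_diff[OF f \<phi>]])
  qed
  have d_sq: "square_integrable M (pullback X (\<lambda>x. f k x - \<phi> x))" for k
    using pullback_measurable[OF X borel_measurable_diff[OF f \<phi>, of k]] \<phi>_le[of k]
    by (auto simp: square_integrable_def integrable_iff_bounded intro: le_less_trans)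
  have d_le: "(\<integral>w. (norm (pullback X (\<lambda>x. f k x - \<phi> x) w))\<^sup>2 \<partial>M) \<le> (1/4) ^ k" for k
    using \<phi>_le[of k] nn_integral_eq_integral[OF square_integrable_integrable[OF d_sq[of k]]]
    by (simp add: ennreal_le_iff)
  have \<phi>_sq: "square_integrable M (pullback X \<phi>)"
    using square_integrable_diff[OF sq[of 0] d_sq[of 0]] by (simp add: pullback_diff)
  have bound: "(\<integral>w. (norm (\<Psi> w - pullback X \<phi> w))\<^sup>2 \<partial>M) \<le> 4 * (1/4) ^ k" for k
  proof -
    have sq1: "square_integrable M (\<lambda>w. pullback X (f k) w - \<Psi> w)" by (intro square_integrable_diff sq \<Psi>)
    have "(\<integral>w. (norm (\<Psi> w - pullback X \<phi> w))\<^sup>2 \<partial>M) =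
      (\<integral>w. (norm (pullback X (\<lambda>x. f k x - \<phi> x) w + (-1) *\<^sub>R (pullback X (f k) w - \<Psi> w)))\<^sup>2 \<partial>M)"
      by (simp add: pullback_diff)
    also have "\<dots> \<le> 2 * (\<integral>w. (norm (pullback X (\<lambda>x. f k x - \<phi> x) w))\<^sup>2 \<partial>M)
        + 2 * (\<integral>w. (norm ((-1) *\<^sub>R (pullback X (f k) w - \<Psi> w)))\<^sup>2 \<partial>M)"
      by (intro square_integrable_norm_sum_le square_integrable_scaleR d_sq sq1)
    also have "(\<integral>w. (norm ((-1) *\<^sub>R (pullback X (f k) w - \<Psi> w)))\<^sup>2 \<partial>M) = (\<integral>w. (norm (pullback X (f k) w - \<Psi> w))\<^sup>2 \<partial>M)"
      by (simp add: norm_minus_commute)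
    finally have le: "(\<integral>w. (norm (\<Psi> w - pullback X \<phi> w))\<^sup>2 \<partial>M) \<le>
        2 * (\<integral>w. (norm (pullback X (\<lambda>x. f k x - \<phi> x) w))\<^sup>2 \<partial>M)
        + 2 * (\<integral>w. (norm (pullback X (f k) w - \<Psi> w))\<^sup>2 \<partial>M)" .
    have "(0::real) \<le> (1/4) ^ k" by simp
    then show ?thesis using le d_le[of k] fast[of k] by linarith
  qed
  have "(\<lambda>k. 4 * (1/4::real) ^ k) \<longlonglongrightarrow> 4 * 0" by (intro tendsto_intros LIMSEQ_power_zero) simp
  then have "(\<integral>w. (norm (\<Psi> w - pullback X \<phi> w))\<^sup>2 \<partial>M) \<le> 4 * 0"
    by (rule LIMSEQ_le_const) (use bound in blast)
  then have "(\<integral>w. (norm (\<Psi> w - pullback X \<phi> w))\<^sup>2 \<partial>M) = 0"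
    by (intro antisym Bochner_Integration.integral_nonneg) auto
  then have "AE w in M. \<Psi> w - pullback X \<phi> w = 0"
    using square_integrable_null_iff[OF square_integrable_diff[OF \<Psi> \<phi>_sq]] by simp
  then have "AE w in M. \<Psi> w = pullback X \<phi> w" by simp
  then show ?thesis using \<phi> by blast
qed

end

section \<open>The chain rule for smooth functions\<close>

text \<open>
  The functional calculus concerns functions of finitely many entries of a sequence. A function on
  $\mathbb{R}^d$ becomes one through an enumeration \<open>en\<close> of the coordinates, with inverse \<open>idx\<close>.
\<close>

lemma C1_Lipschitz_nat_of_GDERIV:
  fixes u :: "real^'d \<Rightarrow> real"
  assumes lip: "C-lipschitz_on UNIV u" and g: "\<And>x. GDERIV u x :> g x" "continuous_on UNIV g"
    and en: "bij_betw en {..<k} (UNIV :: 'd set)" and idx: "\<And>i. en (idx i) = i" "\<And>i. idx i < k"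
  shows "C1_Lipschitz_nat k (\<lambda>x. u (\<chi> i. x (idx i))) (\<lambda>j x. g (\<chi> i. x (idx i)) $ en j)"
  unfolding C1_Lipschitz_nat_def
proof (intro conjI allI impI exI)
  fix x y :: "nat \<Rightarrow> real"
  let ?v = "\<lambda>x::nat \<Rightarrow> real. \<chi> i. x (idx i)"
  have idx_bij: "bij_betw idx UNIV {..<k}"
    by (rule bij_betw_byWitness[where f' = en])
       (use en idx in \<open>auto simp: bij_betw_def inj_on_def\<close>)
  have "\<bar>u (?v x) - u (?v y)\<bar> \<le> C * norm (?v x - ?v y)"
    using lipschitz_onD[OF lip, of "?v x" "?v y"] by (simp add: dist_norm)
  also have "norm (?v x - ?v y) = L2_set (\<lambda>i. x i - y i) {..<k}"
    unfolding norm_vec_def L2_set_def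
    using sum.reindex_bij_betw[OF idx_bij, of "\<lambda>i. (x i - y i)\<^sup>2"] by simp
  finally show "\<bar>u (?v x) - u (?v y)\<bar> \<le> C * L2_set (\<lambda>i. x i - y i) {..<k}" .
next
  fix j
  have "continuous_on UNIV (\<lambda>x::nat \<Rightarrow> real. \<chi> i. x (idx i))"
    by (intro continuous_on_vec_lambda continuous_on_product_coordinates)
  from continuous_on_compose2[OF g(2) this]
  show "continuous_on UNIV (\<lambda>x::nat \<Rightarrow> real. g (\<chi> i. x (idx i)) $ en j)"
    by (intro continuous_on_component) auto
next
  fix j and x :: "nat \<Rightarrow> real"
  assume j: "j < k"
  let ?y = "\<chi> i. x (idx i)"
  have line: "(\<chi> i. (x(j := t)) (idx i)) = ?y + (t - x j) *\<^sub>R axis (en j) 1" for t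
  proof -
    have *: "idx i = j \<longleftrightarrow> i = en j" for i
      using j idx en by (metis bij_betw_imp_inj_on inj_onD lessThan_iff)
    have "(x(j := t)) (idx i) = x (idx i) + (t - x j) * (if i = en j then 1 else 0)" for i
      by (cases "idx i = j") (simp_all add: *[symmetric])
    then show ?thesis by (simp add: vec_eq_iff axis_def)
  qed
  have "((\<lambda>t. ?y + (t - x j) *\<^sub>R axis (en j) 1 :: real^'d) has_derivative (\<lambda>t. t *\<^sub>R axis (en j) 1)) (at (x j))"
    by (auto intro!: derivative_eq_intros)
  moreover have "(u has_derivative (\<lambda>h. h \<bullet> g ?y)) (at (?y + (x j - x j) *\<^sub>R axis (en j) 1))"
    using g(1)[of ?y] by (simp add: gderiv_def)
  ultimately have "((\<lambda>t. u (?y + (t - x j) *\<^sub>R axis (en j) 1)) has_derivative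
      (\<lambda>t. (t *\<^sub>R axis (en j) 1) \<bullet> g ?y)) (at (x j))"
    by (rule has_derivative_compose)
  moreover have "(\<lambda>t. (t *\<^sub>R axis (en j) 1) \<bullet> g ?y) = (*) (g ?y $ en j)"
    by (auto simp: inner_axis' mult.commute)
  ultimately show "((\<lambda>t. u (\<chi> i. (x(j := t)) (idx i))) has_real_derivative g ?y $ en j) (at (x j))"
    unfolding line has_field_derivative_def by simp
qed

lemma C1_Lipschitz_nat_coordinate: "C1_Lipschitz_nat 1 (\<lambda>x. x 0) (\<lambda>i x. 1)"
  unfolding C1_Lipschitz_nat_def
proof (intro conjI allI impI exI)
  show "\<bar>x 0 - y 0\<bar> \<le> 1 * L2_set (\<lambda>i. x i - y i) {..<1}" for x y :: "nat \<Rightarrow> real"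
    by (simp add: L2_set_def)
  fix i :: nat and x :: "nat \<Rightarrow> real" assume "i < 1"
  then show "((\<lambda>t. (x(i := t)) 0) has_real_derivative 1) (at (x i))" by simp
qed simp

context gradient_structure
begin

lemma Gamma_eq_inner:
  assumes u: "u \<in> \<D>" and v: "v \<in> \<D>"
  shows "AE w in M. \<Gamma> u v w = Dg u w \<bullet> Dg v w"
proof -
  let ?s = "\<lambda>w. u w + v w"
  have s: "?s \<in> \<D>" by (rule domain_add[OF u v])
  have "AE w in M. \<Gamma> ?s ?s w = (norm (Dg u w + Dg v w))\<^sup>2"
    using Gamma_linear_diagonal[OF u v, of 1 1] by simp
  then show ?thesis
    using Gamma_add[OF u v s] Gamma_sym[OF u s] Gamma_sym[OF v s] Gamma_add[OF u v u] Gamma_add[OF u v v]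
      Gamma_sym[OF u v] gradient_norm[OF u] gradient_norm[OF v]
    by eventually_elim (simp add: power2_norm_eq_inner inner_simps inner_commute)
qed

text \<open>
  The functional calculus expresses \<open>\<Gamma>\<close> on \<open>u \<circ> X\<close> and on the coordinates of \<open>X\<close>. These values are the
  inner products of the gradients, and they say that the squared distance between the two sides
  of the chain rule vanishes.
\<close>

lemma gradient_chain_rule:
  fixes X :: "'w \<Rightarrow> real^'d"
  assumes X: "admissible X" and lip: "C-lipschitz_on UNIV u"
    and g: "\<And>x. GDERIV u x :> g x" "continuous_on UNIV g"
  shows "(\<lambda>w. u (X w)) \<in> \<D>" and "AE w in M. Dg (\<lambda>w. u (X w)) w = pullback X g w"
proof -
  let ?k = "CARD('d)"
  obtain en :: "nat \<Rightarrow> 'd" where en: "bij_betw en {..<?k} UNIV"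
    using ex_bij_betw_nat_finite[of "UNIV :: 'd set"] by (auto simp: atLeast0LessThan)
  define idx where "idx = the_inv_into {..<?k} en"
  have idx: "en (idx i) = i" "idx i < ?k" for i
  proof -
    show "en (idx i) = i" unfolding idx_def using en by (intro f_the_inv_into_f_bij_betw) auto
    have "idx i \<in> {..<?k}"
      unfolding idx_def using en by (intro the_inv_into_into) (auto simp: bij_betw_def)
    then show "idx i < ?k" by simp
  qed
  note C1 = C1_Lipschitz_nat_of_GDERIV[OF lip g en idx]
  let ?us = "\<lambda>j w. X w $ en j"
  let ?u = "\<lambda>w. u (X w)"
  have us: "?us j \<in> \<D>" for j using X by (simp add: admissible_def)
  have Xi: "(\<lambda>w. X w $ i) \<in> \<D>" for i using X by (simp add: admissible_def)
  have eq: "(\<chi> i. X w $ en (idx i)) = X w" for w by (simp add: idx(1))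
  show uD: "?u \<in> \<D>" using domain_C1[OF C1, of ?us] us by (simp add: eq)
  have sum_en: "(\<Sum>j<?k. h (en j)) = (\<Sum>i\<in>UNIV. h i)" for h :: "'d \<Rightarrow> real"
    by (rule sum.reindex_bij_betw[OF en])
  have cross: "AE w in M. \<Gamma> ?u (\<lambda>w. X w $ i) w = (\<Sum>l\<in>UNIV. g (X w) $ l * \<Gamma> (\<lambda>w. X w $ l) (\<lambda>w. X w $ i) w)" for i
    using Gamma_C1[OF C1 _ C1_Lipschitz_nat_coordinate, of ?us "\<lambda>_ w. X w $ i"] us Xi
    by (simp add: eq sum_en[of "\<lambda>l. g (X _) $ l * \<Gamma> (\<lambda>w. X w $ l) (\<lambda>w. X w $ i) _"])
  have square: "AE w in M. \<Gamma> ?u ?u w =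
      (\<Sum>l\<in>UNIV. \<Sum>m\<in>UNIV. g (X w) $ l * g (X w) $ m * \<Gamma> (\<lambda>w. X w $ l) (\<lambda>w. X w $ m) w)"
  proof -
    have "AE w in M. \<Gamma> ?u ?u w = (\<Sum>l<?k. \<Sum>m<?k. g (X w) $ en l * g (X w) $ en m * \<Gamma> (?us l) (?us m) w)"
      using Gamma_C1[OF C1 _ C1, of ?us ?us] us by (simp add: eq)
    then show ?thesis
    proof eventually_elim
      case (elim w)
      show ?case
        unfolding elim sum_en[of "\<lambda>m. g (X w) $ en _ * g (X w) $ m * \<Gamma> (?us _) (\<lambda>w. X w $ m) w"]
        by (rule sum_en)
    qed
  qed
  have "AE w in M. \<forall>i. \<Gamma> ?u (\<lambda>w. X w $ i) w = (\<Sum>l\<in>UNIV. g (X w) $ l * \<Gamma> (\<lambda>w. X w $ l) (\<lambda>w. X w $ i) w)"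
    using cross by (simp add: AE_all_countable)
  moreover have "AE w in M. \<forall>i. \<Gamma> ?u (\<lambda>w. X w $ i) w = Dg ?u w \<bullet> Dg (\<lambda>w. X w $ i) w"
    using Gamma_eq_inner[OF uD Xi] by (simp add: AE_all_countable)
  moreover have "AE w in M. \<forall>l m. \<Gamma> (\<lambda>w. X w $ l) (\<lambda>w. X w $ m) w = Dg (\<lambda>w. X w $ l) w \<bullet> Dg (\<lambda>w. X w $ m) w"
    using Gamma_eq_inner[OF Xi Xi] by (simp add: AE_all_countable)
  moreover note square gradient_norm[OF uD]
  ultimately show "AE w in M. Dg ?u w = pullback X g w"
  proof eventually_elim
    case (elim w)
    let ?D = "\<lambda>i. Dg (\<lambda>w. X w $ i) w"
    let ?p = "pullback X g w"
    \<comment> \<open>inner products with \<open>?p\<close> reduce to values of \<open>\<Gamma>\<close>; both \<open>Dg ?u w \<bullet> ?p\<close> and \<open>norm (Dg ?u w)\<close> squared equal \<open>norm ?p\<close> squared\<close>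
    have Dp: "Dg ?u w \<bullet> ?p = (\<Sum>i\<in>UNIV. g (X w) $ i * (Dg ?u w \<bullet> ?D i))"
      by (simp add: pullback_def inner_sum_right)
    also have "\<dots> = (\<Sum>i\<in>UNIV. \<Sum>l\<in>UNIV. g (X w) $ i * g (X w) $ l * (?D l \<bullet> ?D i))"
    proof (rule sum.cong[OF refl])
      fix i
      have "Dg ?u w \<bullet> ?D i = (\<Sum>l\<in>UNIV. g (X w) $ l * (?D l \<bullet> ?D i))"
        using elim(1,2,3) by simp
      then show "g (X w) $ i * (Dg ?u w \<bullet> ?D i) = (\<Sum>l\<in>UNIV. g (X w) $ i * g (X w) $ l * (?D l \<bullet> ?D i))"
        by (simp add: sum_distrib_left mult.assoc)
    qed
    also have "\<dots> = (norm ?p)\<^sup>2"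
      unfolding norm_pullback by (intro sum.cong refl) (simp add: inner_commute)
    finally have Dp: "Dg ?u w \<bullet> ?p = (norm ?p)\<^sup>2" .
    have "(norm (Dg ?u w))\<^sup>2 = (norm ?p)\<^sup>2"
      using elim(3,4,5) by (simp add: norm_pullback)
    then have "(norm (Dg ?u w - ?p))\<^sup>2 = 0"
      using Dp by (simp add: power2_norm_eq_inner inner_simps inner_commute)
    then show ?case by simp
  qed
qed

text \<open>
  The chain rule for smooth functions extends to the domain of the image structure: gradients of
  smooth approximations converge in $L^2(m, H)$, and the range of \<open>pullback\<close> is closed.
\<close>

lemma image_domain_gradient:
  fixes X :: "'w \<Rightarrow> real^'d"
  assumes X: "admissible X" and F: "F \<in> image_domain M \<D> \<Gamma> X"
  shows "\<exists>\<phi>\<in>L2_Gamma M \<Gamma> X. AE w in M. Dg (\<lambda>w. F (X w)) w = pullback X \<phi> w"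
proof -
  let ?\<Psi> = "Dg (\<lambda>w. F (X w))"
  have FD: "(\<lambda>w. F (X w)) \<in> \<D>" using F by (simp add: image_domain_def)
  note \<Psi> = gradient_square_integrable[OF FD]
  have "\<exists>\<phi>\<in>borel_measurable borel. AE w in M. ?\<Psi> w = pullback X \<phi> w"
  proof (rule pullback_range_closed[OF X \<Psi>])
    fix \<epsilon> :: real assume "\<epsilon> > 0"
    then have "sqrt (\<epsilon> / 2) > 0" by simp
    then obtain u where u: "C1_Lipschitz u"
      and le: "D_norm M \<Gamma> (\<lambda>w. u (X w) - F (X w)) < sqrt (\<epsilon> / 2)"
      using F unfolding image_domain_def by blast
    obtain C g where lip: "C-lipschitz_on UNIV u" and g: "\<And>x. GDERIV u x :> g x" "continuous_on UNIV g"
      using u by (auto simp: C1_Lipschitz_def)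
    note uD = gradient_chain_rule(1)[OF X lip g] and chain = gradient_chain_rule(2)[OF X lip g]
    have gm: "g \<in> borel_measurable borel" by (rule borel_measurable_continuous_onI[OF g(2)])
    note pm = pullback_measurable[OF X gm]
    have sq: "square_integrable M (pullback X g)"
      by (rule square_integrable_AE[OF gradient_square_integrable[OF uD] pm chain])
    let ?d = "\<lambda>w. u (X w) - F (X w)"
    have dD: "?d \<in> \<D>" using domain_linear[OF uD FD, of 1 "-1"] by simp
    have "(\<integral>w. \<Gamma> ?d ?d w \<partial>M) = (\<integral>w. (norm (pullback X g w - ?\<Psi> w))\<^sup>2 \<partial>M)"
    proof (rule integral_cong_AE)
      show "\<Gamma> ?d ?d \<in> borel_measurable M" using Gamma_integrable[OF dD dD] by simp
      show "(\<lambda>w. (norm (pullback X g w - ?\<Psi> w))\<^sup>2) \<in> borel_measurable M"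
        using square_integrable_integrable[OF square_integrable_diff[OF sq \<Psi>]] by simp
      show "AE w in M. \<Gamma> ?d ?d w = (norm (pullback X g w - ?\<Psi> w))\<^sup>2"
        using Gamma_linear_diagonal[OF uD FD, of 1 "-1"] chain by eventually_elim simp
    qed
    moreover have "(\<integral>w. (?d w)\<^sup>2 \<partial>M) + 1/2 * (\<integral>w. \<Gamma> ?d ?d w \<partial>M) < \<epsilon> / 2"
      using le unfolding D_norm_def by (simp only: real_sqrt_less_iff)
    moreover have "0 \<le> (\<integral>w. (?d w)\<^sup>2 \<partial>M)" by simp
    ultimately have "(\<integral>w. (norm (pullback X g w - ?\<Psi> w))\<^sup>2 \<partial>M) < \<epsilon>" by linarith
    then show "\<exists>\<phi>\<in>borel_measurable borel. square_integrable M (pullback X \<phi>) \<and>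
        (\<integral>w. (norm (pullback X \<phi> w - ?\<Psi> w))\<^sup>2 \<partial>M) < \<epsilon>"
      using gm sq by blast
  qed
  then obtain \<phi> where \<phi>: "\<phi> \<in> borel_measurable borel" "AE w in M. ?\<Psi> w = pullback X \<phi> w" by blast
  then have "\<phi> \<in> L2_Gamma M \<Gamma> X"
    using L2_Gamma_iff[OF X \<phi>(1)] square_integrable_AE[OF \<Psi> pullback_measurable[OF X \<phi>(1)] \<phi>(2)] by simp
  with \<phi>(2) show ?thesis by blast
qed

lemma truncate_tendsto:
  fixes X :: "'w \<Rightarrow> real^'d"
  assumes X: "admissible X" and \<phi>: "\<phi> \<in> L2_Gamma M \<Gamma> X"
  shows "(\<lambda>k. \<integral>w. (norm (pullback X (truncate \<phi> k) w - pullback X \<phi> w))\<^sup>2 \<partial>M) \<longlonglongrightarrow> 0"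
proof -
  have \<phi>m: "\<phi> \<in> borel_measurable borel" using \<phi> by (simp add: L2_Gamma_def)
  have sq: "square_integrable M (pullback X \<phi>)" using L2_Gamma_iff[OF X \<phi>m] \<phi> by simp
  note pm = pullback_measurable[OF X]
  have "(\<lambda>k. \<integral>w. (norm (pullback X (truncate \<phi> k) w - pullback X \<phi> w))\<^sup>2 \<partial>M) \<longlonglongrightarrow> (\<integral>w. 0 \<partial>M)"
  proof (rule integral_dominated_convergence[where w = "\<lambda>w. (norm (pullback X \<phi> w))\<^sup>2"])
    show "(\<lambda>w. (norm (pullback X (truncate \<phi> k) w - pullback X \<phi> w))\<^sup>2) \<in> borel_measurable M" for k
      using borel_measurable_diff[OF pm[OF truncate_measurable(2)[OF \<phi>m]] pm[OF \<phi>m]] by measurable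
    show "integrable M (\<lambda>w. (norm (pullback X \<phi> w))\<^sup>2)" by (rule square_integrable_integrable[OF sq])
    show "AE w in M. norm ((norm (pullback X (truncate \<phi> k) w - pullback X \<phi> w))\<^sup>2) \<le> (norm (pullback X \<phi> w))\<^sup>2" for k
      by (intro AE_I2) (auto simp: pullback_truncate split: split_indicator)
    \<comment> \<open>at each point the truncations are eventually constant\<close>
    show "AE w in M. (\<lambda>k. (norm (pullback X (truncate \<phi> k) w - pullback X \<phi> w))\<^sup>2) \<longlonglongrightarrow> 0"
    proof (intro AE_I2)
      fix w
      obtain k0 :: nat where "norm (\<phi> (X w)) \<le> real k0" using real_arch_simple by blast
      then have "(norm (pullback X (truncate \<phi> k) w - pullback X \<phi> w))\<^sup>2 = 0" if "k \<ge> k0" for k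
        using that by (auto simp: pullback_truncate split: split_indicator)
      then show "(\<lambda>k. (norm (pullback X (truncate \<phi> k) w - pullback X \<phi> w))\<^sup>2) \<longlonglongrightarrow> 0"
        by (intro tendsto_eventually eventually_sequentiallyI)
    qed
  qed simp
  then show ?thesis by simp
qed

end

section \<open>The gradient of an image structure\<close>

locale noisy_gradient_structure = gradient_structure M \<D> \<Gamma> Dg + hilbert_noise P M N e \<nu>
  for M :: "'w measure" and \<D> :: "('w \<Rightarrow> real) set"
    and \<Gamma> :: "('w \<Rightarrow> real) \<Rightarrow> ('w \<Rightarrow> real) \<Rightarrow> 'w \<Rightarrow> real"
    and Dg :: "('w \<Rightarrow> real) \<Rightarrow> 'w \<Rightarrow> 'h::{real_inner, banach, second_countable_topology}"
    and P :: "'o measure" and N :: "nat set" and e :: "nat \<Rightarrow> 'h"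
    and \<nu> :: "nat \<Rightarrow> 'w set \<Rightarrow> 'o \<Rightarrow> real"
begin

abbreviation dG :: "('w \<Rightarrow> real) \<Rightarrow> 'w set \<Rightarrow> 'o \<Rightarrow> real" where
  "dG \<equiv> measure_gradient P M N e \<nu> Dg"

lemma image_measure_gradient_eq:
  "image_measure_gradient M dG X F A = I (Dg (\<lambda>w. F (X w))) (X -` A \<inter> space M)"
  by (simp add: image_measure_gradient_def wn_image_def measure_gradient_def)

text \<open>
  The measure associated with the scalar noise of the \<open>i\<close>-th coordinate of \<open>X\<close>, transported to $\mathbb{R}^d$.
\<close>

definition image_density :: "('w \<Rightarrow> real^'d) \<Rightarrow> 'd \<Rightarrow> (real^'d) measure" where
  "image_density X i = density (distr M borel X) (\<lambda>x. ennreal (Gamma_matrix M \<Gamma> X x $ i $ i))"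

lemma pullback_axis: "pullback X (\<lambda>x. axis i (f x)) w = f (X w) *\<^sub>R Dg (\<lambda>w. X w $ i) w"
proof -
  have "pullback X (\<lambda>x. axis i (f x)) w = (\<Sum>j\<in>UNIV. if j = i then f (X w) *\<^sub>R Dg (\<lambda>w. X w $ i) w else 0)"
    unfolding pullback_def by (intro sum.cong) (auto simp: axis_def)
  then show ?thesis by simp
qed

lemma image_density_sets [simp]: "sets (image_density X i) = sets borel"
  by (simp add: image_density_def)

lemma axis_measurable: "f \<in> borel_measurable borel \<Longrightarrow> (\<lambda>x. axis i (f x) :: real^'d) \<in> borel_measurable borel"
  by (rule borel_measurable_vec) (auto simp: axis_def)

text \<open>
  The form of the field \<open>f\<close> times the \<open>i\<close>-th unit vector has only the diagonal entry of the matrix.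
\<close>

lemma image_density_L2_iff:
  fixes X :: "'w \<Rightarrow> real^'d"
  assumes X: "admissible X"
  shows "f \<in> L2 (image_density X i) \<longleftrightarrow>
    f \<in> borel_measurable borel \<and> square_integrable M (\<lambda>w. f (X w) *\<^sub>R Dg (\<lambda>w. X w $ i) w)" (is ?iff)
    and "f \<in> borel_measurable borel \<Longrightarrow>
      (\<integral>x. (f x)\<^sup>2 \<partial>image_density X i) = (\<integral>w. (norm (f (X w) *\<^sub>R Dg (\<lambda>w. X w $ i) w))\<^sup>2 \<partial>M)"
proof -
  note Xm = admissible_measurable[OF X] and Gm = Gamma_matrix_measurable[OF X, of i i]
  have form: "Gamma_form M \<Gamma> X (\<lambda>x. axis i (f x)) x = Gamma_matrix M \<Gamma> X x $ i $ i * (f x)\<^sup>2" for f x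
    by (simp add: Gamma_form_def inner_axis' matrix_vector_mul_component power2_eq_square inner_axis)
  have nonneg: "AE x in distr M borel X. 0 \<le> Gamma_matrix M \<Gamma> X x $ i $ i"
  proof -
    have "AE w in M. 0 \<le> Gamma_matrix M \<Gamma> X (X w) $ i $ i"
      using Gamma_form_nonneg[OF X axis_measurable[of "\<lambda>_. 1" i]] unfolding form by simp
    then show ?thesis using Gm by (subst AE_distr_iff[OF Xm]) auto
  qed
  have Gm': "(\<lambda>x. Gamma_matrix M \<Gamma> X x $ i $ i) \<in> borel_measurable (distr M borel X)"
    using Gm by simp
  have meas: "f \<in> borel_measurable (image_density X i) \<longleftrightarrow> f \<in> borel_measurable borel"
    by (simp add: image_density_def)
  show ?iff
  proof (cases "f \<in> borel_measurable borel")
    case True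
    have "f \<in> L2 (image_density X i) \<longleftrightarrow> integrable (distr M borel X) (\<lambda>x. Gamma_matrix M \<Gamma> X x $ i $ i * (f x)\<^sup>2)"
      unfolding L2_def using True meas integrable_real_density[OF Gm' nonneg, of "\<lambda>x. (f x)\<^sup>2"]
      by (simp add: image_density_def)
    also have "\<dots> \<longleftrightarrow> (\<lambda>x. axis i (f x)) \<in> L2_Gamma M \<Gamma> X"
      using axis_measurable[OF True, of i] by (simp add: L2_Gamma_def form[abs_def])
    also have "\<dots> \<longleftrightarrow> square_integrable M (\<lambda>w. f (X w) *\<^sub>R Dg (\<lambda>w. X w $ i) w)"
      unfolding L2_Gamma_iff[OF X axis_measurable[OF True]] by (simp add: pullback_axis[abs_def])
    finally show ?thesis using True by simp
  next
    case False
    then show ?thesis using meas by (simp add: L2_def)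
  qed
  assume f: "f \<in> borel_measurable borel"
  have "(\<integral>x. (f x)\<^sup>2 \<partial>image_density X i) = (\<integral>x. Gamma_matrix M \<Gamma> X x $ i $ i * (f x)\<^sup>2 \<partial>distr M borel X)"
    unfolding image_density_def using f by (intro integral_real_density[OF Gm' nonneg]) simp
  also have "\<dots> = (\<integral>w. (norm (pullback X (\<lambda>x. axis i (f x)) w))\<^sup>2 \<partial>M)"
    using Gamma_form_integral[OF X axis_measurable[OF f, of i]] by (simp add: form[abs_def])
  finally show "(\<integral>x. (f x)\<^sup>2 \<partial>image_density X i) = (\<integral>w. (norm (f (X w) *\<^sub>R Dg (\<lambda>w. X w $ i) w))\<^sup>2 \<partial>M)"
    by (simp add: pullback_axis)
qed

lemma image_density_finite:
  fixes X :: "'w \<Rightarrow> real^'d"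
  assumes X: "admissible X"
  shows "finite_measure (image_density X i)"
proof -
  have "(\<lambda>x. 1) \<in> L2 (image_density X i)"
    using image_density_L2_iff(1)[OF X, of "\<lambda>_. 1" i] X gradient_square_integrable
    by (simp add: admissible_def)
  then have "integrable (image_density X i) (\<lambda>x. 1 :: real)" by (simp add: L2_def)
  then have "emeasure (image_density X i) (space (image_density X i)) < \<infinity>"
    by (simp add: integrable_iff_bounded del: space_density)
  then show ?thesis by (intro finite_measureI) (simp only: less_top infinity_ennreal_def)
qed

text \<open>
  An explicit integral against the transported noise of the \<open>i\<close>-th coordinate; by uniqueness of
  extensions it is the integral that defines $\varphi^t\, d_GI$.
\<close>

lemma image_noise_extension:
  fixes X :: "'w \<Rightarrow> real^'d"
  assumes X: "admissible X"
  shows "wn_extension P (image_density X i) (image_measure_gradient M dG X (\<lambda>y. y $ i))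
    (\<lambda>f. I (\<lambda>w. f (X w) *\<^sub>R Dg (\<lambda>w. X w $ i) w) (space M))"
proof -
  let ?G = "Dg (\<lambda>w. X w $ i)"
  let ?K = "\<lambda>f. I (\<lambda>w. f (X w) *\<^sub>R ?G w) (space M)"
  let ?lam = "image_measure_gradient M dG X (\<lambda>y. y $ i)"
  note Xm = admissible_measurable[OF X]
  note L2 = image_density_L2_iff[OF X]
  have top: "space M \<in> sets M" by simp
  have G: "square_integrable M ?G" using X gradient_square_integrable by (simp add: admissible_def)
  show ?thesis
    unfolding wn_extension_def
  proof (intro conjI ballI allI)
    fix f assume f: "f \<in> L2 (image_density X i)"
    then have sq: "square_integrable M (\<lambda>w. f (X w) *\<^sub>R ?G w)" and fm: "f \<in> borel_measurable borel"
      by (simp_all add: L2)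
    show "?K f \<in> L2 P" by (rule wn_inner_L2[OF sq top])
    have "(\<integral>\<omega>. (?K f \<omega>)\<^sup>2 \<partial>P) = (\<integral>w. (norm (f (X w) *\<^sub>R ?G w))\<^sup>2 \<partial>M)"
      unfolding power2_eq_square[of "?K f _"] wn_inner_covariance[OF sq top sq top]
      by (intro Bochner_Integration.integral_cong refl) (simp only: power2_norm_eq_inner, simp)
    then show "(\<integral>\<omega>. (?K f \<omega>)\<^sup>2 \<partial>P) = (\<integral>x. (f x)\<^sup>2 \<partial>image_density X i)" by (simp only: L2(2)[OF fm])
    show "AE \<omega> in P. ?K (\<lambda>x. c * f x) \<omega> = c * ?K f \<omega>" for c
      using wn_inner_linear[OF sq sq top, of c 0] by simp
    fix g assume "g \<in> L2 (image_density X i)"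
    then have sq': "square_integrable M (\<lambda>w. g (X w) *\<^sub>R ?G w)" by (simp add: L2)
    show "AE \<omega> in P. ?K (\<lambda>x. f x + g x) \<omega> = ?K f \<omega> + ?K g \<omega>"
      using wn_inner_linear[OF sq sq' top, of 1 1] by (simp add: scaleR_left_distrib)
  next
    fix A assume "A \<in> sets (image_density X i)"
    then have A: "A \<in> sets borel" by simp
    have XA: "X -` A \<inter> space M \<in> sets M" by (rule measurable_sets[OF Xm A])
    have "(indicator A :: real^'d \<Rightarrow> real) \<in> L2 (image_density X i)"
      by (rule L2_indicator[OF image_density_finite[OF X]]) (simp add: A)
    then have sq: "square_integrable M (\<lambda>w. indicator A (X w) *\<^sub>R ?G w)" by (simp add: L2)
    show "AE \<omega> in P. ?K (indicator A) \<omega> = ?lam A \<omega>"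
      unfolding image_measure_gradient_eq wn_inner_eq_iff[OF sq top G XA]
      by (intro AE_I2) (auto split: split_indicator)
  qed
qed

lemma wn_integral_image:
  fixes X :: "'w \<Rightarrow> real^'d"
  assumes X: "admissible X" and f: "f \<in> L2 (image_density X i)"
  shows "wn_integral P (image_density X i) (image_measure_gradient M dG X (\<lambda>y. y $ i)) f \<in> L2 P"
    and "AE \<omega> in P. wn_integral P (image_density X i) (image_measure_gradient M dG X (\<lambda>y. y $ i)) f \<omega> =
      I (\<lambda>w. f (X w) *\<^sub>R Dg (\<lambda>w. X w $ i) w) (space M) \<omega>"
proof -
  note ext = image_noise_extension[OF X, of i]
  note ext' = wn_extension_wn_integral[OF ext]
  show "wn_integral P (image_density X i) (image_measure_gradient M dG X (\<lambda>y. y $ i)) f \<in> L2 P"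
    by (rule wn_extension_L2[OF ext' f])
  show "AE \<omega> in P. wn_integral P (image_density X i) (image_measure_gradient M dG X (\<lambda>y. y $ i)) f \<omega> =
      I (\<lambda>w. f (X w) *\<^sub>R Dg (\<lambda>w. X w $ i) w) (space M) \<omega>"
    by (rule wn_extension_unique[OF image_density_finite[OF X] ext' ext f])
qed

lemma dGI_integral_bounded_eq:
  fixes X :: "'w \<Rightarrow> real^'d"
  assumes X: "admissible X" and \<phi>: "\<phi> \<in> borel_measurable borel" and bound: "bounded (range \<phi>)"
    and A: "A \<in> sets borel"
  shows "dGI_integral_bounded M \<Gamma> P dG X \<phi> A \<in> borel_measurable P"
    and "AE \<omega> in P. I (pullback X \<phi>) (X -` A \<inter> space M) \<omega> = dGI_integral_bounded M \<Gamma> P dG X \<phi> A \<omega>"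
    and "square_integrable M (pullback X \<phi>)"
proof -
  note Xm = admissible_measurable[OF X]
  have XA: "X -` A \<inter> space M \<in> sets M" by (rule measurable_sets[OF Xm A])
  have top: "space M \<in> sets M" by simp
  let ?f = "\<lambda>i x. indicator A x * \<phi> x $ i"
  let ?J = "\<lambda>i. wn_integral P (image_density X i) (image_measure_gradient M dG X (\<lambda>y. y $ i)) (?f i)"
  let ?D = "\<lambda>i. Dg (\<lambda>w. X w $ i)"
  obtain c where c: "\<And>x. norm (\<phi> x) \<le> c" using bound by (auto simp: bounded_iff)
  have \<phi>i: "(\<lambda>x. \<phi> x $ i) \<in> borel_measurable borel" for i by (rule borel_measurable_vec_nth[OF \<phi>])
  have bd: "square_integrable M (\<lambda>w. h (X w) *\<^sub>R ?D i w)"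
    if h: "h \<in> borel_measurable borel" and hc: "\<And>x. \<bar>h x\<bar> \<le> c" for h i
  proof (rule square_integrable_bound)
    have Di: "square_integrable M (?D i)" using X gradient_square_integrable by (simp add: admissible_def)
    show "square_integrable M (\<lambda>w. c *\<^sub>R ?D i w)" by (rule square_integrable_scaleR[OF Di])
    show "(\<lambda>w. h (X w) *\<^sub>R ?D i w) \<in> borel_measurable M"
      by (intro borel_measurable_scaleR measurable_compose[OF Xm h] square_integrable_measurable[OF Di])
    show "AE w in M. norm (h (X w) *\<^sub>R ?D i w) \<le> norm (c *\<^sub>R ?D i w)"
      using hc by (intro AE_I2) (auto intro!: mult_right_mono intro: order_trans[OF _ abs_ge_self])
  qed
  have cb: "\<bar>\<phi> x $ i\<bar> \<le> c" for x i using component_le_norm_cart[of "\<phi> x" i] c[of x] by simp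
  show sq: "square_integrable M (pullback X \<phi>)"
    unfolding pullback_def[abs_def] by (intro square_integrable_sum bd \<phi>i cb)
  have fm: "?f i \<in> borel_measurable borel" for i using A \<phi>i by measurable
  have fc: "\<bar>?f i x\<bar> \<le> c" for i x
    using cb[of x i] by (auto split: split_indicator intro: order_trans[OF abs_ge_zero])
  have f: "?f i \<in> L2 (image_density X i)" for i
    using image_density_L2_iff(1)[OF X] fm bd[OF fm fc] by simp
  have J: "AE \<omega> in P. ?J i \<omega> = I (\<lambda>w. ?f i (X w) *\<^sub>R ?D i w) (space M) \<omega>" for i
    by (rule wn_integral_image(2)[OF X f])
  have split: "AE \<omega> in P. I (\<lambda>w. \<Sum>i\<in>S. ?f i (X w) *\<^sub>R ?D i w) (space M) \<omega> =
      (\<Sum>i\<in>S. I (\<lambda>w. ?f i (X w) *\<^sub>R ?D i w) (space M) \<omega>)" if "finite S" for S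
    using that
  proof induction
    case empty
    show ?case using wn_inner_linear[OF square_integrable_zero square_integrable_zero top, of 0 0] by simp
  next
    case (insert i S)
    have "square_integrable M (\<lambda>w. \<Sum>i\<in>S. ?f i (X w) *\<^sub>R ?D i w)"
      by (intro square_integrable_sum bd fm fc)
    from wn_inner_linear[OF bd[OF fm fc, of i i] this top, of 1 1] insert
    show ?case by (auto simp: scaleR_sum_right)
  qed
  have eq: "dGI_integral_bounded M \<Gamma> P dG X \<phi> A = (\<lambda>\<omega>. \<Sum>i\<in>UNIV. ?J i \<omega>)"
    by (simp add: fun_eq_iff dGI_integral_bounded_def image_density_def)
  have sqf: "square_integrable M (\<lambda>w. \<Sum>i\<in>UNIV. ?f i (X w) *\<^sub>R ?D i w)"
    by (intro square_integrable_sum bd fm fc)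
  have "AE \<omega> in P. I (pullback X \<phi>) (X -` A \<inter> space M) \<omega> =
      I (\<lambda>w. \<Sum>i\<in>UNIV. ?f i (X w) *\<^sub>R ?D i w) (space M) \<omega>"
    unfolding wn_inner_eq_iff[OF sq XA sqf top]
    by (intro AE_I2) (auto simp: pullback_def split: split_indicator)
  moreover have "AE \<omega> in P. \<forall>i. ?J i \<omega> = I (\<lambda>w. ?f i (X w) *\<^sub>R ?D i w) (space M) \<omega>"
    using J by (simp add: AE_all_countable)
  moreover note split[OF finite_class.finite_UNIV]
  ultimately show "AE \<omega> in P. I (pullback X \<phi>) (X -` A \<inter> space M) \<omega> = dGI_integral_bounded M \<Gamma> P dG X \<phi> A \<omega>"
    unfolding eq by eventually_elim simp
  show "dGI_integral_bounded M \<Gamma> P dG X \<phi> A \<in> borel_measurable P"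
    unfolding eq by (intro borel_measurable_sum L2_measurable wn_integral_image(1)[OF X f])
qed

text \<open>
  The product $\varphi^t\, d_GI$ is the transported noise of the field \<open>pullback X \<phi>\<close>. For bounded
  \<open>\<phi>\<close> this is linearity of the noise, and both sides are continuous in \<open>\<phi>\<close>.
\<close>

lemma dGI_integral_eq:
  fixes X :: "'w \<Rightarrow> real^'d"
  assumes X: "admissible X" and \<phi>: "\<phi> \<in> L2_Gamma M \<Gamma> X" and A: "A \<in> sets borel"
  shows "AE \<omega> in P. dGI_integral M \<Gamma> P dG X \<phi> A \<omega> = I (pullback X \<phi>) (X -` A \<inter> space M) \<omega>"
proof -
  note Xm = admissible_measurable[OF X]
  have XA: "X -` A \<inter> space M \<in> sets M" by (rule measurable_sets[OF Xm A])
  have \<phi>m: "\<phi> \<in> borel_measurable borel" using \<phi> by (simp add: L2_Gamma_def)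
  have sq: "square_integrable M (pullback X \<phi>)" using L2_Gamma_iff[OF X \<phi>m] \<phi> by simp
  let ?Y = "I (pullback X \<phi>) (X -` A \<inter> space M)"
  let ?admits = "\<lambda>\<psi> :: nat \<Rightarrow> real^'d \<Rightarrow> real^'d. (\<forall>k. \<psi> k \<in> borel_measurable borel \<and> bounded (range (\<psi> k))) \<and>
     (\<lambda>k. \<integral>x. Gamma_form M \<Gamma> X (\<lambda>x. \<psi> k x - \<phi> x) x \<partial>distr M borel X) \<longlonglongrightarrow> 0"
  have lim: "L2_tendsto P (\<lambda>k. dGI_integral_bounded M \<Gamma> P dG X (\<psi> k) A) ?Y" if \<psi>: "?admits \<psi>" for \<psi>
  proof -
    have \<psi>m: "\<psi> k \<in> borel_measurable borel" and \<psi>b: "bounded (range (\<psi> k))" for k using \<psi> by auto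
    note b = dGI_integral_bounded_eq[OF X \<psi>m \<psi>b A]
    have "(\<integral>\<omega>. (I (pullback X (\<psi> k)) (X -` A \<inter> space M) \<omega> - ?Y \<omega>)\<^sup>2 \<partial>P) \<le>
        (\<integral>x. Gamma_form M \<Gamma> X (\<lambda>x. \<psi> k x - \<phi> x) x \<partial>distr M borel X)" for k
    proof -
      have d: "square_integrable M (\<lambda>w. pullback X (\<psi> k) w - pullback X \<phi> w)"
        by (rule square_integrable_diff[OF b(3) sq])
      have "(\<integral>\<omega>. (I (pullback X (\<psi> k)) (X -` A \<inter> space M) \<omega> - ?Y \<omega>)\<^sup>2 \<partial>P) =
          (\<integral>w. (norm (indicator (X -` A \<inter> space M) w *\<^sub>R (pullback X (\<psi> k) w - pullback X \<phi> w)))\<^sup>2 \<partial>M)"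
        unfolding wn_inner_norm_diff[OF b(3) XA sq XA] by (simp only: scaleR_diff_right)
      also have "\<dots> \<le> (\<integral>w. (norm (pullback X (\<psi> k) w - pullback X \<phi> w))\<^sup>2 \<partial>M)"
        by (rule integral_mono[OF square_integrable_integrable[OF square_integrable_indicator[OF d XA]]
              square_integrable_integrable[OF d]]) (auto split: split_indicator)
      also have "\<dots> = (\<integral>x. Gamma_form M \<Gamma> X (\<lambda>x. \<psi> k x - \<phi> x) x \<partial>distr M borel X)"
        using Gamma_form_integral[OF X borel_measurable_diff[OF \<psi>m \<phi>m], of k] by (simp add: pullback_diff)
      finally show ?thesis .
    qed
    then have "(\<lambda>k. \<integral>\<omega>. (I (pullback X (\<psi> k)) (X -` A \<inter> space M) \<omega> - ?Y \<omega>)\<^sup>2 \<partial>P) \<longlonglongrightarrow> 0"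
      by (intro tendsto_sandwich[OF always_eventually always_eventually tendsto_const conjunct2[OF \<psi>]]) auto
    then have "L2_tendsto P (\<lambda>k. I (pullback X (\<psi> k)) (X -` A \<inter> space M)) ?Y"
      unfolding L2_tendsto_def using wn_inner_L2[OF b(3) XA] wn_inner_L2[OF sq XA] by blast
    then show ?thesis
      by (rule L2_tendsto_AE[OF _ b(1) b(2) L2_measurable[OF wn_inner_L2[OF sq XA]]]) simp
  qed
  have "?admits (truncate \<phi>)"
  proof (intro conjI allI)
    show "truncate \<phi> k \<in> borel_measurable borel" for k by (rule truncate_measurable[OF \<phi>m])
    show "bounded (range (truncate \<phi> k))" for k
      unfolding bounded_iff using norm_truncate_le[of \<phi> k] by blast
    show "(\<lambda>k. \<integral>x. Gamma_form M \<Gamma> X (\<lambda>x. truncate \<phi> k x - \<phi> x) x \<partial>distr M borel X) \<longlonglongrightarrow> 0"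
      using truncate_tendsto[OF X \<phi>] Gamma_form_integral[OF X borel_measurable_diff[OF truncate_measurable(2)[OF \<phi>m] \<phi>m]]
      by (simp add: pullback_diff)
  qed
  let ?Q = "\<lambda>Z. \<exists>\<psi>. (\<forall>k. \<psi> k \<in> borel_measurable borel \<and> bounded (range (\<psi> k))) \<and>
     (\<lambda>k. \<integral>x. Gamma_form M \<Gamma> X (\<lambda>x. \<psi> k x - \<phi> x) x \<partial>distr M borel X) \<longlonglongrightarrow> 0 \<and>
     L2_tendsto P (\<lambda>k. dGI_integral_bounded M \<Gamma> P dG X (\<psi> k) A) Z"
  have "?Q ?Y" using \<open>?admits (truncate \<phi>)\<close> lim[OF \<open>?admits (truncate \<phi>)\<close>] by blast
  then have "?Q (dGI_integral M \<Gamma> P dG X \<phi> A)" unfolding dGI_integral_def by (rule someI[of ?Q])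
  then obtain \<psi> where "?admits \<psi>"
    and Z: "L2_tendsto P (\<lambda>k. dGI_integral_bounded M \<Gamma> P dG X (\<psi> k) A) (dGI_integral M \<Gamma> P dG X \<phi> A)"
    by blast
  from L2_tendsto_unique[OF Z lim[OF \<open>?admits \<psi>\<close>]] show ?thesis .
qed

text \<open>
  The characterization of the gradient of an image structure by vector fields. The equation
  between noises that defines \<open>nabla\<close> says that the two fields have the same noise, and the noise
  of a field determines the field. Existence of a solution, which is what makes the choice in
  \<open>nabla\<close> meaningful, is \<open>image_domain_gradient\<close>.
\<close>

lemma gradient_eq_pullback_nabla:
  fixes X :: "'w \<Rightarrow> real^'d"
  assumes X: "admissible X" and F: "F \<in> image_domain M \<D> \<Gamma> X"
  shows "nabla M \<Gamma> P dG X F \<in> L2_Gamma M \<Gamma> X"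
    and "AE w in M. Dg (\<lambda>w. F (X w)) w = pullback X (nabla M \<Gamma> P dG X F) w"
proof -
  note Xm = admissible_measurable[OF X]
  have "(\<lambda>w. F (X w)) \<in> \<D>" using F by (simp add: image_domain_def)
  note sqF = gradient_square_integrable[OF this]
  let ?Q = "\<lambda>\<phi>. \<phi> \<in> L2_Gamma M \<Gamma> X \<and> (\<forall>A\<in>sets borel. AE \<omega> in P.
        image_measure_gradient M dG X F A \<omega> = dGI_integral M \<Gamma> P dG X \<phi> A \<omega>)"
  have sq: "square_integrable M (pullback X \<phi>)" if "\<phi> \<in> L2_Gamma M \<Gamma> X" for \<phi>
    using that L2_Gamma_iff[OF X] by (auto simp: L2_Gamma_def)
  obtain \<phi> where \<phi>: "\<phi> \<in> L2_Gamma M \<Gamma> X" "AE w in M. Dg (\<lambda>w. F (X w)) w = pullback X \<phi> w"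
    using image_domain_gradient[OF X F] by blast
  have "?Q \<phi>"
  proof (intro conjI ballI)
    fix A :: "(real^'d) set" assume A: "A \<in> sets borel"
    have XA: "X -` A \<inter> space M \<in> sets M" by (rule measurable_sets[OF Xm A])
    have "AE \<omega> in P. image_measure_gradient M dG X F A \<omega> = I (pullback X \<phi>) (X -` A \<inter> space M) \<omega>"
      unfolding image_measure_gradient_eq wn_inner_eq_iff[OF sqF XA sq[OF \<phi>(1)] XA]
      using \<phi>(2) by eventually_elim simp
    then show "AE \<omega> in P. image_measure_gradient M dG X F A \<omega> = dGI_integral M \<Gamma> P dG X \<phi> A \<omega>"
      using dGI_integral_eq[OF X \<phi>(1) A] by eventually_elim simp
  qed (rule \<phi>(1))
  then have Q: "?Q (nabla M \<Gamma> P dG X F)" unfolding nabla_def by (rule someI[of ?Q])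
  then show L2: "nabla M \<Gamma> P dG X F \<in> L2_Gamma M \<Gamma> X" by blast
  \<comment> \<open>the noise on the whole space already determines the field\<close>
  have XA: "X -` UNIV \<inter> space M \<in> sets M" by simp
  have "AE \<omega> in P. image_measure_gradient M dG X F UNIV \<omega> = dGI_integral M \<Gamma> P dG X (nabla M \<Gamma> P dG X F) UNIV \<omega>"
    using Q by auto
  then have "AE \<omega> in P. I (Dg (\<lambda>w. F (X w))) (X -` UNIV \<inter> space M) \<omega> =
      I (pullback X (nabla M \<Gamma> P dG X F)) (X -` UNIV \<inter> space M) \<omega>"
    using dGI_integral_eq[OF X L2, of UNIV] unfolding image_measure_gradient_eq by auto
  then have "AE w in M. indicator (X -` UNIV \<inter> space M) w *\<^sub>R Dg (\<lambda>w. F (X w)) w =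
      (indicator (X -` UNIV \<inter> space M) w *\<^sub>R pullback X (nabla M \<Gamma> P dG X F) w :: 'h)"
    unfolding wn_inner_eq_iff[OF sqF XA sq[OF L2] XA] .
  then show "AE w in M. Dg (\<lambda>w. F (X w)) w = pullback X (nabla M \<Gamma> P dG X F) w"
    using AE_space by eventually_elim simp
qed

text \<open>
  The gradient of \<open>G \<circ> U \<circ> X\<close> is expanded first in the gradients of the \<open>U\<^sub>j \<circ> X\<close>, with coefficients
  given by the gradient of \<open>G\<close>, and each of these in the gradients of the coordinates of \<open>X\<close>. The
  field obtained represents the same vector field as \<open>nabla\<close> of \<open>G \<circ> U\<close>, so the two have distance
  \<open>0\<close>. That it is square integrable comes with this identification; the separate products need
  not be.
\<close>

lemma nabla_chain_rule:
  fixes X :: "'w \<Rightarrow> real^'d" and U :: "real^'d \<Rightarrow> real^'p" and G :: "real^'p \<Rightarrow> real"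
  assumes X: "admissible X" and U: "\<And>j. (\<lambda>x. U x $ j) \<in> image_domain M \<D> \<Gamma> X"
    and GU: "(\<lambda>x. G (U x)) \<in> image_domain M \<D> \<Gamma> X" and G: "G \<in> image_domain M \<D> \<Gamma> (U \<circ> X)"
  shows "L2_Gamma_eq M \<Gamma> X (nabla M \<Gamma> P dG X (\<lambda>x. G (U x)))
    (\<lambda>x. \<Sum>j\<in>UNIV. nabla M \<Gamma> P dG (U \<circ> X) G (U x) $ j *\<^sub>R nabla M \<Gamma> P dG X (\<lambda>x. U x $ j) x)"
proof -
  let ?a = "nabla M \<Gamma> P dG X (\<lambda>x. G (U x))"
  let ?g = "nabla M \<Gamma> P dG (U \<circ> X) G" and ?h = "\<lambda>j. nabla M \<Gamma> P dG X (\<lambda>x. U x $ j)"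
  let ?b = "\<lambda>x. \<Sum>j\<in>UNIV. ?g (U x) $ j *\<^sub>R ?h j x"
  have UX: "admissible (U \<circ> X)" using U by (simp add: admissible_def image_domain_def)
  have Um: "U \<in> borel_measurable borel"
    by (rule borel_measurable_vec) (use U in \<open>simp add: image_domain_def\<close>)
  note a = gradient_eq_pullback_nabla[OF X GU] and g = gradient_eq_pullback_nabla[OF UX G] and h = gradient_eq_pullback_nabla[OF X U]
  have gm: "?g \<in> borel_measurable borel" and hm: "?h j \<in> borel_measurable borel" and am: "?a \<in> borel_measurable borel" for j
    using a(1) g(1) h(1) by (simp_all add: L2_Gamma_def)
  have bm: "?b \<in> borel_measurable borel"
    by (intro borel_measurable_sum borel_measurable_scaleR hm borel_measurable_vec_nth measurable_compose[OF Um gm])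
  have b_pull: "pullback X ?b w = (\<Sum>j\<in>UNIV. ?g (U (X w)) $ j *\<^sub>R pullback X (?h j) w)" for w
  proof -
    have "pullback X ?b w = (\<Sum>i\<in>UNIV. \<Sum>j\<in>UNIV. ?g (U (X w)) $ j *\<^sub>R (?h j (X w) $ i *\<^sub>R Dg (\<lambda>w. X w $ i) w))"
      by (simp add: pullback_def scaleR_sum_left)
    also have "\<dots> = (\<Sum>j\<in>UNIV. \<Sum>i\<in>UNIV. ?g (U (X w)) $ j *\<^sub>R (?h j (X w) $ i *\<^sub>R Dg (\<lambda>w. X w $ i) w))"
      by (rule sum.swap)
    finally show ?thesis by (simp add: pullback_def scaleR_sum_right)
  qed
  have hj: "AE w in M. \<forall>j. Dg (\<lambda>w. U (X w) $ j) w = pullback X (?h j) w"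
    using h(2) by (simp add: AE_all_countable)
  have ab: "AE w in M. pullback X ?a w = pullback X ?b w"
    using a(2) g(2) hj
  proof eventually_elim
    case (elim w)
    have "pullback (U \<circ> X) ?g w = pullback X ?b w"
      unfolding b_pull using elim(3) by (simp add: pullback_def[of "U \<circ> X"])
    then show ?case using elim(1,2) by simp
  qed
  have a_sq: "square_integrable M (pullback X ?a)" using a(1) L2_Gamma_iff[OF X am] by simp
  have b_sq: "square_integrable M (pullback X ?b)"
    by (rule square_integrable_AE[OF a_sq pullback_measurable[OF X bm] ab])
  then have "?b \<in> L2_Gamma M \<Gamma> X" using L2_Gamma_iff[OF X bm] by simp
  moreover have "(\<integral>x. Gamma_form M \<Gamma> X (\<lambda>x. ?a x - ?b x) x \<partial>distr M borel X) = 0"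
  proof -
    have "(\<integral>x. Gamma_form M \<Gamma> X (\<lambda>x. ?a x - ?b x) x \<partial>distr M borel X) =
        (\<integral>w. (norm (pullback X ?a w - pullback X ?b w))\<^sup>2 \<partial>M)"
      unfolding Gamma_form_integral[OF X borel_measurable_diff[OF am bm]] by (simp only: pullback_diff)
    also have "\<dots> = 0"
      unfolding square_integrable_null_iff[OF square_integrable_diff[OF a_sq b_sq]] using ab by simp
    finally show ?thesis .
  qed
  ultimately show ?thesis using a(1) by (simp add: L2_Gamma_eq_def)
qed

end

theorem proposition5:
  fixes M :: "'w measure"
    and \<D> :: "('w \<Rightarrow> real) set"
    and \<Gamma> :: "('w \<Rightarrow> real) \<Rightarrow> ('w \<Rightarrow> real) \<Rightarrow> 'w \<Rightarrow> real"
    and Dg :: "('w \<Rightarrow> real) \<Rightarrow> 'w \<Rightarrow> 'h::{real_inner, banach, second_countable_topology}"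
    and P :: "'o measure"
    and N :: "nat set" and e :: "nat \<Rightarrow> 'h"
    and \<nu> :: "nat \<Rightarrow> 'w set \<Rightarrow> 'o \<Rightarrow> real"
    and dG :: "('w \<Rightarrow> real) \<Rightarrow> 'w set \<Rightarrow> 'o \<Rightarrow> real"
    and X :: "'w \<Rightarrow> real^'d"
    and U :: "real^'d \<Rightarrow> real^'p"
    and V :: "real^'p \<Rightarrow> real^'q"
  assumes "error_structure M \<D> \<Gamma>"
    and "D_gradient M \<D> \<Gamma> Dg"
    and "hilbert_white_noise P M N e \<nu>"
    and "dG = measure_gradient P M N e \<nu> Dg"
    and "\<And>i. (\<lambda>w. X w $ i) \<in> \<D>"
    and "\<And>j. (\<lambda>x. U x $ j) \<in> image_domain M \<D> \<Gamma> X"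
    and "\<And>r. (\<lambda>x. (V \<circ> U) x $ r) \<in> image_domain M \<D> \<Gamma> X"
    and "\<And>r. (\<lambda>y. V y $ r) \<in> image_domain M \<D> \<Gamma> (U \<circ> X)"
  shows "\<forall>r. L2_Gamma_eq M \<Gamma> X
           (\<lambda>x. transpose (nabla_matrix M \<Gamma> P dG X (V \<circ> U) x) $ r)
           (\<lambda>x. (transpose (nabla_matrix M \<Gamma> P dG (U \<circ> X) V (U x)) **
                  transpose (nabla_matrix M \<Gamma> P dG X U x)) $ r)"
proof
  fix r
  interpret error_structure M \<D> \<Gamma> by (rule assms(1))
  interpret noisy_gradient_structure M \<D> \<Gamma> Dg P N e \<nu>
    by (intro noisy_gradient_structure.intro gradient_structure.intro gradient_structure_axioms.intro
        hilbert_noise.intro assms(1-3) finite_measure_axioms)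
  have X: "admissible X" using assms(5) by (simp add: admissible_def)
  have left: "transpose (nabla_matrix M \<Gamma> P dG X (V \<circ> U) x) $ r = nabla M \<Gamma> P dG X (\<lambda>x. V (U x) $ r) x" for x
    by (simp add: vec_eq_iff transpose_def nabla_matrix_def)
  have right: "(transpose (nabla_matrix M \<Gamma> P dG (U \<circ> X) V (U x)) ** transpose (nabla_matrix M \<Gamma> P dG X U x)) $ r =
      (\<Sum>j\<in>UNIV. nabla M \<Gamma> P dG (U \<circ> X) (\<lambda>y. V y $ r) (U x) $ j *\<^sub>R nabla M \<Gamma> P dG X (\<lambda>x. U x $ j) x)" for x
    by (simp add: vec_eq_iff transpose_def nabla_matrix_def matrix_matrix_mult_def)
  show "L2_Gamma_eq M \<Gamma> X (\<lambda>x. transpose (nabla_matrix M \<Gamma> P dG X (V \<circ> U) x) $ r)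
      (\<lambda>x. (transpose (nabla_matrix M \<Gamma> P dG (U \<circ> X) V (U x)) ** transpose (nabla_matrix M \<Gamma> P dG X U x)) $ r)"
    unfolding left right unfolding assms(4)
    by (rule nabla_chain_rule[OF X assms(6) _ assms(8)]) (use assms(7)[of r] in simp)
qed

end
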